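(* For any $\omega \in \mathcal{M}$ and any integer $k \geq 3$ there exists a conformal Willmore immersion \[ f_{\omega,k}: \mathbb{C}/(\mathbb{Z}+\omega\mathbb{Z}) \to \mathbb{R}^4 \] which has exactly one point of density $k$ and satisfies $\mathcal{W}(f_{\omega,k}) = 4k\pi$.
   Context: $\mathcal{M} := \{a+ib : b>0,\ 0\le a\le 1/2,\ a^2+b^2\ge 1\}$; every two-dimensional torus is conformally equivalent to some $\mathbb{C}/(\mathbb{Z}+\omega\mathbb{Z})$ with $\omega\in\mathcal M$, equipped with the flat metric induced from $\mathbb{C}$. A conformal immersion of this torus is one whose pull-back metric is a positive multiple of the flat metric. The Willmore energy of an immersion $f:\Sigma\to\mathbb{R}^n$ is $\mathcal{W}(f)=\frac14\int_\Sigma |H|^2\,d\mu$, with $H$ the mean curvature vector and $\mu$ the induced area measure; a Willmore immersion is a critical point of $\mathcal W$. A point of density $k$ of an immersion $f$ is a point $x\in\mathbb{R}^4$ at which the image has density $k$, i.e. whose preimage $f^{-1}(x)$ consists of exactly $k$ points. *)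

theory Defs
  imports "HOL-Analysis.Analysis"
begin

definition moduli_M :: "complex set" where
  "moduli_M = {w. Im w > 0 \<and> 0 \<le> Re w \<and> Re w \<le> 1/2 \<and> (Re w)^2 + (Im w)^2 \<ge> 1}"

text \<open>Maps on the torus C/(Z + w Z) are represented as doubly periodic maps on C.\<close>
definition doubly_periodic :: "complex \<Rightarrow> (complex \<Rightarrow> 'a) \<Rightarrow> bool" where
  "doubly_periodic w f \<longleftrightarrow> (\<forall>z. f (z + 1) = f z \<and> f (z + w) = f z)"

definition fund_dom :: "complex \<Rightarrow> complex set" where
  "fund_dom w = {of_real s + of_real t * w | s t. 0 \<le> s \<and> s < 1 \<and> 0 \<le> t \<and> t < 1}"

definition px :: "(complex \<Rightarrow> 'a::real_normed_vector) \<Rightarrow> complex \<Rightarrow> 'a" where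
  "px f z = vector_derivative (\<lambda>t::real. f (z + of_real t)) (at 0)"

definition py :: "(complex \<Rightarrow> 'a::real_normed_vector) \<Rightarrow> complex \<Rightarrow> 'a" where
  "py f z = vector_derivative (\<lambda>t::real. f (z + \<i> * of_real t)) (at 0)"

fun Ck :: "nat \<Rightarrow> (complex \<Rightarrow> 'a::real_normed_vector) \<Rightarrow> bool" where
  "Ck 0 f = continuous_on UNIV f"
| "Ck (Suc n) f = (f differentiable_on UNIV \<and> Ck n (px f) \<and> Ck n (py f))"

definition smooth :: "(complex \<Rightarrow> 'a::real_normed_vector) \<Rightarrow> bool" where
  "smooth f \<longleftrightarrow> (\<forall>n. Ck n f)"

definition immersion :: "(complex \<Rightarrow> real^4) \<Rightarrow> bool" where
  "immersion f \<longleftrightarrow> smooth f \<and> (\<forall>z. independent {px f z, py f z} \<and> px f z \<noteq> py f z)"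

definition conformal :: "(complex \<Rightarrow> real^4) \<Rightarrow> bool" where
  "conformal f \<longleftrightarrow> (\<exists>c::complex \<Rightarrow> real. \<forall>z. c z > 0 \<and>
      px f z \<bullet> px f z = c z \<and> py f z \<bullet> py f z = c z \<and> px f z \<bullet> py f z = 0)"

definition gE :: "(complex \<Rightarrow> real^4) \<Rightarrow> complex \<Rightarrow> real" where
  "gE f z = px f z \<bullet> px f z"
definition gF :: "(complex \<Rightarrow> real^4) \<Rightarrow> complex \<Rightarrow> real" where
  "gF f z = px f z \<bullet> py f z"
definition gG :: "(complex \<Rightarrow> real^4) \<Rightarrow> complex \<Rightarrow> real" where
  "gG f z = py f z \<bullet> py f z"
definition gdet :: "(complex \<Rightarrow> real^4) \<Rightarrow> complex \<Rightarrow> real" where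
  "gdet f z = gE f z * gG f z - (gF f z)^2"

text \<open>Mean curvature vector H = g^{ij} (d_i d_j f)^perp (trace of the second fundamental form).\<close>
definition mean_curv :: "(complex \<Rightarrow> real^4) \<Rightarrow> complex \<Rightarrow> real^4" where
  "mean_curv f z =
    (let E = gE f z; F = gF f z; G = gG f z; d = gdet f z;
         a11 = G / d; a12 = - F / d; a22 = E / d;
         fx = px f z; fy = py f z;
         A = a11 *\<^sub>R px (px f) z + a12 *\<^sub>R py (px f) z + a12 *\<^sub>R px (py f) z
             + a22 *\<^sub>R py (py f) z;
         T = (a11 * (A \<bullet> fx) + a12 * (A \<bullet> fy)) *\<^sub>R fx
             + (a12 * (A \<bullet> fx) + a22 * (A \<bullet> fy)) *\<^sub>R fy
     in A - T)"

definition willmore :: "complex \<Rightarrow> (complex \<Rightarrow> real^4) \<Rightarrow> real" where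
  "willmore w f = integral (fund_dom w) (\<lambda>z. (norm (mean_curv f z))^2 * sqrt (gdet f z)) / 4"

definition willmore_immersion :: "complex \<Rightarrow> (complex \<Rightarrow> real^4) \<Rightarrow> bool" where
  "willmore_immersion w f \<longleftrightarrow> doubly_periodic w f \<and> immersion f \<and>
     (\<forall>\<phi>::complex \<Rightarrow> real^4. smooth \<phi> \<and> doubly_periodic w \<phi> \<longrightarrow>
        ((\<lambda>t. willmore w (\<lambda>z. f z + t *\<^sub>R \<phi> z)) has_real_derivative 0) (at 0))"

definition density_pt :: "complex \<Rightarrow> (complex \<Rightarrow> real^4) \<Rightarrow> real^4 \<Rightarrow> nat \<Rightarrow> bool" where
  "density_pt w f x k \<longleftrightarrow> finite {z \<in> fund_dom w. f z = x} \<and> card {z \<in> fund_dom w. f z = x} = k"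

end

theory Submission
  imports Defs "HOL-Complex_Analysis.Complex_Analysis"
begin

text \<open>
  Let \<open>F = (G1, G2) / T\<close> be a holomorphic immersion of the torus minus \<open>k\<close> points into \<open>\<complex>\<^sup>2\<close>, with simple poles
  at these points and avoiding the origin; the \<open>G\<close>'s and \<open>T\<close> are theta functions of degree \<open>k\<close>. Its
  inversion \<open>F / |F|\<^sup>2 = (cnj T) G / |G|\<^sup>2\<close> extends smoothly across the poles, all of which are sent to the
  origin. Any other point with \<open>k\<close> preimages would give two theta functions of degree \<open>k\<close> with \<open>k\<close> common
  zeros, which are then proportional by Liouville's theorem.

  The inverted surface is conformal, and its Willmore integrand is the pull-back of the area form of the
  Riemann sphere under \<open>G1 / G2\<close>, that is, the Laplacian of \<open>ln |G|\<^sup>2\<close>; the quasi-periodicity of \<open>G\<close>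
  gives the total \<open>4 k \<pi>\<close>. The surface is Willmore because rotating the mean curvature vector by a quarter
  turn in the normal plane yields a vector field \<open>L\<close> that exhibits the Euler--Lagrange
  equation as a conservation law, so that the first variation is the integral of a divergence.

  An immersion among the candidates is found by a general position argument: for \<open>k \<ge> 3\<close> every point is
  a simple zero of some theta function of degree \<open>k\<close>, hence a generic \<open>G2\<close> has nonvanishing derivative
  (relative to \<open>T\<close>) at the finitely many critical points of \<open>G1 / T\<close>.
\<close>

subsection \<open>Partial derivatives and smooth functions\<close>

text \<open>The obstacle is the poles: \<open>F\<close> blows up there and \<open>G1 / T\<close>
  cannot be differentiated across them. Everything is therefore written in terms of \<open>G\<close>
  and the orthogonal vector \<open>G' = (-cnj G2, cnj G1)\<close>, a frame that is regular
  everywhere because \<open>G\<close> has no zero. The differential of the inverted surface has its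
  \<open>dz\<close> part along \<open>G'\<close> and its \<open>d(cnj z)\<close> part along
  \<open>G\<close>; orthogonality of these two complex lines makes conformality immediate and
  reduces the conservation law to four scalar identities. The energy is read off from the theta
  multiplier: moving by \<open>w\<close> adds \<open>-2 pi \<i> k\<close> to the logarithmic
  derivative of \<open>|G|^2\<close>. The bound \<open>k \<ge> 3\<close> enters because the zeros of
  a product of \<open>k\<close> theta translates in a fixed space are tied by their sum. For
  \<open>k = 2\<close> a zero at \<open>c\<close> determines the other one, which may fall on
  \<open>c\<close> again; from \<open>k = 3\<close> on there is room to move the others away. A
  curve inside a complex line would have many points of density \<open>k\<close>, so general
  position must also keep \<open>G1 / T\<close> and \<open>G2 / T\<close> from being affinely
  dependent.\<close>

lemma has_derivative_px:
  assumes "(f has_derivative D) (at z)"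
  shows "((\<lambda>t::real. f (z + of_real t)) has_vector_derivative D 1) (at 0)" "px f z = D 1"
proof -
  have 1: "((\<lambda>t::real. z + of_real t) has_derivative (\<lambda>t. of_real t)) (at 0)"
    by (auto intro!: derivative_eq_intros)
  have "((\<lambda>t::real. f (z + of_real t)) has_derivative (\<lambda>t. D (of_real t))) (at 0)"
    using has_derivative_compose[OF 1, of f D] assms by simp
  moreover have "D (of_real t) = t *\<^sub>R D 1" for t :: real
    using linear_scale[OF has_derivative_linear[OF assms], of t 1] by (simp add: scaleR_conv_of_real)
  ultimately show *: "((\<lambda>t::real. f (z + of_real t)) has_vector_derivative D 1) (at 0)"
    by (simp add: has_vector_derivative_def)
  then show "px f z = D 1"
    unfolding px_def by (rule vector_derivative_at)
qed

lemma has_derivative_py: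
  assumes "(f has_derivative D) (at z)"
  shows "((\<lambda>t::real. f (z + \<i> * of_real t)) has_vector_derivative D \<i>) (at 0)" "py f z = D \<i>"
proof -
  have 1: "((\<lambda>t::real. z + \<i> * of_real t) has_derivative (\<lambda>t. \<i> * of_real t)) (at 0)"
    by (auto intro!: derivative_eq_intros)
  have "((\<lambda>t::real. f (z + \<i> * of_real t)) has_derivative (\<lambda>t. D (\<i> * of_real t))) (at 0)"
    using has_derivative_compose[OF 1, of f D] assms by simp
  moreover have "D (\<i> * of_real t) = t *\<^sub>R D \<i>" for t :: real
    using linear_scale[OF has_derivative_linear[OF assms], of t \<i>]
    by (simp add: scaleR_conv_of_real mult.commute)
  ultimately show *: "((\<lambda>t::real. f (z + \<i> * of_real t)) has_vector_derivative D \<i>) (at 0)"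
    by (simp add: has_vector_derivative_def)
  then show "py f z = D \<i>"
    unfolding py_def by (rule vector_derivative_at)
qed

lemma differentiable_has_derivative_px_py:
  assumes "f differentiable (at z)"
  shows "(f has_derivative (\<lambda>h. Re h *\<^sub>R px f z + Im h *\<^sub>R py f z)) (at z)"
proof -
  obtain D where D: "(f has_derivative D) (at z)"
    using assms by (auto simp: differentiable_def)
  interpret D: linear D using D by (rule has_derivative_linear)
  have "D h = Re h *\<^sub>R px f z + Im h *\<^sub>R py f z" for h
  proof -
    have "h = Re h *\<^sub>R 1 + Im h *\<^sub>R \<i>"
      by (simp add: complex_eq_iff)
    then have "D h = D (Re h *\<^sub>R 1 + Im h *\<^sub>R \<i>)"
      by (rule arg_cong)
    then show ?thesis
      by (simp only: D.add D.scale has_derivative_px(2)[OF D] has_derivative_py(2)[OF D])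
  qed
  then have "D = (\<lambda>h. Re h *\<^sub>R px f z + Im h *\<^sub>R py f z)" by auto
  then show ?thesis using D by simp
qed

lemma Ck_imp_continuous: "Ck n f \<Longrightarrow> continuous_on UNIV f"
  by (cases n) (auto intro: differentiable_imp_continuous_on)

lemma Ck_Suc_imp_differentiable: "Ck (Suc n) f \<Longrightarrow> f differentiable (at z)"
  by (auto simp: differentiable_on_def)

lemma Ck_Suc_imp_Ck: "Ck (Suc n) f \<Longrightarrow> Ck n f"
proof (induction n arbitrary: f)
  case 0
  then show ?case using Ck_imp_continuous[of "Suc 0" f] by simp
next
  case (Suc n)
  then show ?case using Ck.simps(2) by blast
qed

text \<open>The values of a Frechet derivative at 1 and \<i> are the partial derivatives, so an
  explicit derivative formula feeds the recursion of \<open>Ck\<close>. The inductions on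
  \<open>n\<close> below go through this rule.\<close>

lemma Ck_SucI:
  assumes "\<And>z. (f has_derivative (D z)) (at z)"
    and "Ck n (\<lambda>z. D z 1)" and "Ck n (\<lambda>z. D z \<i>)"
  shows "Ck (Suc n) f"
proof -
  have "px f = (\<lambda>z. D z 1)" "py f = (\<lambda>z. D z \<i>)"
    using has_derivative_px(2)[OF assms(1)] has_derivative_py(2)[OF assms(1)] by auto
  then show ?thesis
    using assms by (auto simp: differentiable_on_def differentiable_def)
qed

lemma Ck_has_derivative:
  "Ck (Suc n) f \<Longrightarrow> (f has_derivative (\<lambda>h. Re h *\<^sub>R px f z + Im h *\<^sub>R py f z)) (at z)"
  by (blast intro: differentiable_has_derivative_px_py Ck_Suc_imp_differentiable)

lemma Ck_const: "Ck n (\<lambda>z. c)"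
proof (induction n arbitrary: c)
  case (Suc n)
  show ?case by (rule Ck_SucI[where D="\<lambda>z h. 0"]) (auto intro: Suc)
qed auto

lemma Ck_bounded_linear:
  assumes "bounded_linear L" and "Ck n f"
  shows "Ck n (\<lambda>z. L (f z))"
  using assms(2)
proof (induction n arbitrary: f)
  case 0
  then show ?case
    using assms(1) by (auto intro: bounded_linear.continuous_on)
next
  case (Suc n)
  interpret L: bounded_linear L by fact
  show ?case
  proof (rule Ck_SucI)
    show "((\<lambda>z. L (f z)) has_derivative (\<lambda>h. L (Re h *\<^sub>R px f z + Im h *\<^sub>R py f z))) (at z)" for z
      by (rule L.has_derivative[OF Ck_has_derivative[OF Suc.prems]])
  qed (use Suc in auto)
qed

lemma Ck_add:
  assumes "Ck n f" "Ck n g"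
  shows "Ck n (\<lambda>z. f z + g z)"
  using assms
proof (induction n arbitrary: f g)
  case 0
  then show ?case by (auto intro: continuous_intros)
next
  case (Suc n)
  show ?case
  proof (rule Ck_SucI)
    show "((\<lambda>z. f z + g z) has_derivative (\<lambda>h. (Re h *\<^sub>R px f z + Im h *\<^sub>R py f z)
        + (Re h *\<^sub>R px g z + Im h *\<^sub>R py g z))) (at z)" for z
      by (intro has_derivative_add Ck_has_derivative[OF Suc.prems(1)] Ck_has_derivative[OF Suc.prems(2)])
  qed (use Suc in auto)
qed

lemma (in bounded_bilinear) Ck:
  assumes "Ck n f" "Ck n g"
  shows "Ck n (\<lambda>z. prod (f z) (g z))"
  using assms
proof (induction n arbitrary: f g)
  case 0
  then show ?case by (auto intro: continuous_on)
next
  case (Suc n)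
  have fg: "Ck n f" "Ck n g"
    using Suc.prems Ck_Suc_imp_Ck by blast+
  show ?case
  proof (rule Ck_SucI)
    show "((\<lambda>z. prod (f z) (g z)) has_derivative (\<lambda>h. prod (f z) (Re h *\<^sub>R px g z + Im h *\<^sub>R py g z)
        + prod (Re h *\<^sub>R px f z + Im h *\<^sub>R py f z) (g z))) (at z)" for z
      by (rule FDERIV[OF Ck_has_derivative[OF Suc.prems(1)] Ck_has_derivative[OF Suc.prems(2)]])
  qed (use Suc fg in \<open>auto intro!: Ck_add\<close>)
qed

lemmas Ck_mult = bounded_bilinear.Ck[OF bounded_bilinear_mult]

lemma Ck_inverse:
  fixes f :: "complex \<Rightarrow> 'a::real_normed_field"
  assumes "Ck n f" "\<And>z. f z \<noteq> 0"
  shows "Ck n (\<lambda>z. inverse (f z))"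
  using assms
proof (induction n arbitrary: f)
  case 0
  then show ?case by (auto intro: continuous_intros)
next
  case (Suc n)
  \<comment> \<open>\<open>f\<close> is also \<open>Ck n\<close>, so the induction hypothesis covers
    its own inverse, which reappears in the derivative of the inverse.\<close>
  have IH: "Ck n (\<lambda>z. inverse (f z))"
    using Suc.prems Ck_Suc_imp_Ck by (blast intro: Suc.IH)
  have "Ck n (\<lambda>z. - (inverse (f z) * h z * inverse (f z)))" if "Ck n h" for h
    by (intro Ck_mult IH that Ck_bounded_linear[OF bounded_linear_minus[OF bounded_linear_ident]])
  note comp = this
  show ?case
  proof (rule Ck_SucI)
    show "((\<lambda>z. inverse (f z)) has_derivative
        (\<lambda>h. - (inverse (f z) * (Re h *\<^sub>R px f z + Im h *\<^sub>R py f z) * inverse (f z)))) (at z)" for z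
      by (rule Deriv.has_derivative_inverse[OF Suc.prems(2) Ck_has_derivative[OF Suc.prems(1)]])
  qed (use Suc comp in auto)
qed

lemma Ck_entire:
  assumes "f holomorphic_on UNIV"
  shows "Ck n f"
  using assms
proof (induction n arbitrary: f)
  case 0
  then show ?case by (auto intro: holomorphic_on_imp_continuous_on)
next
  case (Suc n)
  have "Ck n (deriv f)"
    by (intro Suc.IH holomorphic_deriv Suc.prems) auto
  moreover have "(f has_derivative (\<lambda>h. deriv f z * h)) (at z)" for z
    using holomorphic_derivI[OF Suc.prems, of z] by (auto simp: has_field_derivative_def)
  ultimately show ?case
    by (intro Ck_SucI[where D="\<lambda>z h. deriv f z * h"])
      (auto intro!: Ck_mult Ck_const)
qed

subsection \<open>Symmetry of second derivatives\<close>

lemma px_at: "Ck (Suc n) f \<Longrightarrow>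
    ((\<lambda>t::real. f (Complex t y)) has_vector_derivative px f (Complex x y)) (at x)"
proof -
  assume C: "Ck (Suc n) f"
  have "((\<lambda>t. Complex t y) has_derivative (\<lambda>h. of_real h)) (at x)"
    unfolding Complex_eq by (auto intro!: derivative_eq_intros)
  from has_derivative_compose[OF this Ck_has_derivative[OF C]]
  show ?thesis by (simp add: has_vector_derivative_def)
qed

lemma py_at: "Ck (Suc n) f \<Longrightarrow>
    ((\<lambda>t::real. f (Complex x t)) has_vector_derivative py f (Complex x y)) (at y)"
proof -
  assume C: "Ck (Suc n) f"
  have "((\<lambda>t. Complex x t) has_derivative (\<lambda>h. \<i> * of_real h)) (at y)"
    unfolding Complex_eq by (auto intro!: derivative_eq_intros)
  from has_derivative_compose[OF this Ck_has_derivative[OF C]]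
  show ?thesis by (simp add: has_vector_derivative_def)
qed

text \<open>Both mixed derivatives integrate over a rectangle to the same alternating sum of corner values.\<close>

lemma mixed_integral_eq:
  fixes f :: "complex \<Rightarrow> 'a::euclidean_space"
  assumes f: "Ck 2 f" and ab: "a \<le> b" "c \<le> d"
  shows "integral (cbox (a,c) (b,d)) (\<lambda>(x,y). py (px f) (Complex x y) - px (py f) (Complex x y)) = 0"
proof -
  have C: "Ck (Suc (Suc 0)) f" using f by (simp add: numeral_2_eq_2)
  then have Cx: "Ck (Suc 0) (px f)" and Cy: "Ck (Suc 0) (py f)" by auto
  have comp: "continuous_on S (\<lambda>p. g (u p))"
    if "continuous_on UNIV g" "continuous_on S u" for g :: "complex \<Rightarrow> 'a" and u :: "'c::topological_space \<Rightarrow> complex" and S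
    using continuous_on_compose2[OF that(1) that(2)] by simp
  have cont: "continuous_on S (\<lambda>p. py (px f) (Complex (fst p) (snd p)))"
    "continuous_on S (\<lambda>p. px (py f) (Complex (fst p) (snd p)))" for S :: "(real \<times> real) set"
    by (rule comp; use Cx Cy in \<open>auto intro!: continuous_intros\<close>)+
  have conty: "continuous_on S (\<lambda>y. py f (Complex x y))" "continuous_on S (\<lambda>x. px f (Complex x y))"
    for S x y
    by (rule comp; use Ck_imp_continuous[OF Cx] Ck_imp_continuous[OF Cy] in \<open>auto intro!: continuous_intros\<close>)+
  have ftcy: "integral {c..d} (\<lambda>y. py g (Complex x y)) = g (Complex x d) - g (Complex x c)"
    if "Ck (Suc 0) g" for g :: "complex \<Rightarrow> 'a" and x
    by (intro integral_unique fundamental_theorem_of_calculus has_vector_derivative_at_within[OF py_at[OF that]] ab)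
  have ftcx: "integral {a..b} (\<lambda>x. px g (Complex x y)) = g (Complex b y) - g (Complex a y)"
    if "Ck (Suc 0) g" for g :: "complex \<Rightarrow> 'a" and y
    by (intro integral_unique fundamental_theorem_of_calculus has_vector_derivative_at_within[OF px_at[OF that]] ab)
  note C' = Ck_Suc_imp_Ck[OF C]
  have 1: "integral (cbox (a,c) (b,d)) (\<lambda>(x,y). py (px f) (Complex x y))
      = f (Complex b d) - f (Complex a d) - (f (Complex b c) - f (Complex a c))"
  proof -
    have "integral (cbox (a,c) (b,d)) (\<lambda>(x,y). py (px f) (Complex x y))
      = integral (cbox a b) (\<lambda>x. px f (Complex x d) - px f (Complex x c))"
      using integral_prod_continuous[of a c b d "\<lambda>(x,y). py (px f) (Complex x y)"] cont
      by (simp add: ftcy[OF Cx] split_beta)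
    also have "\<dots> = integral (cbox a b) (\<lambda>x. px f (Complex x d)) - integral (cbox a b) (\<lambda>x. px f (Complex x c))"
      by (intro integral_diff integrable_continuous conty)
    finally show ?thesis by (simp add: ftcx[OF C'])
  qed
  have 2: "integral (cbox (a,c) (b,d)) (\<lambda>(x,y). px (py f) (Complex x y))
      = f (Complex b d) - f (Complex b c) - (f (Complex a d) - f (Complex a c))"
  proof -
    have "integral (cbox (a,c) (b,d)) (\<lambda>(x,y). px (py f) (Complex x y))
      = integral (cbox c d) (\<lambda>y. integral (cbox a b) (\<lambda>x. px (py f) (Complex x y)))"
      using integral_prod_continuous[of a c b d "\<lambda>(x,y). px (py f) (Complex x y)"] cont
        integral_swap_continuous[of a c b d "\<lambda>x y. px (py f) (Complex x y)"]
      by (simp add: split_beta)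
    also have "\<dots> = integral (cbox c d) (\<lambda>y. py f (Complex b y) - py f (Complex a y))"
      by (simp add: ftcx[OF Cy])
    also have "\<dots> = integral (cbox c d) (\<lambda>y. py f (Complex b y)) - integral (cbox c d) (\<lambda>y. py f (Complex a y))"
      by (intro integral_diff integrable_continuous conty)
    finally show ?thesis by (simp add: ftcy[OF C'])
  qed
  have "integral (cbox (a,c) (b,d)) (\<lambda>p. (case p of (x,y) \<Rightarrow> py (px f) (Complex x y)) - (case p of (x,y) \<Rightarrow> px (py f) (Complex x y))) = 
     integral (cbox (a,c) (b,d)) (\<lambda>(x,y). py (px f) (Complex x y)) - integral (cbox (a,c) (b,d)) (\<lambda>(x,y). px (py f) (Complex x y))"
    using cont by (intro integral_diff integrable_continuous) (auto simp: split_beta)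
  then show ?thesis
    unfolding 1 2 by (simp add: case_prod_unfold)
qed

text \<open>By continuity a nonzero difference \<open>v\<close> at \<open>z\<close> keeps a positive
  inner product with \<open>v\<close> on a small rectangle around \<open>z\<close>, which
  contradicts the vanishing of its integral there. The symmetry merges the two mixed slots of the
  second-order jet and cancels mixed terms in the first variation.\<close>

lemma py_px_eq_px_py:
  fixes f :: "complex \<Rightarrow> 'a::euclidean_space"
  assumes f: "Ck 2 f"
  shows "py (px f) z = px (py f) z"
proof (rule ccontr)
  define h where "h = (\<lambda>p. py (px f) (Complex (fst p) (snd p)) - px (py f) (Complex (fst p) (snd p)))"
  define v where "v = py (px f) z - px (py f) z"
  assume "\<not> ?thesis"
  then have v: "v \<noteq> 0" by (simp add: v_def)
  have C: "continuous_on UNIV (py (px f))" "continuous_on UNIV (px (py f))"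
    using f by (auto simp: numeral_2_eq_2)
  have cont: "continuous_on UNIV h"
    unfolding h_def
    by (intro continuous_intros continuous_on_compose2[OF C(1)] continuous_on_compose2[OF C(2)]) auto
  have "continuous_on UNIV (\<lambda>p. h p \<bullet> v)"
    by (intro continuous_intros cont)
  then have "open {p. h p \<bullet> v > 0}"
    using open_Collect_less[OF continuous_on_const] by blast
  moreover have "h (Re z, Im z) \<bullet> v > 0"
    using v by (simp add: h_def v_def)
  ultimately obtain a b where ab: "(Re z, Im z) \<in> box a b" "cbox a b \<subseteq> {p. h p \<bullet> v > 0}"
    by (metis mem_Collect_eq open_contains_cbox)
  obtain a1 a2 b1 b2 where ab': "a = (a1,a2)" "b = (b1,b2)" by (cases a, cases b) auto
  have le: "a1 \<le> b1" "a2 \<le> b2" 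
    using ab(1) unfolding ab' by (auto simp: mem_box Basis_prod_def)
  have "integral (cbox a b) h = 0"
    using mixed_integral_eq[OF f le] by (simp add: h_def ab' case_prod_unfold)
  moreover have "h integrable_on cbox a b"
    by (rule integrable_continuous) (rule continuous_on_subset[OF cont], simp)
  ultimately have "integral (cbox a b) (\<lambda>p. h p \<bullet> v) = 0"
    using integral_linear[of h "cbox a b" "\<lambda>x. x \<bullet> v"] bounded_linear_inner_left
    by (simp add: o_def)
  moreover have "integral (cbox a b) (\<lambda>p. h p \<bullet> v) = 0 \<longleftrightarrow> (\<forall>p\<in>cbox a b. h p \<bullet> v = 0)"
    using ab by (intro integral_cbox_eq_0_iff continuous_on_subset[OF \<open>continuous_on UNIV (\<lambda>p. h p \<bullet> v)\<close>])
      (auto intro: less_imp_le)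
  moreover have "(Re z, Im z) \<in> cbox a b"
    using ab(1) box_subset_cbox by blast
  ultimately show False
    using \<open>h (Re z, Im z) \<bullet> v > 0\<close> by auto
qed

subsection \<open>Integration over a period parallelogram\<close>

lemma Complex_image_cbox:
  "(\<lambda>p. Complex (fst p) (snd p)) ` cbox u v = cbox (Complex (fst u) (snd u)) (Complex (fst v) (snd v))"
proof -
  have "\<exists>p. (fst u \<le> fst p \<and> fst p \<le> fst v \<and> snd u \<le> snd p \<and> snd p \<le> snd v) \<and> z = Complex (fst p) (snd p)"
    if "fst u \<le> Re z \<and> Re z \<le> fst v \<and> snd u \<le> Im z \<and> Im z \<le> snd v" for z
    using that by (intro exI[of _ "(Re z, Im z)"]) auto
  then show ?thesis
    by (cases u, cases v) (auto simp: cbox_Pair_eq in_cbox_complex_iff image_iff Bex_def)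
qed

lemma content_cbox_Complex:
  "Sigma_Algebra.measure lborel (cbox (Complex a b) (Complex c d)) = Sigma_Algebra.measure lborel {a..c} * Sigma_Algebra.measure lborel {b..d}"
proof (cases "a \<le> c \<and> b \<le> d")
  case True
  then show ?thesis
    by (subst content_cbox) (auto simp: Basis_complex_def)
next
  case False
  then have "cbox (Complex a b) (Complex c d) = {}"
    by (auto simp: in_cbox_complex_iff)
  then show ?thesis using False by auto
qed

text \<open>Identifying complex numbers with pairs preserves the content of boxes, so the change of
  variables has factor 1. This opens the way to iterated integrals.\<close>

lemma integral_cbox_Complex:
  fixes f :: "complex \<Rightarrow> 'a::euclidean_space"
  assumes f: "f integrable_on cbox (Complex a c) (Complex b d)"
  shows "integral (cbox (Complex a c) (Complex b d)) f
    = integral (cbox (a,c) (b,d)) (\<lambda>p. f (Complex (fst p) (snd p)))"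
proof -
  have h: "(\<lambda>z. (Re z, Im z)) ` cbox u v = cbox (Re u, Im u) (Re v, Im v)" for u v
  proof -
    have "\<exists>z. (Re u \<le> Re z \<and> Re z \<le> Re v \<and> Im u \<le> Im z \<and> Im z \<le> Im v) \<and> fst p = Re z \<and> snd p = Im z"
      if "Re u \<le> fst p \<and> fst p \<le> Re v \<and> Im u \<le> snd p \<and> snd p \<le> Im v" for p
      using that by (intro exI[of _ "Complex (fst p) (snd p)"]) auto
    then show ?thesis
      by (auto simp: cbox_Pair_eq in_cbox_complex_iff image_iff Bex_def)
  qed
  have "((\<lambda>p. f (Complex (fst p) (snd p))) has_integral (1 / 1) *\<^sub>R integral (cbox (Complex a c) (Complex b d)) f)
      ((\<lambda>z. (Re z, Im z)) ` cbox (Complex a c) (Complex b d))"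
  proof (rule has_integral_twiddle)
    show "\<exists>w z. (\<lambda>p. Complex (fst p) (snd p)) ` cbox u v = cbox w z" for u v
      using Complex_image_cbox by blast
    show "\<exists>w z. (\<lambda>z. (Re z, Im z)) ` cbox u v = cbox w z" for u v
      using h by blast
    show "Sigma_Algebra.measure lborel ((\<lambda>p. Complex (fst p) (snd p)) ` cbox u v) = 1 * Sigma_Algebra.measure lborel (cbox u v)"
      for u v :: "real \<times> real"
      unfolding Complex_image_cbox
      by (cases u, cases v) (simp add: content_Pair content_cbox_Complex)
    show "isCont (\<lambda>p. Complex (fst p) (snd p)) x" for x
      unfolding Complex_eq by (intro continuous_intros)
    show "(f has_integral integral (cbox (Complex a c) (Complex b d)) f) (cbox (Complex a c) (Complex b d))"
      using f by (rule integrable_integral)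
  qed auto
  then show ?thesis
    unfolding h by (simp add: integral_unique)
qed

text \<open>Integrating in \<open>x\<close> first leaves, at every height, the difference of
  \<open>U\<close> across one period.\<close>

lemma integral_rectangle_px:
  fixes U :: "complex \<Rightarrow> real"
  assumes U: "Ck 1 U" and per: "\<And>z. U (z + 1) = U z"
  shows "integral (cbox 0 (Complex 1 h)) (px U) = 0"
proof -
  have C: "Ck (Suc 0) U" using U by simp
  have c: "continuous_on UNIV (px U)" using C by simp
  have cont: "continuous_on S (\<lambda>p. px U (Complex (fst p) (snd p)))" for S :: "(real \<times> real) set"
    by (rule continuous_on_compose2[OF c]) (auto intro!: continuous_intros)
  have "integral (cbox (Complex 0 0) (Complex 1 h)) (px U)
      = integral (cbox (0,0) (1,h)) (\<lambda>(x,y). px U (Complex x y))"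
    using continuous_on_subset[OF c]
    by (subst integral_cbox_Complex) (auto intro: integrable_continuous simp: case_prod_unfold)
  also have "\<dots> = integral {0..h} (\<lambda>y. integral {0..1} (\<lambda>x. px U (Complex x y)))"
    using integral_prod_continuous[of 0 0 1 h "\<lambda>(x,y). px U (Complex x y)"] cont
      integral_swap_continuous[of 0 0 1 h "\<lambda>x y. px U (Complex x y)"]
    by (simp add: split_beta)
  also have "\<dots> = integral {0..h} (\<lambda>y. U (Complex 1 y) - U (Complex 0 y))"
    by (intro arg_cong[where f="integral _"] ext integral_unique fundamental_theorem_of_calculus
        has_vector_derivative_at_within[OF px_at[OF C]]) auto
  also have "\<dots> = integral {0..h} (\<lambda>y. 0)"
  proof -
    have "U (Complex 1 y) = U (Complex 0 y)" for y
      using per[of "Complex 0 y"] by (simp add: Complex_eq add.commute)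
    then show ?thesis by simp
  qed
  finally show ?thesis by (simp add: zero_complex.code)
qed

text \<open>The part of the shifted interval to the left of 0 is moved by one period to the right
  end of the unit interval.\<close>

lemma integral_period_shift:
  fixes g :: "real \<Rightarrow> real"
  assumes g: "continuous_on UNIV g" and per: "\<And>x. g (x + 1) = g x" and r: "0 \<le> r" "r \<le> 1"
  shows "integral {0..1} (\<lambda>x. g (x - r)) = integral {0..1} g"
proof -
  have int: "g integrable_on {a..b}" for a b
    using g by (intro integrable_continuous_interval) (blast intro: continuous_on_subset)
  have shift: "integral {a..b} (\<lambda>x. g (x + c)) = integral {a+c..b+c} g" for a b c
    using integral_shift_Icc_real[of a b g c] by (simp add: add.commute o_def)
  have "integral {0..1} (\<lambda>x. g (x - r)) = integral {-r..1-r} g"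
    using shift[of 0 1 "-r"] by simp
  also have "\<dots> = integral {-r..0} g + integral {0..1-r} g"
    by (rule Henstock_Kurzweil_Integration.integral_combine[symmetric]) (use r int in auto)
  also have "integral {-r..0} g = integral {1-r..1} g"
    using shift[of "-r" 0 1] per by (simp add: add.commute)
  also have "integral {1-r..1} g + integral {0..1-r} g = integral {0..1} g"
    by (subst add.commute, rule Henstock_Kurzweil_Integration.integral_combine) (use r int in auto)
  finally show ?thesis .
qed

text \<open>Integrating in \<open>y\<close> first compares the top and bottom edges. The top edge is
  the bottom one moved by \<open>w\<close>, up to a horizontal shift by \<open>Re w\<close> that
  \<open>integral_period_shift\<close> absorbs. The additive constant \<open>c\<close> is kept
  because the Willmore energy will be read off from it.\<close>

lemma integral_rectangle_py:
  fixes V :: "complex \<Rightarrow> real"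
  assumes V: "Ck 1 V" and per: "\<And>z. V (z + 1) = V z" and perw: "\<And>z. V (z + w) = V z + c"
    and w: "0 \<le> Im w" "0 \<le> Re w" "Re w \<le> 1"
  shows "integral (cbox 0 (Complex 1 (Im w))) (py V) = c"
proof -
  have C: "Ck (Suc 0) V" using V by simp
  have c: "continuous_on UNIV (py V)" using C by simp
  have cV: "continuous_on S (\<lambda>x. V (Complex x y))" for S y
    by (rule continuous_on_compose2[OF Ck_imp_continuous[OF V]]) (auto intro!: continuous_intros)
  have cont: "continuous_on S (\<lambda>p. py V (Complex (fst p) (snd p)))" for S :: "(real \<times> real) set"
    by (rule continuous_on_compose2[OF c]) (auto intro!: continuous_intros)
  have "integral (cbox (Complex 0 0) (Complex 1 (Im w))) (py V)
      = integral (cbox (0,0) (1,Im w)) (\<lambda>(x,y). py V (Complex x y))"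
    using continuous_on_subset[OF c]
    by (subst integral_cbox_Complex) (auto intro: integrable_continuous simp: case_prod_unfold)
  also have "\<dots> = integral {0..1} (\<lambda>x. integral {0..Im w} (\<lambda>y. py V (Complex x y)))"
    using integral_prod_continuous[of 0 0 1 "Im w" "\<lambda>(x,y). py V (Complex x y)"] cont
    by (simp add: split_beta)
  also have "\<dots> = integral {0..1} (\<lambda>x. V (Complex x (Im w)) - V (Complex x 0))"
    by (intro arg_cong[where f="integral _"] ext integral_unique fundamental_theorem_of_calculus
        has_vector_derivative_at_within[OF py_at[OF C]]) (use w in auto)
  also have "\<dots> = integral {0..1} (\<lambda>x. (V (Complex (x - Re w) 0) - V (Complex x 0)) + c)"
  proof -
    have "Complex (x - Re w) 0 + w = Complex x (Im w)" for x
      by (simp add: complex_eq_iff)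
    then have "V (Complex x (Im w)) = V (Complex (x - Re w) 0) + c" for x
      using perw[of "Complex (x - Re w) 0"] by simp
    then show ?thesis by (simp add: algebra_simps)
  qed
  also have "\<dots> = (integral {0..1} (\<lambda>x. V (Complex (x - Re w) 0)) - integral {0..1} (\<lambda>x. V (Complex x 0))) + c"
  proof -
    have i: "(\<lambda>x. V (Complex (x - Re w) 0)) integrable_on {0..1}" "(\<lambda>x. V (Complex x 0)) integrable_on {0..1}"
      by (rule integrable_continuous_interval, rule continuous_on_compose2[OF Ck_imp_continuous[OF V]],
          auto intro!: continuous_intros)+
    show ?thesis
      using i by (subst Henstock_Kurzweil_Integration.integral_add)
        (auto intro: integrable_diff simp: Henstock_Kurzweil_Integration.integral_diff)
  qed
  also have "integral {0..1} (\<lambda>x. V (Complex (x - Re w) 0)) = integral {0..1} (\<lambda>x. V (Complex x 0))"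
    using per[of "Complex _ 0"] w
    by (intro integral_period_shift[where g="\<lambda>x. V (Complex x 0)"] cV) (auto simp: Complex_eq)
  finally show ?thesis by (simp add: zero_complex.code)
qed

lemma fund_dom_eq:
  assumes "Im w > 0"
  shows "fund_dom w = {z. 0 \<le> Im z \<and> Im z < Im w \<and> Im z * Re w \<le> Re z * Im w \<and> Re z * Im w < Im w + Im z * Re w}"
proof (intro set_eqI iffI)
  fix z assume "z \<in> fund_dom w"
  then obtain s t where st: "z = of_real s + of_real t * w" "0 \<le> s" "s < 1" "0 \<le> t" "t < 1"
    by (auto simp: fund_dom_def)
  then have "0 \<le> s * Im w" "s * Im w < 1 * Im w" "t * Im w < 1 * Im w" "0 \<le> t * Im w"
    using assms by (auto intro!: mult_strict_right_mono simp del: mult_1)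
  then show "z \<in> {z. 0 \<le> Im z \<and> Im z < Im w \<and> Im z * Re w \<le> Re z * Im w \<and> Re z * Im w < Im w + Im z * Re w}"
    using st by (auto simp: algebra_simps)
next
  fix z assume z: "z \<in> {z. 0 \<le> Im z \<and> Im z < Im w \<and> Im z * Re w \<le> Re z * Im w \<and> Re z * Im w < Im w + Im z * Re w}"
  define t where "t = Im z / Im w"
  define s where "s = Re z - t * Re w"
  have "z = of_real s + of_real t * w"
    using assms by (auto simp: complex_eq_iff s_def t_def)
  moreover have "0 \<le> t" "t < 1" "0 \<le> s" "s < 1"
    using z assms by (auto simp: s_def t_def field_simps)
  ultimately show "z \<in> fund_dom w" by (auto simp: fund_dom_def)
qed

text \<open>Cut and paste: the triangle \<open>Q\<close> of the rectangle to the left of the segment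
  from 0 to \<open>w\<close>, moved right by 1, fills the part of the parallelogram that sticks out
  of the rectangle.\<close>

lemma integral_fund_dom_eq_rectangle:
  fixes g :: "complex \<Rightarrow> real"
  assumes w: "Im w > 0" "0 \<le> Re w" "Re w \<le> 1" and per: "\<And>z. g (z + 1) = g z"
    and cont: "continuous_on (cbox 0 (Complex 1 (Im w))) g"
  shows "integral (fund_dom w) g = integral (cbox 0 (Complex 1 (Im w))) g"
proof -
  define R where "R = cbox 0 (Complex 1 (Im w))"
  define P where "P = R \<inter> {z. Im z * Re w \<le> Re z * Im w}"
  define Q where "Q = R \<inter> {z. Re z * Im w < Im z * Re w}"
  have abs: "g absolutely_integrable_on R"
    unfolding R_def by (rule absolutely_integrable_continuous[OF cont])
  have "closed {z::complex. Im z * Re w \<le> Re z * Im w}"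
    by (intro closed_Collect_le continuous_intros)
  moreover have "open {z::complex. Re z * Im w < Im z * Re w}"
    by (intro open_Collect_less continuous_intros)
  ultimately have meas: "P \<in> sets lebesgue" "Q \<in> sets lebesgue"
    unfolding P_def Q_def R_def by (auto intro!: sets.Int)
  have intP: "g integrable_on P" and intQ: "g integrable_on Q"
    using set_integrable_subset[OF abs meas(1)] set_integrable_subset[OF abs meas(2)]
    by (auto simp: P_def Q_def intro: set_lebesgue_integral_eq_integral(1))
  have QR: "Q \<subseteq> cbox 0 (Complex 1 (Im w))" by (auto simp: Q_def R_def)
  have "((\<lambda>x. if x \<in> Q then g x else 0) has_integral integral Q g) (cbox 0 (Complex 1 (Im w)))"
    using intQ by (simp add: has_integral_restrict[OF QR] has_integral_integral)
  from has_integral_shift_cbox[OF this, of "-1"]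
  have "((\<lambda>x. if x + - 1 \<in> Q then g (x + - 1) else 0) has_integral integral Q g)
      (cbox (0 - (-1)) (Complex 1 (Im w) - (-1)))" .
  moreover have "(\<lambda>x. if x + - 1 \<in> Q then g (x + - 1) else 0) = (\<lambda>x. if x \<in> (+) 1 ` Q then g x else 0)"
  proof
    fix x
    have "x + - 1 \<in> Q \<longleftrightarrow> x \<in> (+) 1 ` Q"
      by (force simp: image_iff)
    moreover have "g (x + - 1) = g x" using per[of "x - 1"] by simp
    ultimately show "(if x + - 1 \<in> Q then g (x + - 1) else 0) = (if x \<in> (+) 1 ` Q then g x else 0)"
      by simp
  qed
  moreover have "(+) 1 ` Q \<subseteq> cbox (0 - (-1)) (Complex 1 (Im w) - (-1))"
    using QR by (force simp: in_cbox_complex_iff)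
  ultimately have hQ: "(g has_integral integral Q g) ((+) 1 ` Q)"
    by (simp add: has_integral_restrict)
  have PQ: "P \<union> Q = R" "P \<inter> Q = {}"
    by (auto simp: P_def Q_def)
  have R_iff: "z \<in> R \<longleftrightarrow> 0 \<le> Re z \<and> Re z \<le> 1 \<and> 0 \<le> Im z \<and> Im z \<le> Im w" for z
    by (auto simp: R_def in_cbox_complex_iff)
  have R: "integral R g = integral P g + integral Q g"
    using intP intQ PQ has_integral_Un[of g "integral P g" P "integral Q g" Q]
    by (auto intro!: integral_unique)
  \<comment> \<open>The pieces overlap, and differ from the half-open parallelogram, only on the
    lines \<open>Re z = 1\<close> and \<open>Im z = Im w\<close>.\<close>
  have negl: "negligible {z::complex. z \<bullet> 1 = 1}" "negligible {z::complex. z \<bullet> \<i> = Im w}"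
    by (intro negligible_standard_hyperplane; simp add: Basis_complex_def)+
  have "(g has_integral integral P g + integral Q g) (P \<union> (+) 1 ` Q)"
  proof (rule has_integral_Un)
    show "(g has_integral integral P g) P" using intP by blast
    have "P \<inter> (+) 1 ` Q \<subseteq> {z. z \<bullet> 1 = 1}"
      by (auto simp: P_def Q_def R_iff inner_complex_def)
    then show "negligible (P \<inter> (+) 1 ` Q)"
      using negl(1) negligible_subset by blast
  qed (rule hQ)
  then have "integral P g + integral Q g = integral (P \<union> (+) 1 ` Q) g"
    by (simp add: integral_unique)
  also have "\<dots> = integral (fund_dom w) g"
  proof (rule integral_spike_set)
    have "P \<union> (+) 1 ` Q - fund_dom w \<subseteq> {z. z \<bullet> 1 = 1} \<union> {z. z \<bullet> \<i> = Im w}"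
    proof safe
      fix z assume z: "z \<in> P" "z \<notin> fund_dom w" "z \<bullet> \<i> \<noteq> Im w"
      then have "Re z * Im w \<ge> Im w + Im z * Re w" "Im z * Re w \<ge> 0"
        using w by (auto simp: P_def R_iff fund_dom_eq inner_complex_def)
      then have "1 * Im w \<le> Re z * Im w" by simp
      then have "Re z \<ge> 1" using w by (simp only: mult_le_cancel_right_pos)
      then show "z \<bullet> 1 = 1" using z by (auto simp: P_def R_iff inner_complex_def)
    next
      fix z assume z: "z \<in> Q" "1 + z \<notin> fund_dom w" "(1 + z) \<bullet> \<i> \<noteq> Im w"
      have "Im z * Re w \<le> Im w * 1" 
        using z w by (intro mult_mono) (auto simp: Q_def R_iff)
      moreover have "Re z * Im w \<ge> 0" using z w by (auto simp: Q_def R_iff)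
      ultimately have "1 + z \<in> fund_dom w"
        using z w by (auto simp: Q_def R_iff fund_dom_eq inner_complex_def algebra_simps)
      then show "(1 + z) \<bullet> 1 = 1" using z by simp
    qed
    then show "negligible {z \<in> P \<union> (+) 1 ` Q - fund_dom w. g z \<noteq> 0}"
      by (intro negligible_subset[OF negligible_Un[OF negl]]) auto
    have "fund_dom w \<subseteq> P \<union> (+) 1 ` Q"
    proof
      fix z assume z: "z \<in> fund_dom w"
      then have z': "0 \<le> Im z" "Im z < Im w" "Im z * Re w \<le> Re z * Im w" "Re z * Im w < Im w + Im z * Re w"
        using w by (auto simp: fund_dom_eq)
      have "0 \<le> Im z * Re w" "Im z * Re w \<le> Im w * 1"
        using z' w by (auto intro!: mult_mono simp del: mult_1_right)
      then have "0 * Im w \<le> Re z * Im w" "Re z * Im w < 2 * Im w" using z' by linarith+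
      then have Rez: "0 \<le> Re z" "Re z < 2"
        using w by (simp_all only: mult_less_cancel_right_pos mult_le_cancel_right_pos)
      show "z \<in> P \<union> (+) 1 ` Q"
      proof (cases "Re z \<le> 1")
        case True
        then show ?thesis using z' Rez by (auto simp: P_def R_iff)
      next
        case False
        then have "z - 1 \<in> Q" using z' Rez by (auto simp: Q_def R_iff algebra_simps)
        then show ?thesis by (force simp: image_iff)
      qed
    qed
    then show "negligible {z \<in> fund_dom w - (P \<union> (+) 1 ` Q). g z \<noteq> 0}"
      by (metis (no_types, lifting) Diff_eq_empty_iff empty_Collect_eq empty_iff negligible_empty)
  qed
  finally show ?thesis using R by (simp add: R_def)
qed

subsection \<open>Functions depending differentiably on a parameter\<close>

text \<open>The regularity needed to differentiate under the integral sign, packaged as a class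
  closed under sums, bilinear products, inverse and square root, so that it can be checked along the
  formula of the Willmore integrand.\<close>

definition C1_param ::
    "real set \<Rightarrow> complex set \<Rightarrow> (real \<Rightarrow> complex \<Rightarrow> 'a::real_normed_vector) \<Rightarrow> bool" where
  "C1_param U R u \<longleftrightarrow> continuous_on (U \<times> R) (\<lambda>p. u (fst p) (snd p)) \<and>
    (\<exists>u'. continuous_on (U \<times> R) (\<lambda>p. u' (fst p) (snd p)) \<and>
      (\<forall>t\<in>U. \<forall>z\<in>R. ((\<lambda>t. u t z) has_vector_derivative u' t z) (at t)))"

lemma C1_paramI:
  assumes "continuous_on (U \<times> R) (\<lambda>p. u (fst p) (snd p))" "continuous_on (U \<times> R) (\<lambda>p. u' (fst p) (snd p))"
    "\<And>t z. t \<in> U \<Longrightarrow> z \<in> R \<Longrightarrow> ((\<lambda>t. u t z) has_vector_derivative u' t z) (at t)"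
  shows "C1_param U R u"
  using assms unfolding C1_param_def by blast

lemma C1_paramE:
  assumes "C1_param U R u"
  obtains u' where "continuous_on (U \<times> R) (\<lambda>p. u (fst p) (snd p))"
    "continuous_on (U \<times> R) (\<lambda>p. u' (fst p) (snd p))"
    "\<And>t z. t \<in> U \<Longrightarrow> z \<in> R \<Longrightarrow> ((\<lambda>t. u t z) has_vector_derivative u' t z) (at t)"
  using assms unfolding C1_param_def by blast

lemma C1_param_affine:
  assumes "continuous_on R g" "continuous_on R h"
  shows "C1_param U R (\<lambda>t z. g z + t *\<^sub>R h z)"
proof (rule C1_paramI)
  have *: "continuous_on (U \<times> R) (\<lambda>p. g (snd p))" "continuous_on (U \<times> R) (\<lambda>p. h (snd p))"
    by (rule continuous_on_compose2[OF assms(1)] continuous_on_compose2[OF assms(2)];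
        auto intro: continuous_intros)+
  show "continuous_on (U \<times> R) (\<lambda>p. g (snd p) + fst p *\<^sub>R h (snd p))"
    by (intro continuous_intros *)
  show "continuous_on (U \<times> R) (\<lambda>p. h (snd p))" by (rule *)
  show "((\<lambda>t. g z + t *\<^sub>R h z) has_vector_derivative h z) (at t)" for t z
    by (auto intro!: derivative_eq_intros simp: has_vector_derivative_def)
qed

lemma C1_param_add:
  assumes "C1_param U R u" "C1_param U R v"
  shows "C1_param U R (\<lambda>t z. u t z + v t z)"
proof -
  from assms obtain u' v' where
    "continuous_on (U \<times> R) (\<lambda>p. u (fst p) (snd p))" "continuous_on (U \<times> R) (\<lambda>p. u' (fst p) (snd p))"
    "\<And>t z. t \<in> U \<Longrightarrow> z \<in> R \<Longrightarrow> ((\<lambda>t. u t z) has_vector_derivative u' t z) (at t)"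
    "continuous_on (U \<times> R) (\<lambda>p. v (fst p) (snd p))" "continuous_on (U \<times> R) (\<lambda>p. v' (fst p) (snd p))"
    "\<And>t z. t \<in> U \<Longrightarrow> z \<in> R \<Longrightarrow> ((\<lambda>t. v t z) has_vector_derivative v' t z) (at t)"
    by (elim C1_paramE) blast
  then show ?thesis
    by (intro C1_paramI[where u'="\<lambda>t z. u' t z + v' t z"] continuous_intros has_vector_derivative_add) auto
qed

lemma (in bounded_bilinear) C1_param:
  assumes "C1_param U R u" "C1_param U R v"
  shows "C1_param U R (\<lambda>t z. prod (u t z) (v t z))"
proof -
  from assms obtain u' v' where *:
    "continuous_on (U \<times> R) (\<lambda>p. u (fst p) (snd p))" "continuous_on (U \<times> R) (\<lambda>p. u' (fst p) (snd p))"
    "\<And>t z. t \<in> U \<Longrightarrow> z \<in> R \<Longrightarrow> ((\<lambda>t. u t z) has_vector_derivative u' t z) (at t)"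
    "continuous_on (U \<times> R) (\<lambda>p. v (fst p) (snd p))" "continuous_on (U \<times> R) (\<lambda>p. v' (fst p) (snd p))"
    "\<And>t z. t \<in> U \<Longrightarrow> z \<in> R \<Longrightarrow> ((\<lambda>t. v t z) has_vector_derivative v' t z) (at t)"
    by (elim C1_paramE) blast
  show ?thesis
  proof (rule C1_paramI)
    show "((\<lambda>t. prod (u t z) (v t z)) has_vector_derivative prod (u t z) (v' t z) + prod (u' t z) (v t z)) (at t)"
      if "t \<in> U" "z \<in> R" for t z
      using that * by (intro has_vector_derivative) auto
  qed (use * in \<open>auto intro!: continuous_on continuous_on_add\<close>)
qed

lemmas C1_param_bilinear =
  bounded_bilinear.C1_param[OF bounded_bilinear_mult]
  bounded_bilinear.C1_param[OF bounded_bilinear_scaleR]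
  bounded_bilinear.C1_param[OF bounded_bilinear_inner]

lemma C1_param_const: "C1_param U R (\<lambda>t z. c)"
  by (rule C1_paramI[where u'="\<lambda>t z. 0"]) auto

lemma C1_param_minus: 
  assumes "C1_param U R u" shows "C1_param U R (\<lambda>t z. - u t z)"
  using C1_param_bilinear(2)[OF C1_param_const[of U R "-1"] assms] by simp

lemma C1_param_diff:
  assumes "C1_param U R u" "C1_param U R v"
  shows "C1_param U R (\<lambda>t z. u t z - v t z)"
  using C1_param_add[OF assms(1) C1_param_minus[OF assms(2)]] by simp

lemma C1_param_compose_real:
  assumes u: "C1_param U R u" and h: "\<And>x::real. x > 0 \<Longrightarrow> (h has_real_derivative h' x) (at x)"
    and h': "continuous_on {0<..} h'" and pos: "\<And>t z. t \<in> U \<Longrightarrow> z \<in> R \<Longrightarrow> u t z > 0"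
  shows "C1_param U R (\<lambda>t z. h (u t z))"
proof -
  from u obtain u' where *:
    "continuous_on (U \<times> R) (\<lambda>p. u (fst p) (snd p))" "continuous_on (U \<times> R) (\<lambda>p. u' (fst p) (snd p))"
    "\<And>t z. t \<in> U \<Longrightarrow> z \<in> R \<Longrightarrow> ((\<lambda>t. u t z) has_vector_derivative u' t z) (at t)"
    by (elim C1_paramE) blast
  have ch: "continuous_on {0<..} h"
    using h by (intro continuous_at_imp_continuous_on) (auto intro: DERIV_isCont)
  show ?thesis
  proof (rule C1_paramI)
    show "continuous_on (U \<times> R) (\<lambda>p. h (u (fst p) (snd p)))"
      by (rule continuous_on_compose2[OF ch *(1)]) (use pos in auto)
    have "continuous_on (U \<times> R) (\<lambda>p. h' (u (fst p) (snd p)))"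
      by (rule continuous_on_compose2[OF h' *(1)]) (use pos in auto)
    then show "continuous_on (U \<times> R) (\<lambda>p. h' (u (fst p) (snd p)) * u' (fst p) (snd p))"
      by (intro continuous_intros *)
    show "((\<lambda>t. h (u t z)) has_vector_derivative h' (u t z) * u' t z) (at t)"
      if "t \<in> U" "z \<in> R" for t z
      using DERIV_chain2[where f=h and g="\<lambda>t. u t z", OF h[OF pos[OF that]]] *(3)[OF that]
      by (simp add: has_real_derivative_iff_has_vector_derivative)
  qed
qed

lemma C1_param_inverse:
  assumes "C1_param U R u" "\<And>t z. t \<in> U \<Longrightarrow> z \<in> R \<Longrightarrow> u t z > (0::real)"
  shows "C1_param U R (\<lambda>t z. inverse (u t z))"
  using assms(1) by (rule C1_param_compose_real[where h'="\<lambda>x. - inverse (x ^ 2)"])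
    (use assms(2) in \<open>auto intro!: derivative_eq_intros continuous_intros simp: power2_eq_square field_simps\<close>)

lemma C1_param_sqrt:
  assumes "C1_param U R u" "\<And>t z. t \<in> U \<Longrightarrow> z \<in> R \<Longrightarrow> u t z > (0::real)"
  shows "C1_param U R (\<lambda>t z. sqrt (u t z))"
  using assms(1) by (rule C1_param_compose_real[where h'="\<lambda>x. inverse (sqrt x) / 2"])
    (use assms(2) in \<open>auto intro!: DERIV_real_sqrt continuous_intros\<close>)

subsection \<open>The Willmore integrand as a function of the second-order jet\<close>

definition jet_det :: "'v::real_inner \<Rightarrow> 'v \<Rightarrow> real" where
  "jet_det a b = (a \<bullet> a) * (b \<bullet> b) - (a \<bullet> b) * (a \<bullet> b)"

text \<open>\<open>p\<close>, \<open>q\<close>, \<open>q'\<close>, \<open>r\<close> stand for the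
  second derivatives xx, xy, yx, yy; the mixed ones stay separate because \<open>mean_curv\<close>
  contains both. Writing \<open>inverse\<close> in place of division matches the closure rules of
  \<open>C1_param\<close>.\<close>

definition jet_trace :: "'v::real_inner \<Rightarrow> 'v \<Rightarrow> 'v \<Rightarrow> 'v \<Rightarrow> 'v \<Rightarrow> 'v \<Rightarrow> 'v" where
  "jet_trace a b p q q' r = ((b \<bullet> b) * inverse (jet_det a b)) *\<^sub>R p
     + (- (a \<bullet> b) * inverse (jet_det a b)) *\<^sub>R q + (- (a \<bullet> b) * inverse (jet_det a b)) *\<^sub>R q'
     + ((a \<bullet> a) * inverse (jet_det a b)) *\<^sub>R r"

text \<open>The orthogonal projection of \<open>A\<close> to the span of \<open>a\<close> and
  \<open>b\<close>, with the inverse Gram matrix written out.\<close>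

definition jet_tangent :: "'v::real_inner \<Rightarrow> 'v \<Rightarrow> 'v \<Rightarrow> 'v" where
  "jet_tangent a b A =
     ((b \<bullet> b) * inverse (jet_det a b) * (A \<bullet> a) + - (a \<bullet> b) * inverse (jet_det a b) * (A \<bullet> b)) *\<^sub>R a
   + (- (a \<bullet> b) * inverse (jet_det a b) * (A \<bullet> a) + (a \<bullet> a) * inverse (jet_det a b) * (A \<bullet> b)) *\<^sub>R b"

definition jet_willmore :: "'v::real_inner \<Rightarrow> 'v \<Rightarrow> 'v \<Rightarrow> 'v \<Rightarrow> 'v \<Rightarrow> 'v \<Rightarrow> real" where
  "jet_willmore a b p q q' r =
     ((jet_trace a b p q q' r - jet_tangent a b (jet_trace a b p q q' r))
       \<bullet> (jet_trace a b p q q' r - jet_tangent a b (jet_trace a b p q q' r))) * sqrt (jet_det a b)"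

lemma gdet_eq_jet: "gdet f z = jet_det (px f z) (py f z)"
  by (simp add: gdet_def gE_def gF_def gG_def jet_det_def power2_eq_square)

lemma mean_curv_eq_jet:
  "mean_curv f z = (let A = jet_trace (px f z) (py f z) (px (px f) z) (py (px f) z) (px (py f) z) (py (py f) z)
     in A - jet_tangent (px f z) (py f z) A)"
  by (simp add: mean_curv_def jet_trace_def jet_tangent_def Let_def gdet_eq_jet gE_def gF_def gG_def
      divide_inverse)

lemma willmore_integrand_eq_jet:
  "(norm (mean_curv f z))\<^sup>2 * sqrt (gdet f z) =
    jet_willmore (px f z) (py f z) (px (px f) z) (py (px f) z) (px (py f) z) (py (py f) z)"
  by (simp add: mean_curv_eq_jet jet_willmore_def gdet_eq_jet Let_def power2_norm_eq_inner)

lemma C1_param_jet_det: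
  assumes "C1_param U R a" "C1_param U R b"
  shows "C1_param U R (\<lambda>t z. jet_det (a t z) (b t z))"
  unfolding jet_det_def by (intro C1_param_diff C1_param_bilinear assms)

lemma C1_param_jet_willmore:
  assumes ab: "C1_param U R a" "C1_param U R b"
    and pqr: "C1_param U R p" "C1_param U R q" "C1_param U R q'" "C1_param U R r"
    and pos: "\<And>t z. t \<in> U \<Longrightarrow> z \<in> R \<Longrightarrow> jet_det (a t z) (b t z) > 0"
  shows "C1_param U R (\<lambda>t z. jet_willmore (a t z) (b t z) (p t z) (q t z) (q' t z) (r t z))"
proof -
  note rules = C1_param_diff C1_param_add C1_param_minus C1_param_bilinear
  note d = C1_param_jet_det[OF ab]
  note id = C1_param_inverse[OF d pos]
  have tr: "C1_param U R (\<lambda>t z. jet_trace (a t z) (b t z) (p t z) (q t z) (q' t z) (r t z))"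
    unfolding jet_trace_def by (intro rules ab pqr id)
  have tan: "C1_param U R (\<lambda>t z. jet_tangent (a t z) (b t z) (A t z))" if "C1_param U R A" for A
    unfolding jet_tangent_def by (intro rules ab that id)
  show ?thesis
    unfolding jet_willmore_def by (intro rules tr tan C1_param_sqrt[OF d pos])
qed

text \<open>For a conformal jet the trace is \<open>(p + r) / l\<close>, already normal by
  assumption, and the area density is \<open>l\<close>.\<close>

lemma jet_willmore_conformal:
  assumes ab: "a \<bullet> a = l" "b \<bullet> b = l" "a \<bullet> b = 0" "l > 0"
    and perp: "(p + r) \<bullet> a = 0" "(p + r) \<bullet> b = 0"
  shows "jet_willmore a b p q q' r = ((p + r) \<bullet> (p + r)) / l"
proof -
  have d: "jet_det a b = l * l" by (simp add: jet_det_def ab)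
  have tr: "jet_trace a b p q q' r = (1 / l) *\<^sub>R (p + r)"
    using ab by (simp add: jet_trace_def d scaleR_add_right field_simps)
  have "jet_tangent a b ((1 / l) *\<^sub>R (p + r)) = 0"
    using ab perp by (simp add: jet_tangent_def)
  then show ?thesis
    using ab by (simp add: jet_willmore_def tr d)
qed

text \<open>Three things vary: the second derivatives, the inverse metric and the area density. The
  terms \<open>4 (h \<bullet> p) / l\<close> and their analogues come from the inverse metric, the
  term \<open>h \<bullet> h\<close> from the area density. The variation of the tangential
  projection stays tangential, hence orthogonal to \<open>h\<close>, and contributes
  nothing.\<close>

lemma jet_willmore_has_derivative:
  fixes a b p q r a1 b1 p1 q1 q2 r1 :: "'v::real_inner"
  assumes ab: "a \<bullet> a = l" "b \<bullet> b = l" "a \<bullet> b = 0" "l > 0"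
    and perp: "(p + r) \<bullet> a = 0" "(p + r) \<bullet> b = 0"
    and h: "h = (1 / l) *\<^sub>R (p + r)"
  shows "((\<lambda>t. jet_willmore (a + t *\<^sub>R a1) (b + t *\<^sub>R b1) (p + t *\<^sub>R p1) (q + t *\<^sub>R q1) (q + t *\<^sub>R q2) (r + t *\<^sub>R r1))
    has_real_derivative
      2 * (h \<bullet> (p1 + r1))
      + ((h \<bullet> h - 4 * (h \<bullet> p) / l) *\<^sub>R a - (4 * (h \<bullet> q) / l) *\<^sub>R b) \<bullet> a1
      + ((h \<bullet> h - 4 * (h \<bullet> r) / l) *\<^sub>R b - (4 * (h \<bullet> q) / l) *\<^sub>R a) \<bullet> b1) (at 0)"
proof -
  have ha: "h \<bullet> a = 0" "h \<bullet> b = 0" using perp by (auto simp: h)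
  define av where "av = (\<lambda>t. a + t *\<^sub>R a1)"
  define bv where "bv = (\<lambda>t. b + t *\<^sub>R b1)"
  define dt where "dt = (\<lambda>t. jet_det (av t) (bv t))"
  define At where "At = (\<lambda>t. jet_trace (av t) (bv t) (p + t *\<^sub>R p1) (q + t *\<^sub>R q1) (q + t *\<^sub>R q2) (r + t *\<^sub>R r1))"
  have at0: "av 0 = a" "bv 0 = b" by (auto simp: av_def bv_def)
  have dat: "(av has_vector_derivative a1) (at 0)" "(bv has_vector_derivative b1) (at 0)"
    unfolding av_def bv_def by (auto intro!: derivative_eq_intros simp: has_vector_derivative_def)
  have lin: "((\<lambda>t. x + t *\<^sub>R y) has_vector_derivative y) (at 0)" for x y :: 'v
    by (auto intro!: derivative_eq_intros simp: has_vector_derivative_def)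
  note inner_d = bounded_bilinear.has_vector_derivative[OF bounded_bilinear_inner, folded has_real_derivative_iff_has_vector_derivative]
  have E: "((\<lambda>t. av t \<bullet> av t) has_real_derivative 2 * (a \<bullet> a1)) (at 0)"
    using inner_d[OF dat(1) dat(1)] by (simp add: at0 inner_commute)
  have F: "((\<lambda>t. av t \<bullet> bv t) has_real_derivative (a \<bullet> b1 + b \<bullet> a1)) (at 0)"
    using inner_d[OF dat(1) dat(2)] by (simp add: at0 inner_commute)
  have G: "((\<lambda>t. bv t \<bullet> bv t) has_real_derivative 2 * (b \<bullet> b1)) (at 0)"
    using inner_d[OF dat(2) dat(2)] by (simp add: at0 inner_commute)
  have d0: "dt 0 = l * l" by (simp add: dt_def jet_det_def at0 ab)
  have D: "(dt has_real_derivative 2 * l * (a \<bullet> a1 + b \<bullet> b1)) (at 0)"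
    unfolding dt_def jet_det_def
    by (rule derivative_eq_intros E F G | simp add: at0 ab algebra_simps)+
  have iD: "((\<lambda>t. inverse (dt t)) has_real_derivative - (2 * (a \<bullet> a1 + b \<bullet> b1) / (l * l * l))) (at 0)"
    by (rule derivative_eq_intros D | use ab(4) in \<open>simp add: d0 field_simps\<close>)+
  define c11 where "c11 = (\<lambda>t. (bv t \<bullet> bv t) * inverse (dt t))"
  define c12 where "c12 = (\<lambda>t. - (av t \<bullet> bv t) * inverse (dt t))"
  define c22 where "c22 = (\<lambda>t. (av t \<bullet> av t) * inverse (dt t))"
  \<comment> \<open>The off-diagonal coefficient vanishes at \<open>t = 0\<close>, which is why the
    variations \<open>q1\<close> and \<open>q2\<close> of the mixed derivatives drop out of the
    result.\<close>
  have c0: "c11 0 = 1 / l" "c12 0 = 0" "c22 0 = 1 / l"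
    unfolding c11_def c12_def c22_def d0 at0 ab using ab(4) by (simp_all add: field_simps)
  have C11: "(c11 has_real_derivative - 2 * (a \<bullet> a1) / (l * l)) (at 0)"
    unfolding c11_def by (rule DERIV_cong[OF DERIV_mult[OF G iD]]) (use ab(4) in \<open>simp add: d0 at0 ab divide_simps; simp add: algebra_simps\<close>)
  define m where "m = (a \<bullet> b1 + b \<bullet> a1) / (l * l)"
  have C12: "(c12 has_real_derivative - m) (at 0)"
    unfolding c12_def m_def by (rule DERIV_cong[OF DERIV_mult[OF DERIV_minus[OF F] iD]]) (use ab(4) in \<open>simp add: d0 at0 ab divide_simps; simp add: algebra_simps\<close>)
  have C22: "(c22 has_real_derivative - 2 * (b \<bullet> b1) / (l * l)) (at 0)"
    unfolding c22_def by (rule DERIV_cong[OF DERIV_mult[OF E iD]]) (use ab(4) in \<open>simp add: d0 at0 ab divide_simps; simp add: algebra_simps\<close>)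
  define A1 where "A1 = (1 / l) *\<^sub>R (p1 + r1) - (2 * (a \<bullet> a1) / (l * l)) *\<^sub>R p
     - m *\<^sub>R q - m *\<^sub>R q - (2 * (b \<bullet> b1) / (l * l)) *\<^sub>R r"
  have At_eq: "At = (\<lambda>t. c11 t *\<^sub>R (p + t *\<^sub>R p1) + c12 t *\<^sub>R (q + t *\<^sub>R q1) + c12 t *\<^sub>R (q + t *\<^sub>R q2) + c22 t *\<^sub>R (r + t *\<^sub>R r1))"
    by (simp add: At_def jet_trace_def c11_def c12_def c22_def dt_def)
  have A0: "At 0 = h" by (simp add: At_eq c0 h scaleR_add_right)
  have A: "(At has_vector_derivative A1) (at 0)"
  proof -
    have "(At has_vector_derivative
        (c11 0 *\<^sub>R p1 + (- 2 * (a \<bullet> a1) / (l * l)) *\<^sub>R (p + 0 *\<^sub>R p1))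
      + (c12 0 *\<^sub>R q1 + (- m) *\<^sub>R (q + 0 *\<^sub>R q1))
      + (c12 0 *\<^sub>R q2 + (- m) *\<^sub>R (q + 0 *\<^sub>R q2))
      + (c22 0 *\<^sub>R r1 + (- 2 * (b \<bullet> b1) / (l * l)) *\<^sub>R (r + 0 *\<^sub>R r1))) (at 0)"
      unfolding At_eq
      by (intro has_vector_derivative_add has_vector_derivative_scaleR C11 C12 C22 lin)
    then show ?thesis
      by (simp add: c0 A1_def scaleR_add_right algebra_simps)
  qed
  define s1 where "s1 = (\<lambda>t. c11 t * (At t \<bullet> av t) + c12 t * (At t \<bullet> bv t))"
  define s2 where "s2 = (\<lambda>t. c12 t * (At t \<bullet> av t) + c22 t * (At t \<bullet> bv t))"
  have s0: "s1 0 = 0" "s2 0 = 0" by (auto simp: s1_def s2_def A0 at0 ha)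
  note Aa = inner_d[OF A dat(1)] and Ab = inner_d[OF A dat(2)]
  \<comment> \<open>Existence of these derivatives suffices: since \<open>s1\<close> and
    \<open>s2\<close> vanish at 0, they only contribute \<open>S1 a + S2 b\<close>, which is
    orthogonal to \<open>h\<close>.\<close>
  obtain S1 where S1: "(s1 has_real_derivative S1) (at 0)"
    using DERIV_add[OF DERIV_mult[OF C11 Aa] DERIV_mult[OF C12 Ab]] unfolding s1_def by blast
  obtain S2 where S2: "(s2 has_real_derivative S2) (at 0)"
    using DERIV_add[OF DERIV_mult[OF C12 Aa] DERIV_mult[OF C22 Ab]] unfolding s2_def by blast
  have T: "((\<lambda>t. s1 t *\<^sub>R av t + s2 t *\<^sub>R bv t) has_vector_derivative S1 *\<^sub>R a + S2 *\<^sub>R b) (at 0)"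
    using has_vector_derivative_add[OF has_vector_derivative_scaleR[OF S1 dat(1)] has_vector_derivative_scaleR[OF S2 dat(2)]]
    by (simp add: s0 at0)
  define Ht where "Ht = (\<lambda>t. At t - (s1 t *\<^sub>R av t + s2 t *\<^sub>R bv t))"
  have H0: "Ht 0 = h" by (simp add: Ht_def s0 A0)
  have H: "(Ht has_vector_derivative A1 - (S1 *\<^sub>R a + S2 *\<^sub>R b)) (at 0)"
    unfolding Ht_def by (rule has_vector_derivative_diff[OF A T])
  have HH: "((\<lambda>t. Ht t \<bullet> Ht t) has_real_derivative 2 * (h \<bullet> A1)) (at 0)"
    by (rule DERIV_cong[OF inner_d[OF H H]])
      (simp add: H0 inner_diff_left inner_diff_right inner_add_left inner_add_right ha
        inner_commute[of a h] inner_commute[of b h] inner_commute[of A1 h])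
  have sq: "((\<lambda>t. sqrt (dt t)) has_real_derivative (a \<bullet> a1 + b \<bullet> b1)) (at 0)"
    by (rule DERIV_cong[OF DERIV_chain2[OF DERIV_real_sqrt D]])
      (use ab(4) in \<open>auto simp: d0 divide_simps algebra_simps\<close>)
  have eq: "jet_willmore (a + t *\<^sub>R a1) (b + t *\<^sub>R b1) (p + t *\<^sub>R p1) (q + t *\<^sub>R q1) (q + t *\<^sub>R q2) (r + t *\<^sub>R r1)
     = (Ht t \<bullet> Ht t) * sqrt (dt t)" for t
    by (simp add: jet_willmore_def Ht_def s1_def s2_def jet_tangent_def c11_def c12_def c22_def dt_def At_def av_def bv_def)
  show ?thesis
    unfolding eq
  proof (rule DERIV_cong[OF DERIV_mult[OF HH sq]])
    show "2 * (h \<bullet> A1) * sqrt (dt 0) + (a \<bullet> a1 + b \<bullet> b1) * (Ht 0 \<bullet> Ht 0) =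
      2 * (h \<bullet> (p1 + r1))
      + ((h \<bullet> h - 4 * (h \<bullet> p) / l) *\<^sub>R a - (4 * (h \<bullet> q) / l) *\<^sub>R b) \<bullet> a1
      + ((h \<bullet> h - 4 * (h \<bullet> r) / l) *\<^sub>R b - (4 * (h \<bullet> q) / l) *\<^sub>R a) \<bullet> b1"
      using ab(4)
      by (simp add: H0 d0 A1_def m_def inner_diff_left inner_diff_right inner_add_right divide_simps; simp add: algebra_simps)
  qed
qed

subsection \<open>First variation of the Willmore energy at a conformal immersion\<close>

lemma doubly_periodic_px:
  assumes "doubly_periodic w f" shows "doubly_periodic w (px f)"
proof -
  have "f (z + 1 + u) = f (z + u)" "f (z + w + u) = f (z + u)" for z u
    using assms unfolding doubly_periodic_def by (metis add.assoc add.commute)+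
  then show ?thesis by (simp add: doubly_periodic_def px_def)
qed

lemma doubly_periodic_py:
  assumes "doubly_periodic w f" shows "doubly_periodic w (py f)"
proof -
  have "f (z + 1 + u) = f (z + u)" "f (z + w + u) = f (z + u)" for z u
    using assms unfolding doubly_periodic_def by (metis add.assoc add.commute)+
  then show ?thesis by (simp add: doubly_periodic_def py_def)
qed

lemma px_py_add_scaleR:
  assumes f: "Ck (Suc n) f" and g: "Ck (Suc m) g"
  shows "px (\<lambda>z. f z + t *\<^sub>R g z) = (\<lambda>z. px f z + t *\<^sub>R px g z)"
    "py (\<lambda>z. f z + t *\<^sub>R g z) = (\<lambda>z. py f z + t *\<^sub>R py g z)"
proof -
  have d: "((\<lambda>z. f z + t *\<^sub>R g z) has_derivative (\<lambda>h. (Re h *\<^sub>R px f z + Im h *\<^sub>R py f z)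
      + t *\<^sub>R (Re h *\<^sub>R px g z + Im h *\<^sub>R py g z))) (at z)" for z
    by (intro has_derivative_add has_derivative_scaleR_right Ck_has_derivative[OF f] Ck_has_derivative[OF g])
  show "px (\<lambda>z. f z + t *\<^sub>R g z) = (\<lambda>z. px f z + t *\<^sub>R px g z)"
    "py (\<lambda>z. f z + t *\<^sub>R g z) = (\<lambda>z. py f z + t *\<^sub>R py g z)"
    using has_derivative_px(2)[OF d] has_derivative_py(2)[OF d] by auto
qed

lemma px_py_inner:
  assumes f: "Ck (Suc n) f" and g: "Ck (Suc m) g"
  shows "px (\<lambda>z. f z \<bullet> g z) z = f z \<bullet> px g z + px f z \<bullet> g z"
    "py (\<lambda>z. f z \<bullet> g z) z = f z \<bullet> py g z + py f z \<bullet> g z"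
  using has_derivative_px(2)[OF has_derivative_inner[OF Ck_has_derivative[OF f] Ck_has_derivative[OF g]]]
    has_derivative_py(2)[OF has_derivative_inner[OF Ck_has_derivative[OF f] Ck_has_derivative[OF g]]]
  by auto

lemma willmore_eq_rectangle:
  assumes w: "w \<in> moduli_M" and per: "doubly_periodic w g" and
    cont: "continuous_on (cbox 0 (Complex 1 (Im w))) (\<lambda>z. jet_willmore (px g z) (py g z) (px (px g) z) (py (px g) z) (px (py g) z) (py (py g) z))"
  shows "willmore w g = integral (cbox 0 (Complex 1 (Im w)))
    (\<lambda>z. jet_willmore (px g z) (py g z) (px (px g) z) (py (px g) z) (px (py g) z) (py (py g) z)) / 4"
proof -
  have w': "Im w > 0" "0 \<le> Re w" "Re w \<le> 1" using w by (auto simp: moduli_M_def)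
  note pers = per[THEN doubly_periodic_px] per[THEN doubly_periodic_py]
  show ?thesis
    unfolding willmore_def willmore_integrand_eq_jet
    using pers pers[THEN doubly_periodic_px] pers[THEN doubly_periodic_py]
    by (subst integral_fund_dom_eq_rectangle[OF w' _ cont]) (auto simp: doubly_periodic_def)
qed

text \<open>The equations for \<open>L\<close> express the Euler--Lagrange equation as a conservation law: they turn
  the first variation into a divergence.\<close>

theorem willmore_immersion_if_conservation_law:
  fixes f :: "complex \<Rightarrow> real^4"
  assumes w: "w \<in> moduli_M" and per: "doubly_periodic w f" and imm: "immersion f"
    and conf: "\<And>z. l z > 0" "\<And>z. px f z \<bullet> px f z = l z" "\<And>z. py f z \<bullet> py f z = l z" "\<And>z. px f z \<bullet> py f z = 0"
    and perp: "\<And>z. (px (px f) z + py (py f) z) \<bullet> px f z = 0" "\<And>z. (px (px f) z + py (py f) z) \<bullet> py f z = 0"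
    and h: "\<And>z. h z = (1 / l z) *\<^sub>R (px (px f) z + py (py f) z)"
    and Ck: "Ck 1 h" "Ck 1 L" and perL: "doubly_periodic w L"
    and eqx: "\<And>z. 2 *\<^sub>R px h z - py L z =
      (h z \<bullet> h z - 4 * (h z \<bullet> px (px f) z) / l z) *\<^sub>R px f z - (4 * (h z \<bullet> py (px f) z) / l z) *\<^sub>R py f z"
    and eqy: "\<And>z. 2 *\<^sub>R py h z + px L z =
      (h z \<bullet> h z - 4 * (h z \<bullet> py (py f) z) / l z) *\<^sub>R py f z - (4 * (h z \<bullet> py (px f) z) / l z) *\<^sub>R px f z"
  shows "willmore_immersion w f"
  unfolding willmore_immersion_def
proof (intro conjI allI impI per imm)
  fix \<phi> :: "complex \<Rightarrow> real^4"
  assume "smooth \<phi> \<and> doubly_periodic w \<phi>"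
  then have s\<phi>: "\<And>n. Ck n \<phi>" and per\<phi>: "doubly_periodic w \<phi>" by (auto simp: smooth_def)
  have sf: "\<And>n. Ck n f" using imm by (auto simp: immersion_def smooth_def)
  have w': "Im w > 0" "0 \<le> Re w" "Re w \<le> 1" using w by (auto simp: moduli_M_def)
  define R where "R = cbox 0 (Complex 1 (Im w))"
  have Ckf: "Ck n (px f)" "Ck n (py f)" for n using sf[of "Suc n"] by auto
  have Ck\<phi>: "Ck n (px \<phi>)" "Ck n (py \<phi>)" for n using s\<phi>[of "Suc n"] by auto
  have Ckf2: "Ck n (px (px f))" "Ck n (py (px f))" "Ck n (px (py f))" "Ck n (py (py f))" for n
    using Ckf[of "Suc n"] by auto
  have Ck\<phi>2: "Ck n (px (px \<phi>))" "Ck n (py (px \<phi>))" "Ck n (px (py \<phi>))" "Ck n (py (py \<phi>))" for n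
    using Ck\<phi>[of "Suc n"] by auto
  have cont: "continuous_on A g" if "\<And>n. Ck n g" for A and g :: "complex \<Rightarrow> real^4"
    using Ck_imp_continuous[OF that] continuous_on_subset by blast
  note conts = Ckf[THEN cont] Ck\<phi>[THEN cont] Ckf2[THEN cont] Ck\<phi>2[THEN cont]
  define g where "g = (\<lambda>t z. f z + t *\<^sub>R \<phi> z)"
  have pg: "px (g t) = (\<lambda>z. px f z + t *\<^sub>R px \<phi> z)" "py (g t) = (\<lambda>z. py f z + t *\<^sub>R py \<phi> z)" for t
    unfolding g_def using px_py_add_scaleR[OF sf s\<phi>] by auto
  have pg2: "px (px (g t)) = (\<lambda>z. px (px f) z + t *\<^sub>R px (px \<phi>) z)" "py (px (g t)) = (\<lambda>z. py (px f) z + t *\<^sub>R py (px \<phi>) z)"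
    "px (py (g t)) = (\<lambda>z. px (py f) z + t *\<^sub>R px (py \<phi>) z)" "py (py (g t)) = (\<lambda>z. py (py f) z + t *\<^sub>R py (py \<phi>) z)" for t
    unfolding pg using px_py_add_scaleR[OF Ckf(1) Ck\<phi>(1)] px_py_add_scaleR[OF Ckf(2) Ck\<phi>(2)] by auto
  define I where "I = (\<lambda>t z. jet_willmore (px f z + t *\<^sub>R px \<phi> z) (py f z + t *\<^sub>R py \<phi> z)
    (px (px f) z + t *\<^sub>R px (px \<phi>) z) (py (px f) z + t *\<^sub>R py (px \<phi>) z)
    (px (py f) z + t *\<^sub>R px (py \<phi>) z) (py (py f) z + t *\<^sub>R py (py \<phi>) z))"
  \<comment> \<open>The varied map stays an immersion for small \<open>t\<close>, uniformly on the
    rectangle: the determinant is positive on the compact set \<open>{0} \<times> R\<close>, hence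
    on a neighbourhood of it.\<close>
  have "\<exists>\<delta>>0. \<forall>t z. \<bar>t\<bar> < \<delta> \<and> z \<in> R \<longrightarrow> jet_det (px f z + t *\<^sub>R px \<phi> z) (py f z + t *\<^sub>R py \<phi> z) > 0"
  proof -
    define d where "d = (\<lambda>p. jet_det (px f (snd p) + fst p *\<^sub>R px \<phi> (snd p)) (py f (snd p) + fst p *\<^sub>R py \<phi> (snd p)))"
    have "C1_param UNIV UNIV (\<lambda>t z. jet_det (px f z + t *\<^sub>R px \<phi> z) (py f z + t *\<^sub>R py \<phi> z))"
      by (intro C1_param_jet_det C1_param_affine conts)
    then have cd: "continuous_on UNIV d"
      by (auto simp: C1_param_def d_def)
    then have "open {p. d p > 0}"
      by (intro open_Collect_less continuous_intros)
    moreover have "{0} \<times> R \<subseteq> {p. d p > 0}"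
      using conf by (auto simp: d_def jet_det_def)
    moreover have "compact ({0::real} \<times> R)"
      unfolding R_def by (intro compact_Times) auto
    ultimately obtain e where e: "e > 0" "(\<Union>x\<in>{0} \<times> R. ball x e) \<subseteq> {p. d p > 0}"
      using compact_subset_open_imp_ball_epsilon_subset[of "{0} \<times> R" "{p. d p > 0}"] by metis
    have "d (t, z) > 0" if "\<bar>t\<bar> < e" "z \<in> R" for t z
    proof -
      have "(t, z) \<in> ball (0, z) e" using that by (auto simp: dist_Pair_Pair)
      then show ?thesis using e that by blast
    qed
    then show ?thesis using e(1) by (auto simp: d_def)
  qed
  then obtain \<delta> where \<delta>: "\<delta> > 0"
    and pos: "\<And>t z. t \<in> {-\<delta><..<\<delta>} \<Longrightarrow> z \<in> R \<Longrightarrow> jet_det (px f z + t *\<^sub>R px \<phi> z) (py f z + t *\<^sub>R py \<phi> z) > 0"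
    by (metis abs_less_iff greaterThanLessThan_iff minus_less_iff)
  have "C1_param {-\<delta><..<\<delta>} R I"
    unfolding I_def by (intro C1_param_jet_willmore C1_param_affine conts pos)
  then obtain I' where cI: "continuous_on ({-\<delta><..<\<delta>} \<times> R) (\<lambda>p. I (fst p) (snd p))"
    and cI': "continuous_on ({-\<delta><..<\<delta>} \<times> R) (\<lambda>p. I' (fst p) (snd p))"
    and dI: "\<And>t z. t \<in> {-\<delta><..<\<delta>} \<Longrightarrow> z \<in> R \<Longrightarrow> ((\<lambda>t. I t z) has_vector_derivative I' t z) (at t)"
    by (elim C1_paramE) blast
  have cIt: "continuous_on R (I t)" if "t \<in> {-\<delta><..<\<delta>}" for t
  proof -
    have "continuous_on R (\<lambda>z. I (fst (t, z)) (snd (t, z)))"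
      by (rule continuous_on_compose2[OF cI]) (use that in \<open>auto intro!: continuous_intros\<close>)
    then show ?thesis by simp
  qed
  have W: "willmore w (g t) = integral R (I t) / 4" if "t \<in> {-\<delta><..<\<delta>}" for t
  proof -
    have "doubly_periodic w (g t)"
      using per per\<phi> by (auto simp: doubly_periodic_def g_def)
    from willmore_eq_rectangle[OF w this, unfolded pg2, unfolded pg] cIt[OF that] show ?thesis
      by (simp add: I_def R_def)
  qed
  have leib: "((\<lambda>t. integral R (I t)) has_real_derivative integral R (I' 0)) (at 0 within {-\<delta><..<\<delta>})"
    unfolding R_def
  proof (rule leibniz_rule_field_derivative)
    show "((\<lambda>t. I t z) has_real_derivative I' t z) (at t within {-\<delta><..<\<delta>})"
      if "t \<in> {-\<delta><..<\<delta>}" "z \<in> cbox 0 (Complex 1 (Im w))" for t z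
      using dI[of t z] that
      by (auto simp: R_def has_real_derivative_iff_has_vector_derivative intro: has_vector_derivative_at_within)
    show "I t integrable_on cbox 0 (Complex 1 (Im w))" if "t \<in> {-\<delta><..<\<delta>}" for t
      using cIt[OF that] by (auto simp: R_def intro: integrable_continuous)
    show "continuous_on ({-\<delta><..<\<delta>} \<times> cbox 0 (Complex 1 (Im w))) (\<lambda>(t, z). I' t z)"
      using cI' by (simp add: R_def case_prod_unfold)
  qed (use \<delta> in auto)
  \<comment> \<open>In \<open>px U + py V\<close> the mixed derivatives of \<phi> paired with
    \<open>L\<close> cancel by symmetry. What remains is \<open>2 h\<close> paired with the
    Laplacian of \<phi>, plus \<open>2 px h - py L\<close> paired with \<open>px \<phi>\<close> and
    \<open>2 py h + px L\<close> paired with \<open>py \<phi>\<close>: exactly the first variation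
    once \<open>eqx\<close> and \<open>eqy\<close> are inserted.\<close>
  define U where "U = (\<lambda>z. h z \<bullet> (2 *\<^sub>R px \<phi> z) + L z \<bullet> py \<phi> z)"
  define V where "V = (\<lambda>z. h z \<bullet> (2 *\<^sub>R py \<phi> z) + L z \<bullet> (- px \<phi> z))"
  have Ck1: "Ck (Suc 0) h" "Ck (Suc 0) L" using Ck by auto
  have Ck2: "Ck n (\<lambda>z. 2 *\<^sub>R px \<phi> z)" "Ck n (\<lambda>z. 2 *\<^sub>R py \<phi> z)" "Ck n (\<lambda>z. - px \<phi> z)" for n
    by (intro Ck_bounded_linear[OF bounded_linear_scaleR_right] Ck_bounded_linear[OF bounded_linear_minus[OF bounded_linear_ident]] Ck\<phi>)+
  note Ck_inner = bounded_bilinear.Ck[OF bounded_bilinear_inner]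
  have CkU: "Ck 1 U" "Ck 1 V"
    unfolding U_def V_def by (intro Ck_add Ck_inner Ck Ck2 Ck\<phi>)+
  have lin: "px (\<lambda>z. c *\<^sub>R g z) z = c *\<^sub>R px g z" "py (\<lambda>z. c *\<^sub>R g z) z = c *\<^sub>R py g z"
    if "\<And>n. Ck n g" for g :: "complex \<Rightarrow> real^4" and z c
    using px_py_add_scaleR[OF Ck_const that, of 0 c] Ck_has_derivative[OF Ck_const[where c="0::real^4"]]
    has_derivative_px(2)[OF has_derivative_const[where c="0::real^4"]] has_derivative_py(2)[OF has_derivative_const[where c="0::real^4"]]
    by (auto simp: fun_eq_iff)
  have linm: "py (\<lambda>z. - g z) z = - py g z"
    if "\<And>n. Ck n g" for g :: "complex \<Rightarrow> real^4" and z
    using lin(2)[OF that, of "-1"] by simp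
  have add: "px (\<lambda>z. u z + v z) z = px u z + px v z" "py (\<lambda>z. u z + v z) z = py u z + py v z"
    if "Ck (Suc 0) u" "Ck (Suc 0) v" for u v :: "complex \<Rightarrow> real" and z
    using px_py_add_scaleR[OF that, of 1] by (auto simp: fun_eq_iff)
  have I'0: "I' 0 z = px U z + py V z" if "z \<in> R" for z
  proof -
    have mixf: "px (py f) z = py (px f) z" and mix\<phi>: "py (px \<phi>) z = px (py \<phi>) z" 
      using py_px_eq_px_py[OF sf] py_px_eq_px_py[OF s\<phi>] by auto
    define D where "D = 2 * (h z \<bullet> (px (px \<phi>) z + py (py \<phi>) z)) + (2 *\<^sub>R px h z - py L z) \<bullet> px \<phi> z
      + (2 *\<^sub>R py h z + px L z) \<bullet> py \<phi> z"
    have "((\<lambda>t. I t z) has_real_derivative D) (at 0)"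
      unfolding I_def mixf eqx eqy D_def
      by (rule jet_willmore_has_derivative) (use conf perp h in auto)
    moreover have "((\<lambda>t. I t z) has_real_derivative I' 0 z) (at 0)"
      using dI[OF _ that, of 0] \<delta> by (simp add: has_real_derivative_iff_has_vector_derivative)
    ultimately have "I' 0 z = D"
      using DERIV_unique by blast
    also have "D = px U z + py V z"
    proof -
      have "px U z = (h z \<bullet> (2 *\<^sub>R px (px \<phi>) z) + px h z \<bullet> (2 *\<^sub>R px \<phi> z)) + (L z \<bullet> px (py \<phi>) z + px L z \<bullet> py \<phi> z)"
        unfolding U_def
        using add(1)[OF Ck_inner[OF Ck1(1) Ck2(1)] Ck_inner[OF Ck1(2) Ck\<phi>(2)]]
          px_py_inner(1)[OF Ck1(1) Ck2(1)] px_py_inner(1)[OF Ck1(2) Ck\<phi>(2)] lin(1)[OF Ck\<phi>(1)] by simp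
      moreover have "py V z = (h z \<bullet> (2 *\<^sub>R py (py \<phi>) z) + py h z \<bullet> (2 *\<^sub>R py \<phi> z)) + (L z \<bullet> (- py (px \<phi>) z) + py L z \<bullet> (- px \<phi> z))"
        unfolding V_def
        using add(2)[OF Ck_inner[OF Ck1(1) Ck2(2)] Ck_inner[OF Ck1(2) Ck2(3)]]
          px_py_inner(2)[OF Ck1(1) Ck2(2)] px_py_inner(2)[OF Ck1(2) Ck2(3)] lin(2)[OF Ck\<phi>(2)] linm[OF Ck\<phi>(1)] by simp
      ultimately show ?thesis
        by (simp add: D_def mix\<phi> inner_add_left inner_add_right inner_diff_left)
    qed
    finally show ?thesis .
  qed
  have perh: "doubly_periodic w h"
    using per[THEN doubly_periodic_px] per[THEN doubly_periodic_px, THEN doubly_periodic_px]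
      per[THEN doubly_periodic_py, THEN doubly_periodic_py] conf(2)
    unfolding doubly_periodic_def h conf(2)[symmetric] by simp
  have "integral R (I' 0) = integral R (\<lambda>z. px U z + py V z)"
    by (intro integral_cong I'0)
  also have "\<dots> = integral R (px U) + integral R (py V)"
    unfolding R_def using CkU
    by (intro Henstock_Kurzweil_Integration.integral_add integrable_continuous)
      (auto intro: continuous_on_subset)
  also have "integral R (px U) = 0"
    unfolding R_def using perh perL per\<phi>[THEN doubly_periodic_px] per\<phi>[THEN doubly_periodic_py]
    by (intro integral_rectangle_px CkU) (auto simp: U_def doubly_periodic_def)
  also have "integral R (py V) = 0"
    unfolding R_def using perh perL per\<phi>[THEN doubly_periodic_px] per\<phi>[THEN doubly_periodic_py] w'
    by (intro integral_rectangle_py CkU) (auto simp: V_def doubly_periodic_def)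
  finally have "((\<lambda>t. integral R (I t)) has_real_derivative 0) (at 0 within {-\<delta><..<\<delta>})"
    using leib by simp
  then have "((\<lambda>t. integral R (I t)) has_real_derivative 0) (at 0)"
    using at_within_open[of 0 "{-\<delta><..<\<delta>}"] \<delta> by simp
  then have "((\<lambda>t. integral R (I t) / 4) has_real_derivative 0) (at 0)"
    using DERIV_cdivide[of "\<lambda>t. integral R (I t)" 0 0 UNIV 4] by simp
  then have "((\<lambda>t. willmore w (g t)) has_real_derivative 0) (at 0)"
    by (rule DERIV_cong_ev[THEN iffD1, rotated 3])
      (use W \<delta> in \<open>auto intro!: eventually_nhds_in_open[THEN eventually_mono, of "{-\<delta><..<\<delta>}"]\<close>)
  then show "((\<lambda>t. willmore w (\<lambda>z. f z + t *\<^sub>R \<phi> z)) has_real_derivative 0) (at 0)"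
    by (simp add: g_def)
qed

subsection \<open>Wirtinger derivatives\<close>

text \<open>The real differential in the basis \<open>dz\<close>, \<open>d(cnj z)\<close>:
  \<open>a\<close> is the derivative in \<open>z\<close> and \<open>b\<close> the one in
  \<open>cnj z\<close>. In relational form one of the two can be left existential when only the
  other is computed.\<close>

definition wirtinger :: "(complex \<Rightarrow> complex) \<Rightarrow> complex \<Rightarrow> complex \<Rightarrow> complex \<Rightarrow> bool" where
  "wirtinger f a b z \<longleftrightarrow> (f has_derivative (\<lambda>h. a * h + b * cnj h)) (at z)"

lemma wirtinger_cong: "wirtinger f a b z \<Longrightarrow> a = a' \<Longrightarrow> b = b' \<Longrightarrow> wirtinger f a' b' z"
  by simp

lemma wirtinger_add:
  "wirtinger f a b z \<Longrightarrow> wirtinger g c d z \<Longrightarrow> wirtinger (\<lambda>z. f z + g z) (a + c) (b + d) z"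
  unfolding wirtinger_def by (drule (1) has_derivative_add) (simp add: algebra_simps)

lemma wirtinger_minus: "wirtinger f a b z \<Longrightarrow> wirtinger (\<lambda>z. - f z) (- a) (- b) z"
  unfolding wirtinger_def by (drule has_derivative_minus) (simp add: algebra_simps)

lemma wirtinger_diff:
  "wirtinger f a b z \<Longrightarrow> wirtinger g c d z \<Longrightarrow> wirtinger (\<lambda>z. f z - g z) (a - c) (b - d) z"
  unfolding wirtinger_def by (drule (1) has_derivative_diff) (simp add: algebra_simps)

lemma wirtinger_mult:
  "wirtinger f a b z \<Longrightarrow> wirtinger g c d z \<Longrightarrow>
    wirtinger (\<lambda>z. f z * g z) (f z * c + a * g z) (f z * d + b * g z) z"
  unfolding wirtinger_def by (drule (1) has_derivative_mult) (simp add: algebra_simps)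

lemma wirtinger_cmult: "wirtinger f a b z \<Longrightarrow> wirtinger (\<lambda>z. k * f z) (k * a) (k * b) z"
  unfolding wirtinger_def by (drule has_derivative_mult_right[of _ _ _ k]) (simp add: algebra_simps)

lemma wirtinger_cnj: "wirtinger f a b z \<Longrightarrow> wirtinger (\<lambda>z. cnj (f z)) (cnj b) (cnj a) z"
  unfolding wirtinger_def by (drule bounded_linear.has_derivative[OF bounded_linear_cnj]) (simp add: algebra_simps)

lemma wirtinger_inverse:
  assumes "wirtinger f a b z" "f z \<noteq> 0"
  shows "wirtinger (\<lambda>z. inverse (f z)) (- a / (f z)\<^sup>2) (- b / (f z)\<^sup>2) z"
  unfolding wirtinger_def
  by (rule has_derivative_eq_rhs[OF Deriv.has_derivative_inverse[OF assms(2) assms(1)[unfolded wirtinger_def]]])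
    (use assms(2) in \<open>simp add: fun_eq_iff divide_simps; simp add: algebra_simps power2_eq_square\<close>)

lemma wirtinger_entire:
  assumes "f holomorphic_on UNIV"
  shows "wirtinger f (deriv f z) 0 z"
  using holomorphic_derivI[OF assms, of z] by (simp add: wirtinger_def has_field_derivative_def)

lemma Ck_cnj: "Ck n g \<Longrightarrow> Ck n (\<lambda>z. cnj (g z))" for g :: "complex \<Rightarrow> complex"
  by (rule Ck_bounded_linear[OF bounded_linear_cnj])

lemma Ck_minus: "Ck n g \<Longrightarrow> Ck n (\<lambda>z. - g z)" for g :: "complex \<Rightarrow> complex"
  by (rule Ck_bounded_linear[OF bounded_linear_minus[OF bounded_linear_ident]])

lemma Ck_diff: "Ck n g \<Longrightarrow> Ck n g' \<Longrightarrow> Ck n (\<lambda>z. g z - g' z)" for g g' :: "complex \<Rightarrow> complex"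
  using Ck_add[OF _ Ck_minus, of n g g'] by simp

subsection \<open>Identification of \<open>\<complex>\<^sup>2\<close> with \<open>\<real>\<^sup>4\<close>\<close>

definition vec4 :: "complex \<Rightarrow> complex \<Rightarrow> real^4" where
  "vec4 u v = vector [Re u, Im u, Re v, Im v]"

lemma vec4_nth [simp]:
  "vec4 u v $ 1 = Re u" "vec4 u v $ 2 = Im u" "vec4 u v $ 3 = Re v" "vec4 u v $ 4 = Im v"
  by (simp_all add: vec4_def vector_def)

lemma vec4_add: "vec4 u v + vec4 u' v' = vec4 (u + u') (v + v')"
  and vec4_diff: "vec4 u v - vec4 u' v' = vec4 (u - u') (v - v')"
  and vec4_scaleR: "c *\<^sub>R vec4 u v = vec4 (of_real c * u) (of_real c * v)"
  and vec4_eq_iff: "vec4 u v = vec4 u' v' \<longleftrightarrow> u = u' \<and> v = v'"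
  by (auto simp: vec_eq_iff forall_4 complex_eq_iff)

lemma vec4_eq_0_iff: "vec4 u v = 0 \<longleftrightarrow> u = 0 \<and> v = 0"
  by (auto simp: vec_eq_iff forall_4 complex_eq_iff)

lemma ex_vec4: "\<exists>u v. x = vec4 u v"
  by (rule exI[of _ "Complex (x$1) (x$2)"], rule exI[of _ "Complex (x$3) (x$4)"])
    (simp add: vec_eq_iff forall_4)

lemma inner_vec4: "vec4 u v \<bullet> vec4 u' v' = Re (u * cnj u' + v * cnj v')"
  by (simp add: inner_vec_def sum_4)

lemma bounded_linear_vec4: "bounded_linear (\<lambda>u. vec4 u 0)" "bounded_linear (\<lambda>u. vec4 0 u)"
  by (auto intro!: linearI linear_conv_bounded_linear[THEN iffD1] simp: vec_eq_iff forall_4)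

lemma vec4_split: "vec4 u v = vec4 u 0 + vec4 0 v"
  by (simp add: vec4_add)

lemma Ck_vec4:
  assumes "Ck n f" "Ck n g" shows "Ck n (\<lambda>z. vec4 (f z) (g z))"
  by (subst vec4_split) (intro Ck_add Ck_bounded_linear[OF bounded_linear_vec4(1)]
      Ck_bounded_linear[OF bounded_linear_vec4(2)] assms)

lemma px_py_vec4:
  assumes "wirtinger f a b z" "wirtinger g c d z"
  shows "px (\<lambda>z. vec4 (f z) (g z)) z = vec4 (a + b) (c + d)"
    "py (\<lambda>z. vec4 (f z) (g z)) z = vec4 (\<i> * (a - b)) (\<i> * (c - d))"
proof -
  have *: "((\<lambda>z. vec4 (f z) (g z)) has_derivative (\<lambda>h. vec4 (a * h + b * cnj h) (c * h + d * cnj h))) (at z)"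
    using has_derivative_add[OF bounded_linear.has_derivative[OF bounded_linear_vec4(1) assms(1)[unfolded wirtinger_def]]
      bounded_linear.has_derivative[OF bounded_linear_vec4(2) assms(2)[unfolded wirtinger_def]]]
    by (simp add: vec4_add)
  show "px (\<lambda>z. vec4 (f z) (g z)) z = vec4 (a + b) (c + d)"
    "py (\<lambda>z. vec4 (f z) (g z)) z = vec4 (\<i> * (a - b)) (\<i> * (c - d))"
    using has_derivative_px(2)[OF *] has_derivative_py(2)[OF *] by (auto simp: algebra_simps)
qed

subsection \<open>Surfaces framed by a holomorphic curve\<close>

text \<open>Writing \<open>G' = (-cnj G2, cnj G1)\<close>, the structure equations say that the Wirtinger derivatives are
  \<open>d f = \<alpha> G' dz + \<beta> G d(cnj z)\<close> and \<open>d G = (D G + \<mu> G') dz\<close>. The equations for \<open>\<alpha>\<close> and \<open>\<beta>\<close> are the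
  resulting integrability conditions.\<close>

locale framed_surface =
  fixes G1 G2 \<alpha> \<beta> \<mu> D \<alpha>1 \<beta>2 \<mu>1 f1 f2 :: "complex \<Rightarrow> complex"
  assumes Ck_fun: "\<And>n. Ck n G1" "\<And>n. Ck n G2" "\<And>n. Ck n \<alpha>" "\<And>n. Ck n \<beta>" "\<And>n. Ck n \<mu>" "\<And>n. Ck n f1" "\<And>n. Ck n f2"
    and wG1: "\<And>z. wirtinger G1 (D z * G1 z - \<mu> z * cnj (G2 z)) 0 z"
    and wG2: "\<And>z. wirtinger G2 (D z * G2 z + \<mu> z * cnj (G1 z)) 0 z"
    and w\<alpha>: "\<And>z. wirtinger \<alpha> (\<alpha>1 z) (\<beta> z * \<mu> z - \<alpha> z * cnj (D z)) z"
    and w\<beta>: "\<And>z. wirtinger \<beta> (- \<alpha> z * cnj (\<mu> z) - \<beta> z * D z) (\<beta>2 z) z"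
    and w\<mu>: "\<And>z. wirtinger \<mu> (\<mu>1 z) (- \<mu> z * cnj (D z)) z"
    and wf1: "\<And>z. wirtinger f1 (- \<alpha> z * cnj (G2 z)) (\<beta> z * G1 z) z"
    and wf2: "\<And>z. wirtinger f2 (\<alpha> z * cnj (G1 z)) (\<beta> z * G2 z) z"
    and G_nz: "\<And>z. G1 z \<noteq> 0 \<or> G2 z \<noteq> 0"
    and ab_nz: "\<And>z. \<alpha> z \<noteq> 0 \<or> \<beta> z \<noteq> 0"
begin

definition f where "f = (\<lambda>z. vec4 (f1 z) (f2 z))"
definition N where "N = (\<lambda>z. G1 z * cnj (G1 z) + G2 z * cnj (G2 z))"
text \<open>The conformal factor as a complex-valued function, so that the Wirtinger rules apply to
  it.\<close>

definition lc where "lc = (\<lambda>z. N z * (\<alpha> z * cnj (\<alpha> z) + \<beta> z * cnj (\<beta> z)))"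
definition l where "l = (\<lambda>z. Re (lc z))"
text \<open>The structure equations give \<open>\<beta> \<mu> G' - \<alpha> cnj \<mu> G\<close> for
  the mixed derivative of \<open>f\<close> in \<open>z\<close> and \<open>cnj z\<close>. The
  Laplacian is four times this; divided by the conformal factor it becomes
  \<open>h = e G' - k G\<close>, and \<open>c\<close> is the factor shared, up to conjugation, by
  \<open>e\<close> and \<open>k\<close>.\<close>

definition c where "c = (\<lambda>z. 4 * cnj (\<mu> z) * inverse (lc z))"
definition c1 where "c1 = (\<lambda>z. - c z * D z - c z * (N z * (\<alpha>1 z * cnj (\<alpha> z) + \<beta> z * cnj (\<beta>2 z))) / lc z)"
definition e where "e = (\<lambda>z. cnj (c z) * \<beta> z)"
definition k where "k = (\<lambda>z. c z * \<alpha> z)"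
definition h where "h = (\<lambda>z. vec4 (- (e z * cnj (G2 z)) - k z * G1 z) (e z * cnj (G1 z) - k z * G2 z))"
text \<open>Here \<open>L = -2 \<i> (e G' + k G)\<close>, twice the image of \<open>h\<close> under
  the map that multiplies by \<i> on the line of \<open>G\<close> and by -\<i> on the line of
  \<open>G'\<close>. This map sends \<open>px f\<close> to \<open>- py f\<close> and
  \<open>py f\<close> to \<open>px f\<close>, so it preserves the tangent plane and acts on the
  normal plane as a quarter turn.\<close>

definition L where "L = (\<lambda>z. vec4 (2 * \<i> * (e z * cnj (G2 z) - k z * G1 z)) (2 * \<i> * (- (e z * cnj (G1 z)) - k z * G2 z)))"
text \<open>The trace-free second fundamental form in the direction \<open>h\<close>, stored as one
  complex number: \<open>l m\<close> has real part \<open>h \<bullet> (f_xx - f_yy)\<close> and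
  imaginary part \<open>-2 (h \<bullet> f_xy)\<close>, as \<open>h_second\<close> shows.\<close>

definition m where "m = (\<lambda>z. 2 * c z * N z / lc z * (\<alpha>1 z * cnj (\<beta> z) - \<alpha> z * cnj (\<beta>2 z)))"

lemma l_pos: "l z > 0" and lc_eq: "lc z = of_real (l z)" and cnj_lc: "cnj (lc z) = lc z"
  and lc_nz: "lc z \<noteq> 0" and cnj_N: "cnj (N z) = N z"
proof -
  have eq: "lc z = of_real (((norm (G1 z))\<^sup>2 + (norm (G2 z))\<^sup>2) * ((norm (\<alpha> z))\<^sup>2 + (norm (\<beta> z))\<^sup>2))"
    unfolding lc_def N_def by (simp only: complex_norm_square of_real_mult of_real_add)
  then have l: "l z = ((norm (G1 z))\<^sup>2 + (norm (G2 z))\<^sup>2) * ((norm (\<alpha> z))\<^sup>2 + (norm (\<beta> z))\<^sup>2)"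
    unfolding l_def eq by simp
  show pos: "l z > 0"
    unfolding l using G_nz[of z] ab_nz[of z]
    by (intro mult_pos_pos) (auto intro: add_pos_nonneg add_nonneg_pos)
  show lc: "lc z = of_real (l z)" using eq l by simp
  show "cnj (lc z) = lc z" "lc z \<noteq> 0" using pos by (auto simp: lc)
  show "cnj (N z) = N z" by (simp add: N_def mult.commute)
qed

lemma Ck_lc: "Ck n lc"
  unfolding lc_def N_def by (intro Ck_mult Ck_add Ck_cnj Ck_fun)

lemma Ck_c: "Ck n c"
  unfolding c_def by (intro Ck_mult Ck_cnj Ck_fun Ck_const Ck_inverse Ck_lc lc_nz)

lemma Ck_f: "Ck n f" and Ck_h: "Ck n h" and Ck_L: "Ck n L"
  unfolding f_def h_def L_def e_def k_def
  by (intro Ck_vec4 Ck_mult Ck_diff Ck_minus Ck_cnj Ck_fun Ck_const Ck_c)+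

lemma px_f: "px f = (\<lambda>z. vec4 (- \<alpha> z * cnj (G2 z) + \<beta> z * G1 z) (\<alpha> z * cnj (G1 z) + \<beta> z * G2 z))"
  and py_f: "py f = (\<lambda>z. vec4 (\<i> * (- \<alpha> z * cnj (G2 z) - \<beta> z * G1 z)) (\<i> * (\<alpha> z * cnj (G1 z) - \<beta> z * G2 z)))"
  unfolding f_def fun_eq_iff using px_py_vec4[OF wf1 wf2] by auto

text \<open>\<open>G\<close> and \<open>G'\<close> are Hermitian orthogonal and of equal length, and
  the partial derivatives are \<open>\<alpha> G' + \<beta> G\<close> and
  \<open>\<i> (\<alpha> G' - \<beta> G)\<close>. So their lengths agree and their Hermitian product
  is purely imaginary.\<close>

lemma conformal_f: "px f z \<bullet> px f z = l z" "py f z \<bullet> py f z = l z" "px f z \<bullet> py f z = 0"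
proof -
  show "px f z \<bullet> px f z = l z" "py f z \<bullet> py f z = l z"
    unfolding px_f py_f inner_vec4 l_def lc_def N_def by (rule arg_cong[where f=Re], simp add: algebra_simps)+
  have "(- \<alpha> z * cnj (G2 z) + \<beta> z * G1 z) * cnj (\<i> * (- \<alpha> z * cnj (G2 z) - \<beta> z * G1 z))
      + (\<alpha> z * cnj (G1 z) + \<beta> z * G2 z) * cnj (\<i> * (\<alpha> z * cnj (G1 z) - \<beta> z * G2 z))
    = - \<i> * ((G1 z * cnj (G1 z) + G2 z * cnj (G2 z)) * (\<alpha> z * cnj (\<alpha> z) - \<beta> z * cnj (\<beta> z)))"
    by (simp add: algebra_simps)
  also have "\<dots> = - \<i> * of_real (((norm (G1 z))\<^sup>2 + (norm (G2 z))\<^sup>2) * ((norm (\<alpha> z))\<^sup>2 - (norm (\<beta> z))\<^sup>2))"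
    by (simp only: complex_norm_square of_real_mult of_real_add of_real_diff)
  finally show "px f z \<bullet> py f z = 0"
    unfolding px_f py_f inner_vec4 by simp
qed

text \<open>Since \<open>G\<close> is holomorphic and \<open>G'\<close> antiholomorphic, the pure
  second derivatives are \<open>\<alpha>1 G'\<close> (twice in \<open>z\<close>) and
  \<open>\<beta>2 G\<close> (twice in \<open>cnj z\<close>). \<open>K1\<close> and \<open>K2\<close>
  are the components of the mixed one, obtained equally from \<open>\<alpha> G'\<close> and from
  \<open>\<beta> G\<close>; the terms with \<open>D\<close> cancel.\<close>

lemma second_derivatives:
  defines "K1 \<equiv> \<lambda>z. - (\<beta> z * \<mu> z * cnj (G2 z)) - \<alpha> z * cnj (\<mu> z) * G1 z"
    and "K2 \<equiv> \<lambda>z. \<beta> z * \<mu> z * cnj (G1 z) - \<alpha> z * cnj (\<mu> z) * G2 z"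
  shows "px (px f) z = vec4 (- (\<alpha>1 z * cnj (G2 z)) + 2 * K1 z + \<beta>2 z * G1 z) (\<alpha>1 z * cnj (G1 z) + 2 * K2 z + \<beta>2 z * G2 z)"
    "py (px f) z = vec4 (\<i> * (- (\<alpha>1 z * cnj (G2 z)) - \<beta>2 z * G1 z)) (\<i> * (\<alpha>1 z * cnj (G1 z) - \<beta>2 z * G2 z))"
    "py (py f) z = vec4 (\<alpha>1 z * cnj (G2 z) + 2 * K1 z - \<beta>2 z * G1 z) (- (\<alpha>1 z * cnj (G1 z)) + 2 * K2 z - \<beta>2 z * G2 z)"
proof -
  note wc = wirtinger_cnj[OF wG1] wirtinger_cnj[OF wG2]
  have u: "wirtinger (\<lambda>z. \<alpha> z * cnj (G2 z)) (\<alpha>1 z * cnj (G2 z))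
      (\<beta> z * \<mu> z * cnj (G2 z) + \<alpha> z * cnj (\<mu> z) * G1 z) z"
    by (rule wirtinger_cong[OF wirtinger_mult[OF w\<alpha> wc(2)]]) (auto simp: algebra_simps)
  have u': "wirtinger (\<lambda>z. \<alpha> z * cnj (G1 z)) (\<alpha>1 z * cnj (G1 z))
      (\<beta> z * \<mu> z * cnj (G1 z) - \<alpha> z * cnj (\<mu> z) * G2 z) z"
    by (rule wirtinger_cong[OF wirtinger_mult[OF w\<alpha> wc(1)]]) (auto simp: algebra_simps)
  have v: "wirtinger (\<lambda>z. \<beta> z * G1 z) (- (\<beta> z * \<mu> z * cnj (G2 z)) - \<alpha> z * cnj (\<mu> z) * G1 z) (\<beta>2 z * G1 z) z"
    by (rule wirtinger_cong[OF wirtinger_mult[OF w\<beta> wG1]]) (auto simp: algebra_simps)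
  have v': "wirtinger (\<lambda>z. \<beta> z * G2 z) (\<beta> z * \<mu> z * cnj (G1 z) - \<alpha> z * cnj (\<mu> z) * G2 z) (\<beta>2 z * G2 z) z"
    by (rule wirtinger_cong[OF wirtinger_mult[OF w\<beta> wG2]]) (auto simp: algebra_simps)
  note wx = px_py_vec4[OF wirtinger_add[OF wirtinger_minus[OF u] v] wirtinger_add[OF u' v']]
  note wy = px_py_vec4[OF wirtinger_cmult[of _ _ _ _ \<i>, OF wirtinger_diff[OF wirtinger_minus[OF u] v]]
      wirtinger_cmult[of _ _ _ _ \<i>, OF wirtinger_diff[OF u' v']]]
  show "px (px f) z = vec4 (- (\<alpha>1 z * cnj (G2 z)) + 2 * K1 z + \<beta>2 z * G1 z) (\<alpha>1 z * cnj (G1 z) + 2 * K2 z + \<beta>2 z * G2 z)"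
    "py (px f) z = vec4 (\<i> * (- (\<alpha>1 z * cnj (G2 z)) - \<beta>2 z * G1 z)) (\<i> * (\<alpha>1 z * cnj (G1 z) - \<beta>2 z * G2 z))"
    using wx unfolding px_f K1_def K2_def by (simp_all add: vec4_eq_iff algebra_simps)
  show "py (py f) z = vec4 (\<alpha>1 z * cnj (G2 z) + 2 * K1 z - \<beta>2 z * G1 z) (- (\<alpha>1 z * cnj (G1 z)) + 2 * K2 z - \<beta>2 z * G2 z)"
    using wy(2) unfolding py_f K1_def K2_def by (simp add: vec4_eq_iff algebra_simps)
qed

lemma cnj_c: "cnj (c z) = 4 * \<mu> z * inverse (lc z)"
  by (simp add: c_def cnj_lc)

lemma laplace_f: "px (px f) z + py (py f) z = l z *\<^sub>R h z"
  unfolding second_derivatives h_def vec4_add vec4_scaleR vec4_eq_iff lc_eq[symmetric] e_def k_def cnj_c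
  using lc_nz[of z] by (simp add: c_def field_simps)

text \<open>The common factor \<open>c\<close> makes the Hermitian product of \<open>h\<close> with
  \<open>px f\<close> a real multiple of \<open>q - cnj q\<close>, and the one with
  \<open>py f\<close> an imaginary multiple of \<open>q + cnj q\<close>; both have real part
  0.\<close>

lemma h_perp: "h z \<bullet> px f z = 0" "h z \<bullet> py f z = 0"
proof -
  have "(- (e z * cnj (G2 z)) - k z * G1 z) * cnj (- \<alpha> z * cnj (G2 z) + \<beta> z * G1 z)
     + (e z * cnj (G1 z) - k z * G2 z) * cnj (\<alpha> z * cnj (G1 z) + \<beta> z * G2 z)
     = N z * (cnj (c z) * \<beta> z * cnj (\<alpha> z) - cnj (cnj (c z) * \<beta> z * cnj (\<alpha> z)))"
    by (simp add: e_def k_def N_def algebra_simps)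
  moreover have "(- (e z * cnj (G2 z)) - k z * G1 z) * cnj (\<i> * (- \<alpha> z * cnj (G2 z) - \<beta> z * G1 z))
     + (e z * cnj (G1 z) - k z * G2 z) * cnj (\<i> * (\<alpha> z * cnj (G1 z) - \<beta> z * G2 z))
     = - \<i> * (N z * (cnj (c z) * \<beta> z * cnj (\<alpha> z) + cnj (cnj (c z) * \<beta> z * cnj (\<alpha> z))))"
    by (simp add: e_def k_def N_def algebra_simps)
  moreover have "Re (N z * (q - cnj q)) = 0" "Re (- \<i> * (N z * (q + cnj q))) = 0" for q
    using cnj_N[of z] by (simp_all add: complex_eq_iff)
  ultimately show "h z \<bullet> px f z = 0" "h z \<bullet> py f z = 0"
    unfolding h_def px_f py_f inner_vec4 by (simp_all only:)
qed

text \<open>\<alpha> and \<beta> cancel, so the Willmore integrand depends on \<mu> alone, that is,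
  only on the curve \<open>G\<close> and not on \<open>T\<close>.\<close>

lemma norm_h: "of_real (h z \<bullet> h z) = 16 * \<mu> z * cnj (\<mu> z) / lc z" (is ?A)
  and norm_h_real: "l z * (h z \<bullet> h z) = 16 * (norm (\<mu> z))\<^sup>2"
proof -
  have "(- (e z * cnj (G2 z)) - k z * G1 z) * cnj (- (e z * cnj (G2 z)) - k z * G1 z)
     + (e z * cnj (G1 z) - k z * G2 z) * cnj (e z * cnj (G1 z) - k z * G2 z) = c z * cnj (c z) * lc z"
    by (simp add: e_def k_def lc_def N_def algebra_simps)
  also have "\<dots> = 16 * \<mu> z * cnj (\<mu> z) / lc z"
    using lc_nz[of z] unfolding cnj_c by (simp add: c_def field_simps)
  also have mu: "\<dots> = of_real (16 * (norm (\<mu> z))\<^sup>2 / l z)"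
    by (simp only: lc_eq of_real_divide of_real_mult complex_norm_square of_real_numeral mult.assoc)
  finally have *: "h z \<bullet> h z = 16 * (norm (\<mu> z))\<^sup>2 / l z"
    unfolding h_def inner_vec4 by (simp only: Re_complex_of_real)
  then show "l z * (h z \<bullet> h z) = 16 * (norm (\<mu> z))\<^sup>2" using l_pos[of z] by simp
  show ?A unfolding * mu ..
qed

lemma h_second:
  "h z \<bullet> px (px f) z = l z / 2 * Re (m z) + l z / 2 * (h z \<bullet> h z)"
  "h z \<bullet> py (py f) z = - (l z / 2 * Re (m z)) + l z / 2 * (h z \<bullet> h z)"
  "h z \<bullet> py (px f) z = - (l z / 2 * Im (m z))"
proof -
  \<comment> \<open>\<open>P = \<alpha>1 G' + \<beta>2 G\<close> is the trace-free part: the xx and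
    yy derivatives are \<open>P\<close> and \<open>- P\<close>, each plus half the
    Laplacian.\<close>
  define P where "P = vec4 (- (\<alpha>1 z * cnj (G2 z)) + \<beta>2 z * G1 z) (\<alpha>1 z * cnj (G1 z) + \<beta>2 z * G2 z)"
  have lap: "vec4 (- (\<beta> z * \<mu> z * cnj (G2 z)) - \<alpha> z * cnj (\<mu> z) * G1 z)
     (\<beta> z * \<mu> z * cnj (G1 z) - \<alpha> z * cnj (\<mu> z) * G2 z) = (l z / 4) *\<^sub>R h z"
    unfolding h_def vec4_scaleR vec4_eq_iff e_def k_def cnj_c using lc_nz[of z]
    by (simp add: c_def lc_eq[symmetric] field_simps)
  have xx: "px (px f) z = P + (l z / 2) *\<^sub>R h z"
  proof -
    have "(l z / 2) *\<^sub>R h z = 2 *\<^sub>R ((l z / 4) *\<^sub>R h z)" by simp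
    then show ?thesis unfolding lap[symmetric] P_def second_derivatives by (simp add: vec4_add vec4_scaleR vec4_eq_iff)
  qed
  have yy: "py (py f) z = - P + (l z / 2) *\<^sub>R h z"
  proof -
    have "(l z / 2) *\<^sub>R h z = 2 *\<^sub>R ((l z / 4) *\<^sub>R h z)" by simp
    moreover have "- P = (-1) *\<^sub>R P" by simp
    ultimately show ?thesis unfolding lap[symmetric] P_def second_derivatives by (simp only: vec4_add vec4_scaleR vec4_eq_iff) simp
  qed
  define Z where "Z = \<alpha>1 z * N z * c z * cnj (\<beta> z)"
  define W where "W = - \<beta>2 z * N z * cnj (k z)"
  have mlc: "of_real (l z / 2) * m z = Z + cnj W"
    using lc_nz[of z] by (simp add: m_def Z_def W_def k_def cnj_N lc_eq[symmetric] field_simps)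
  have m_re: "l z / 2 * Re (m z) = Re (Z + cnj W)" and m_im: "l z / 2 * Im (m z) = Im (Z + cnj W)"
    using arg_cong[OF mlc, of Re] arg_cong[OF mlc, of Im] by simp_all
  have "P \<bullet> h z = Re (Z + W)"
    unfolding P_def h_def inner_vec4 Z_def W_def N_def e_def k_def by (rule arg_cong[where f=Re]) (simp add: algebra_simps)
  then have hP: "h z \<bullet> P = l z / 2 * Re (m z)"
    unfolding m_re by (simp add: inner_commute)
  have "py (px f) z \<bullet> h z = Re (\<i> * (Z - W))"
    unfolding second_derivatives h_def inner_vec4 Z_def W_def N_def e_def k_def by (rule arg_cong[where f=Re]) (simp add: algebra_simps)
  then show "h z \<bullet> py (px f) z = - (l z / 2 * Im (m z))"
    unfolding m_im by (simp add: inner_commute)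
  show "h z \<bullet> px (px f) z = l z / 2 * Re (m z) + l z / 2 * (h z \<bullet> h z)"
    "h z \<bullet> py (py f) z = - (l z / 2 * Re (m z)) + l z / 2 * (h z \<bullet> h z)"
    unfolding xx yy inner_add_right inner_minus_right hP by simp_all
qed

end

section \<open>The conservation law for the rotated mean curvature vector\<close>

context framed_surface begin

lemma wirtinger_lc:
  "wirtinger lc (N z * (\<alpha>1 z * cnj (\<alpha> z) + \<beta> z * cnj (\<beta>2 z))) (N z * (\<alpha> z * cnj (\<alpha>1 z) + \<beta>2 z * cnj (\<beta> z))) z"
proof -
  have "wirtinger N (D z * N z) (cnj (D z) * N z) z"
    unfolding N_def
    by (rule wirtinger_cong[OF wirtinger_add[OF wirtinger_mult[OF wG1 wirtinger_cnj[OF wG1]] wirtinger_mult[OF wG2 wirtinger_cnj[OF wG2]]]])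
      (simp_all add: algebra_simps)
  from wirtinger_mult[OF this wirtinger_add[OF wirtinger_mult[OF w\<alpha> wirtinger_cnj[OF w\<alpha>]] wirtinger_mult[OF w\<beta> wirtinger_cnj[OF w\<beta>]]]]
  show ?thesis
    unfolding lc_def by (rule wirtinger_cong) (simp_all add: algebra_simps)
qed

text \<open>Only the derivative in \<open>z\<close> is made explicit: the conservation law
  differentiates \<open>k = c \<alpha>\<close> in \<open>z\<close> and
  \<open>e = cnj c * \<beta>\<close> in \<open>cnj z\<close>, and the latter involves just the
  conjugate of \<open>c1\<close>.\<close>

lemma wirtinger_c: "\<exists>c2. wirtinger c (c1 z) c2 z"
proof (rule exI)
  show "wirtinger c (c1 z) (4 * cnj (\<mu> z) * (- (N z * (\<alpha> z * cnj (\<alpha>1 z) + \<beta>2 z * cnj (\<beta> z))) / (lc z)\<^sup>2) + 4 * cnj (\<mu>1 z) * inverse (lc z)) z"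
    unfolding c_def
    by (rule wirtinger_cong[OF wirtinger_mult[OF wirtinger_cmult[OF wirtinger_cnj[OF w\<mu>]] wirtinger_inverse[OF wirtinger_lc lc_nz]]])
      (use lc_nz[of z] in \<open>simp_all add: c1_def c_def field_simps power2_eq_square\<close>)
qed

text \<open>The scalar core of the conservation law. Up to constant factors, the left sides are the
  coefficients in the frame \<open>G\<close>, \<open>G'\<close> of the \<open>z\<close>-derivative
  of \<open>k G\<close> and of the \<open>cnj z\<close>-derivative of \<open>e G'\<close>. That each
  is a multiple of the matching \<alpha> or \<beta> says that the results can be expressed through
  tangent vectors. In the last two equations, expanding \<open>lc\<close> cancels the terms of the
  wrong type.\<close>

lemma frame_coefficients:
  "4 * k z * \<mu> z = of_real (h z \<bullet> h z) * \<alpha> z"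
  "4 * e z * cnj (\<mu> z) = of_real (h z \<bullet> h z) * \<beta> z"
  "4 * (c z * \<alpha>1 z + c1 z * \<alpha> z + k z * D z) = 2 * m z * \<beta> z"
  "4 * (cnj (c z) * \<beta>2 z + cnj (c1 z) * \<beta> z + e z * cnj (D z)) = - 2 * cnj (m z) * \<alpha> z"
proof -
  have 0: "N z * (\<alpha> z * cnj (\<alpha> z) + \<beta> z * cnj (\<beta> z)) = lc z" by (simp add: lc_def)
  show "4 * k z * \<mu> z = of_real (h z \<bullet> h z) * \<alpha> z"
    unfolding norm_h by (simp add: k_def c_def field_simps)
  show "4 * e z * cnj (\<mu> z) = of_real (h z \<bullet> h z) * \<beta> z"
    unfolding norm_h e_def cnj_c by (simp add: field_simps)
  have "c z * \<alpha>1 z + c1 z * \<alpha> z + k z * D z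
     = c z * (\<alpha>1 z * lc z - \<alpha> z * (N z * (\<alpha>1 z * cnj (\<alpha> z) + \<beta> z * cnj (\<beta>2 z)))) / lc z"
    using lc_nz[of z] by (simp add: c1_def k_def field_simps)
  also have "\<alpha>1 z * lc z - \<alpha> z * (N z * (\<alpha>1 z * cnj (\<alpha> z) + \<beta> z * cnj (\<beta>2 z)))
     = N z * (\<alpha>1 z * cnj (\<beta> z) - \<alpha> z * cnj (\<beta>2 z)) * \<beta> z"
    unfolding 0[symmetric] by (simp add: algebra_simps)
  finally have 1: "c z * \<alpha>1 z + c1 z * \<alpha> z + k z * D z =
      c z * (N z * (\<alpha>1 z * cnj (\<beta> z) - \<alpha> z * cnj (\<beta>2 z)) * \<beta> z) / lc z" .
  show "4 * (c z * \<alpha>1 z + c1 z * \<alpha> z + k z * D z) = 2 * m z * \<beta> z"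
    unfolding 1 by (simp add: m_def)
  have "cnj (c z) * \<beta>2 z + cnj (c1 z) * \<beta> z + e z * cnj (D z)
     = cnj (c z) * (\<beta>2 z * lc z - \<beta> z * (N z * (cnj (\<alpha>1 z) * \<alpha> z + cnj (\<beta> z) * \<beta>2 z))) / lc z"
    using lc_nz[of z] by (simp add: c1_def e_def cnj_lc cnj_N field_simps)
  also have "\<beta>2 z * lc z - \<beta> z * (N z * (cnj (\<alpha>1 z) * \<alpha> z + cnj (\<beta> z) * \<beta>2 z))
     = - (N z * (cnj (\<alpha>1 z) * \<beta> z - cnj (\<alpha> z) * \<beta>2 z) * \<alpha> z)"
    unfolding 0[symmetric] by (simp add: algebra_simps)
  finally have 2: "cnj (c z) * \<beta>2 z + cnj (c1 z) * \<beta> z + e z * cnj (D z) =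
      cnj (c z) * - (N z * (cnj (\<alpha>1 z) * \<beta> z - cnj (\<alpha> z) * \<beta>2 z) * \<alpha> z) / lc z" .
  show "4 * (cnj (c z) * \<beta>2 z + cnj (c1 z) * \<beta> z + e z * cnj (D z)) = - 2 * cnj (m z) * \<alpha> z"
    unfolding 2 by (simp add: m_def cnj_lc cnj_N)
qed

text \<open>Let \<open>A\<close> be the \<open>cnj z\<close>-derivative of \<open>e G'\<close> and
  \<open>B\<close> the \<open>z\<close>-derivative of \<open>k G\<close>. With
  \<open>h = e G' - k G\<close> and \<open>L = -2 \<i> (e G' + k G)\<close> the left sides are
  \<open>4 (A - B)\<close> and \<open>-4 \<i> (A + B)\<close>; the complementary derivatives
  \<open>y1\<close>, \<open>y2\<close>, \<open>y3\<close>, \<open>y4\<close> cancel. Then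
  \<open>frame_coefficients\<close> applies.\<close>

lemma conservation_law:
  "2 *\<^sub>R px h z - py L z = (h z \<bullet> h z - 4 * (h z \<bullet> px (px f) z) / l z) *\<^sub>R px f z
    - (4 * (h z \<bullet> py (px f) z) / l z) *\<^sub>R py f z"
  "2 *\<^sub>R py h z + px L z = (h z \<bullet> h z - 4 * (h z \<bullet> py (py f) z) / l z) *\<^sub>R py f z
    - (4 * (h z \<bullet> py (px f) z) / l z) *\<^sub>R px f z"
proof -
  obtain c2 where wc: "wirtinger c (c1 z) c2 z" using wirtinger_c by blast
  define ez where "ez = cnj (c z) * \<beta>2 z + cnj (c1 z) * \<beta> z"
  define kz where "kz = c z * \<alpha>1 z + c1 z * \<alpha> z"
  obtain x1 where we: "wirtinger e x1 ez z"
    unfolding e_def ez_def using wirtinger_mult[OF wirtinger_cnj[OF wc] w\<beta>] by blast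
  obtain x2 where wk: "wirtinger k kz x2 z"
    unfolding k_def kz_def using wirtinger_mult[OF wc w\<alpha>] by blast
  define a1 where "a1 = e z * cnj (D z * G2 z + \<mu> z * cnj (G1 z)) + ez * cnj (G2 z)"
  define a2 where "a2 = e z * cnj (D z * G1 z - \<mu> z * cnj (G2 z)) + ez * cnj (G1 z)"
  define b1 where "b1 = k z * (D z * G1 z - \<mu> z * cnj (G2 z)) + kz * G1 z"
  define b2 where "b2 = k z * (D z * G2 z + \<mu> z * cnj (G1 z)) + kz * G2 z"
  obtain y1 where A1: "wirtinger (\<lambda>z. e z * cnj (G2 z)) y1 a1 z"
    unfolding a1_def using wirtinger_mult[OF we wirtinger_cnj[OF wG2]] by blast
  obtain y2 where A2: "wirtinger (\<lambda>z. e z * cnj (G1 z)) y2 a2 z"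
    unfolding a2_def using wirtinger_mult[OF we wirtinger_cnj[OF wG1]] by blast
  obtain y3 where B1: "wirtinger (\<lambda>z. k z * G1 z) b1 y3 z"
    unfolding b1_def using wirtinger_mult[OF wk wG1] by blast
  obtain y4 where B2: "wirtinger (\<lambda>z. k z * G2 z) b2 y4 z"
    unfolding b2_def using wirtinger_mult[OF wk wG2] by blast
  note dh = px_py_vec4[OF wirtinger_diff[OF wirtinger_minus[OF A1] B1] wirtinger_diff[OF A2 B2], folded h_def]
  note dL = px_py_vec4[OF wirtinger_cmult[where k="2 * \<i>", OF wirtinger_diff[OF A1 B1]]
      wirtinger_cmult[where k="2 * \<i>", OF wirtinger_diff[OF wirtinger_minus[OF A2] B2]]]
  have lhs: "2 *\<^sub>R px h z - py L z = vec4 (- (4 * a1) - 4 * b1) (4 * a2 - 4 * b2)"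
    "2 *\<^sub>R py h z + px L z = vec4 (\<i> * (4 * a1 - 4 * b1)) (\<i> * (- (4 * a2) - 4 * b2))"
    unfolding dh L_def dL vec4_scaleR vec4_add vec4_diff vec4_eq_iff by (simp_all add: algebra_simps)
  define H where "H = complex_of_real (h z \<bullet> h z)"
  note fc = frame_coefficients[of z, folded H_def, folded kz_def ez_def]
  have a: "4 * a1 = H * \<beta> z * G1 z - 2 * cnj (m z) * \<alpha> z * cnj (G2 z)"
    "4 * a2 = - H * \<beta> z * G2 z - 2 * cnj (m z) * \<alpha> z * cnj (G1 z)"
  proof -
    have "4 * a1 = 4 * (ez + e z * cnj (D z)) * cnj (G2 z) + 4 * e z * cnj (\<mu> z) * G1 z"
      "4 * a2 = 4 * (ez + e z * cnj (D z)) * cnj (G1 z) - 4 * e z * cnj (\<mu> z) * G2 z"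
      by (simp_all add: a1_def a2_def algebra_simps)
    then show "4 * a1 = H * \<beta> z * G1 z - 2 * cnj (m z) * \<alpha> z * cnj (G2 z)"
      "4 * a2 = - H * \<beta> z * G2 z - 2 * cnj (m z) * \<alpha> z * cnj (G1 z)"
      unfolding fc by simp_all
  qed
  have b: "4 * b1 = 2 * m z * \<beta> z * G1 z - H * \<alpha> z * cnj (G2 z)"
    "4 * b2 = 2 * m z * \<beta> z * G2 z + H * \<alpha> z * cnj (G1 z)"
  proof -
    have "4 * b1 = 4 * (kz + k z * D z) * G1 z - 4 * k z * \<mu> z * cnj (G2 z)"
      "4 * b2 = 4 * (kz + k z * D z) * G2 z + 4 * k z * \<mu> z * cnj (G1 z)"
      by (simp_all add: b1_def b2_def algebra_simps)
    then show "4 * b1 = 2 * m z * \<beta> z * G1 z - H * \<alpha> z * cnj (G2 z)"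
      "4 * b2 = 2 * m z * \<beta> z * G2 z + H * \<alpha> z * cnj (G1 z)"
      unfolding fc by simp_all
  qed
  have co: "h z \<bullet> h z - 4 * (h z \<bullet> px (px f) z) / l z = - (h z \<bullet> h z) - 2 * Re (m z)"
    "h z \<bullet> h z - 4 * (h z \<bullet> py (py f) z) / l z = - (h z \<bullet> h z) + 2 * Re (m z)"
    "4 * (h z \<bullet> py (px f) z) / l z = - 2 * Im (m z)"
    unfolding h_second using l_pos[of z] by (simp_all add: field_simps)
  have re: "complex_of_real (- (h z \<bullet> h z) - 2 * Re (m z)) = - H - (m z + cnj (m z))"
    "complex_of_real (- (h z \<bullet> h z) + 2 * Re (m z)) = - H + (m z + cnj (m z))"
    "complex_of_real (- 2 * Im (m z)) = \<i> * (m z - cnj (m z))"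
    by (simp_all add: H_def complex_eq_iff)
  show "2 *\<^sub>R px h z - py L z = (h z \<bullet> h z - 4 * (h z \<bullet> px (px f) z) / l z) *\<^sub>R px f z
      - (4 * (h z \<bullet> py (px f) z) / l z) *\<^sub>R py f z"
    unfolding lhs(1) co
    unfolding px_f py_f vec4_scaleR re vec4_diff vec4_eq_iff a b by (simp add: algebra_simps)
  show "2 *\<^sub>R py h z + px L z = (h z \<bullet> h z - 4 * (h z \<bullet> py (py f) z) / l z) *\<^sub>R py f z
      - (4 * (h z \<bullet> py (px f) z) / l z) *\<^sub>R px f z"
    unfolding lhs(2) co
    unfolding px_f py_f vec4_scaleR re vec4_diff vec4_eq_iff a b by (simp add: algebra_simps)
qed

text \<open>\<open>k G\<close> is minus the projection of \<open>h\<close> to the complex line spanned by \<open>G\<close>, so it depends on \<open>G\<close> only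
  up to a factor.\<close>

lemma L_eq:
  assumes "h z' = h z" "G1 z' = M * G1 z" "G2 z' = M * G2 z"
  shows "L z' = L z"
proof -
  have proj: "k z * G1 z = - (h1 * cnj (G1 z) + h2 * cnj (G2 z)) * G1 z / N z"
    "k z * G2 z = - (h1 * cnj (G1 z) + h2 * cnj (G2 z)) * G2 z / N z"
    "N z \<noteq> 0"
    if "h z = vec4 h1 h2" for z h1 h2
  proof -
    have h12: "h1 = - (e z * cnj (G2 z)) - k z * G1 z" "h2 = e z * cnj (G1 z) - k z * G2 z"
      using that by (auto simp: h_def vec4_eq_iff)
    show nz: "N z \<noteq> 0" using lc_nz[of z] by (auto simp: lc_def)
    have "h1 * cnj (G1 z) + h2 * cnj (G2 z) = - k z * N z"
      by (simp add: h12 N_def algebra_simps)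
    then show "k z * G1 z = - (h1 * cnj (G1 z) + h2 * cnj (G2 z)) * G1 z / N z"
      "k z * G2 z = - (h1 * cnj (G1 z) + h2 * cnj (G2 z)) * G2 z / N z"
      using nz by (simp_all add: field_simps)
  qed
  obtain h1 h2 where hz: "h z = vec4 h1 h2" using ex_vec4 by blast
  have hz': "h z' = vec4 h1 h2" using assms hz by simp
  have N': "N z' = M * cnj M * N z" by (simp add: N_def assms algebra_simps)
  have M: "M \<noteq> 0" "cnj M \<noteq> 0" using proj(3)[OF hz'] N' by auto
  have k: "k z' * G1 z' = k z * G1 z" "k z' * G2 z' = k z * G2 z"
    using proj(1,2)[OF hz', unfolded N' assms(2,3)] proj(1,2)[OF hz] M proj(3)[OF hz]
    by (simp_all only: assms(2,3)) (simp_all add: field_simps)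
  have "L x = vec4 (2 * \<i> * (- h1 - 2 * (k x * G1 x))) (2 * \<i> * (- h2 - 2 * (k x * G2 x)))"
    if "h x = vec4 h1 h2" for x
  proof -
    have h12: "h1 = - (e x * cnj (G2 x)) - k x * G1 x" "h2 = e x * cnj (G1 x) - k x * G2 x"
      using that by (auto simp: h_def vec4_eq_iff)
    show ?thesis unfolding L_def h12 by (simp add: vec4_eq_iff)
  qed
  from this[OF hz] this[OF hz'] k show ?thesis by simp
qed

theorem willmore_framed_surface:
  assumes w: "w \<in> moduli_M" and per: "doubly_periodic w f"
    and G1: "\<And>z. \<exists>M. G1 (z + 1) = M * G1 z \<and> G2 (z + 1) = M * G2 z"
    and Gw: "\<And>z. \<exists>M. G1 (z + w) = M * G1 z \<and> G2 (z + w) = M * G2 z"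
  shows "immersion f" "conformal f" "willmore_immersion w f"
    "willmore w f = integral (cbox 0 (Complex 1 (Im w))) (\<lambda>z. 4 * (norm (\<mu> z))\<^sup>2)"
proof -
  show imm: "immersion f"
    unfolding immersion_def smooth_def
  proof (intro conjI allI Ck_f)
    fix z
    have nz: "px f z \<noteq> 0" "py f z \<noteq> 0" using conformal_f[of z] l_pos[of z] by auto
    show ne: "px f z \<noteq> py f z" using conformal_f[of z] l_pos[of z] by auto
    have "pairwise orthogonal {px f z, py f z}"
      using conformal_f(3)[of z] by (auto simp: pairwise_def orthogonal_def inner_commute)
    then show "independent {px f z, py f z}"
      by (rule pairwise_orthogonal_independent) (use nz in auto)
  qed
  show "conformal f"
    unfolding conformal_def by (rule exI[of _ l]) (simp add: conformal_f l_pos)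
  have h_eq: "h z = (1 / l z) *\<^sub>R (px (px f) z + py (py f) z)" for z
    unfolding laplace_f using l_pos[of z] by simp
  have perh: "h (z + 1) = h z" "h (z + w) = h z" for z
    using per[THEN doubly_periodic_px] per[THEN doubly_periodic_px, THEN doubly_periodic_px]
      per[THEN doubly_periodic_py, THEN doubly_periodic_py]
    unfolding doubly_periodic_def h_eq conformal_f(1)[symmetric] by simp_all
  \<comment> \<open>\<open>G\<close> is periodic only up to a scalar, but \<open>L\<close> depends
    on \<open>h\<close> and on the line spanned by \<open>G\<close> alone.\<close>
  have perL: "doubly_periodic w L"
    unfolding doubly_periodic_def
    using L_eq[OF perh(1)] L_eq[OF perh(2)] G1 Gw by blast
  have perp: "(px (px f) z + py (py f) z) \<bullet> px f z = 0" "(px (px f) z + py (py f) z) \<bullet> py f z = 0" for z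
    unfolding laplace_f using h_perp[of z] by simp_all
  show "willmore_immersion w f"
    by (rule willmore_immersion_if_conservation_law[OF w per imm l_pos conformal_f perp h_eq Ck_h Ck_L perL conservation_law])
  have I: "jet_willmore (px f z) (py f z) (px (px f) z) (py (px f) z) (px (py f) z) (py (py f) z) = 16 * (norm (\<mu> z))\<^sup>2" for z
    unfolding jet_willmore_conformal[OF conformal_f l_pos perp] laplace_f
    using l_pos[of z] by (simp add: norm_h_real)
  have "continuous_on A \<mu>" for A
    using Ck_imp_continuous[OF Ck_fun(5)] continuous_on_subset by blast
  then have "willmore w f = integral (cbox 0 (Complex 1 (Im w))) (\<lambda>z. 16 * (norm (\<mu> z))\<^sup>2) / 4"
    by (subst willmore_eq_rectangle[OF w per]) (auto simp: I intro!: continuous_intros)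
  then show "willmore w f = integral (cbox 0 (Complex 1 (Im w))) (\<lambda>z. 4 * (norm (\<mu> z))\<^sup>2)"
    by simp
qed

end

subsection \<open>Inversion of a holomorphic curve with simple poles\<close>

definition inverted_curve :: "(complex \<Rightarrow> complex) \<Rightarrow> (complex \<Rightarrow> complex) \<Rightarrow> (complex \<Rightarrow> complex) \<Rightarrow> complex \<Rightarrow> real^4" where
  "inverted_curve G1 G2 T z =
    vec4 (cnj (T z) * G1 z * inverse (G1 z * cnj (G1 z) + G2 z * cnj (G2 z)))
         (cnj (T z) * G2 z * inverse (G1 z * cnj (G1 z) + G2 z * cnj (G2 z)))"

lemma sum_cnj_nonzero: "(x::complex) \<noteq> 0 \<or> y \<noteq> 0 \<Longrightarrow> x * cnj x + y * cnj y \<noteq> 0"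
  unfolding complex_norm_square[symmetric] of_real_add[symmetric] of_real_eq_0_iff
  by (auto simp: add_nonneg_eq_0_iff)

lemma deriv_quasi_periodic:
  assumes g: "g holomorphic_on UNIV" and q: "\<And>z. g (z + w) = M z * g z"
    and M: "\<And>z. (M has_field_derivative c * M z) (at z)"
  shows "deriv g (z + w) = M z * (c * g z + deriv g z)"
proof -
  have d: "(g has_field_derivative deriv g z) (at z)" for z
    using holomorphic_derivI[OF g] by auto
  have "((\<lambda>z. M z * g z) has_field_derivative c * M z * g z + deriv g z * M z) (at z)"
    by (rule DERIV_mult[OF M d])
  moreover have "((\<lambda>z. g (z + w)) has_field_derivative deriv g (z + w)) (at z)"
    using DERIV_shift[of g "deriv g (z + w)" z w] d by simp
  ultimately show ?thesis
    unfolding q using DERIV_unique by (fastforce simp: algebra_simps)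
qed

context
  fixes G1 G2 T :: "complex \<Rightarrow> complex"
  assumes holo: "G1 holomorphic_on UNIV" "G2 holomorphic_on UNIV" "T holomorphic_on UNIV"
    and G_nz: "\<And>z. G1 z \<noteq> 0 \<or> G2 z \<noteq> 0"
    and simple: "\<And>z. T z = 0 \<Longrightarrow> deriv T z \<noteq> 0"
    and imm: "\<And>z. T z \<noteq> 0 \<Longrightarrow> deriv G1 z * T z - G1 z * deriv T z \<noteq> 0 \<or> deriv G2 z * T z - G2 z * deriv T z \<noteq> 0"
begin

text \<open>\<open>NN\<close> is \<open>|G|^2\<close>; \<open>SS\<close> and \<open>om\<close> are
  the Hermitian products of the derivative of \<open>G\<close> with \<open>G\<close> and with
  \<open>G' = (-cnj G2, cnj G1)\<close>. \<open>al\<close> and \<open>be\<close> are the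
  coefficients of the differential of the inverted curve along \<open>G' dz\<close> and
  \<open>G d(cnj z)\<close>.\<close>

abbreviation "NN z \<equiv> G1 z * cnj (G1 z) + G2 z * cnj (G2 z)"
abbreviation "SS z \<equiv> deriv G1 z * cnj (G1 z) + deriv G2 z * cnj (G2 z)"
abbreviation "om z \<equiv> G1 z * deriv G2 z - G2 z * deriv G1 z"
abbreviation "al z \<equiv> cnj (T z) * (om z * (inverse (NN z) * inverse (NN z)))"
abbreviation "be z \<equiv> (cnj (deriv T z) * NN z - cnj (T z) * cnj (SS z)) * (inverse (NN z) * inverse (NN z))"

lemma NN_nz: "NN z \<noteq> 0"
  by (rule sum_cnj_nonzero[OF G_nz])

lemma holo_deriv: "deriv G1 holomorphic_on UNIV" "deriv G2 holomorphic_on UNIV" "deriv T holomorphic_on UNIV"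
  "(\<lambda>z. om z) holomorphic_on UNIV"
  using holo by (auto intro!: holomorphic_intros)

lemma wirtinger_NN: "wirtinger (\<lambda>z. NN z) (SS z) (cnj (SS z)) z"
  by (rule wirtinger_cong[OF wirtinger_add[OF wirtinger_mult[OF wirtinger_entire[OF holo(1)] wirtinger_cnj[OF wirtinger_entire[OF holo(1)]]]
    wirtinger_mult[OF wirtinger_entire[OF holo(2)] wirtinger_cnj[OF wirtinger_entire[OF holo(2)]]]]])
   (simp_all add: algebra_simps)

lemma wirtinger_inverse_NN: "wirtinger (\<lambda>z. inverse (NN z)) (- SS z / (NN z)\<^sup>2) (- cnj (SS z) / (NN z)\<^sup>2) z"
  by (rule wirtinger_inverse[OF wirtinger_NN NN_nz])

lemma wirtinger_SS:
  "wirtinger (\<lambda>z. SS z) (deriv (deriv G1) z * cnj (G1 z) + deriv (deriv G2) z * cnj (G2 z))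
    (deriv G1 z * cnj (deriv G1 z) + deriv G2 z * cnj (deriv G2 z)) z"
  by (rule wirtinger_cong[OF wirtinger_add[OF wirtinger_mult[OF wirtinger_entire[OF holo_deriv(1)] wirtinger_cnj[OF wirtinger_entire[OF holo(1)]]]
    wirtinger_mult[OF wirtinger_entire[OF holo_deriv(2)] wirtinger_cnj[OF wirtinger_entire[OF holo(2)]]]]])
   (simp_all add: algebra_simps)

lemma Ck_NN: "Ck n (\<lambda>z. inverse (NN z))"
  by (intro Ck_inverse NN_nz Ck_add Ck_mult Ck_bounded_linear[OF bounded_linear_cnj] Ck_entire holo)

lemma Ck_SS: "Ck n (\<lambda>z. SS z)"
  by (intro Ck_add Ck_mult Ck_bounded_linear[OF bounded_linear_cnj] Ck_entire holo holo_deriv)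

text \<open>Lagrange's identity for \<open>G\<close> and its derivative. It brings
  \<open>|om|^2\<close> into the \<open>z\<close>-derivative of \<open>be\<close> and into the
  Laplacian of \<open>ln NN\<close>.\<close>

lemma Gram_identity: "om z * cnj (om z) =
  NN z * (deriv G1 z * cnj (deriv G1 z) + deriv G2 z * cnj (deriv G2 z)) - SS z * cnj (SS z)"
  by (simp add: algebra_simps)

lemma wirtinger_al: "\<exists>a. wirtinger (\<lambda>z. al z) a (be z * (om z * inverse (NN z)) - al z * cnj (SS z * inverse (NN z))) z"
proof -
  have cN: "cnj (NN z) = NN z" by (simp add: mult.commute)
  note w = wirtinger_mult[OF wirtinger_cnj[OF wirtinger_entire[OF holo(3)]]
    wirtinger_mult[OF wirtinger_entire[OF holo_deriv(4)] wirtinger_mult[OF wirtinger_inverse_NN wirtinger_inverse_NN]]]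
  \<comment> \<open>Opaque names keep these sums from being expanded; afterwards only
    \<open>n \<noteq> 0\<close> and \<open>cnj n = n\<close> are used.\<close>
  define n where "n = NN z"
  define s where "s = SS z"
  define o' where "o' = om z"
  have n: "n \<noteq> 0" "cnj n = n" using NN_nz cN by (auto simp: n_def)
  show ?thesis
  proof (rule exI, rule wirtinger_cong[OF w refl], unfold n_def[symmetric] s_def[symmetric] o'_def[symmetric])
    have e: "cnj (s * inverse n) = cnj s * inverse n" using n by simp
    show "cnj (T z) * (o' * (inverse n * (- cnj s / n\<^sup>2) + - cnj s / n\<^sup>2 * inverse n) + 0 * (inverse n * inverse n)) +
        cnj (deriv T z) * (o' * (inverse n * inverse n))
      = (cnj (deriv T z) * n - cnj (T z) * cnj s) * (inverse n * inverse n) * (o' * inverse n)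
        - cnj (T z) * (o' * (inverse n * inverse n)) * cnj (s * inverse n)"
      unfolding e using n(1) by (simp add: divide_simps power2_eq_square) (simp add: algebra_simps)
  qed
qed

lemma wirtinger_be: "\<exists>b. wirtinger (\<lambda>z. be z) (- al z * cnj (om z * inverse (NN z)) - be z * (SS z * inverse (NN z))) b z"
proof -
  have cN: "cnj (NN z) = NN z" by (simp add: mult.commute)
  note w = wirtinger_mult[OF wirtinger_diff[OF wirtinger_mult[OF wirtinger_cnj[OF wirtinger_entire[OF holo_deriv(3)]] wirtinger_NN]
     wirtinger_mult[OF wirtinger_cnj[OF wirtinger_entire[OF holo(3)]] wirtinger_cnj[OF wirtinger_SS]]]
     wirtinger_mult[OF wirtinger_inverse_NN wirtinger_inverse_NN]]
  define n where "n = NN z"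
  define s where "s = SS z"
  define q where "q = deriv G1 z * cnj (deriv G1 z) + deriv G2 z * cnj (deriv G2 z)"
  define o' where "o' = om z"
  have o: "o' * cnj o' = n * q - s * cnj s"
    using Gram_identity[of z] unfolding n_def s_def q_def o'_def .
  have n: "n \<noteq> 0" "cnj n = n" using NN_nz cN by (auto simp: n_def)
  have q: "cnj q = q" by (simp add: q_def mult.commute)
  show ?thesis
  proof (rule exI, rule wirtinger_cong[OF w _ refl], unfold n_def[symmetric] s_def[symmetric] q_def[symmetric] o'_def[symmetric])
    have e: "cnj (T z) * (o' * (inverse n * inverse n)) * cnj (o' * inverse n) = cnj (T z) * (n * q - s * cnj s) * inverse (n * n * n)"
      unfolding o[symmetric] using n by (simp add: field_simps)
    show "(cnj (deriv T z) * n - cnj (T z) * cnj s) * (inverse n * (- s / n\<^sup>2) + - s / n\<^sup>2 * inverse n) +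
        (cnj (deriv T z) * s + cnj 0 * n - (cnj (T z) * cnj q + cnj 0 * cnj s)) * (inverse n * inverse n)
      = - (cnj (T z) * (o' * (inverse n * inverse n))) * cnj (o' * inverse n)
        - (cnj (deriv T z) * n - cnj (T z) * cnj s) * (inverse n * inverse n) * (s * inverse n)"
      unfolding minus_mult_left[symmetric] e q
      using n(1) by (simp add: divide_simps power2_eq_square) (simp add: algebra_simps)
  qed
qed

text \<open>Decomposing the derivative of \<open>G\<close> orthogonally along \<open>G\<close> and
  \<open>G'\<close> gives the coefficients \<open>D = SS / NN\<close> and
  \<open>\<mu> = om / NN\<close>.\<close>

lemma inverted_curve_frame:
  obtains \<alpha>1 \<beta>2 \<mu>1 where
    "framed_surface G1 G2 (\<lambda>z. al z) (\<lambda>z. be z) (\<lambda>z. om z * inverse (NN z)) (\<lambda>z. SS z * inverse (NN z)) \<alpha>1 \<beta>2 \<mu>1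
       (\<lambda>z. cnj (T z) * G1 z * inverse (NN z)) (\<lambda>z. cnj (T z) * G2 z * inverse (NN z))"
proof -
  obtain \<alpha>1 where \<alpha>1: "\<forall>z. wirtinger (\<lambda>z. al z) (\<alpha>1 z) (be z * (om z * inverse (NN z)) - al z * cnj (SS z * inverse (NN z))) z"
    using choice[OF allI[OF wirtinger_al]] ..
  obtain \<beta>2 where \<beta>2: "\<forall>z. wirtinger (\<lambda>z. be z) (- al z * cnj (om z * inverse (NN z)) - be z * (SS z * inverse (NN z))) (\<beta>2 z) z"
    using choice[OF allI[OF wirtinger_be]] ..
  have mu: "\<exists>a. wirtinger (\<lambda>z. om z * inverse (NN z)) a (- (om z * inverse (NN z)) * cnj (SS z * inverse (NN z))) z" for z
  proof -
    have "cnj (NN z) = NN z" by (simp add: mult.commute)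
    then have *: "cnj (SS z * inverse (NN z)) = cnj (SS z) * inverse (NN z)"
      by (simp only: complex_cnj_mult complex_cnj_inverse)
    define n where "n = NN z"
    show ?thesis
      unfolding * by (rule exI, rule wirtinger_cong[OF wirtinger_mult[OF wirtinger_entire[OF holo_deriv(4)] wirtinger_inverse_NN] refl],
        unfold n_def[symmetric]) (simp add: divide_inverse power2_eq_square algebra_simps)
  qed
  obtain \<mu>1 where \<mu>1: "\<forall>z. wirtinger (\<lambda>z. om z * inverse (NN z)) (\<mu>1 z) (- (om z * inverse (NN z)) * cnj (SS z * inverse (NN z))) z"
    using choice[OF allI[OF mu]] ..
  show thesis
  proof (rule that, unfold_locales)
    fix z
    define n where "n = NN z"
    have n: "n \<noteq> 0" "cnj n = n" using NN_nz by (auto simp: n_def mult.commute)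
    show "wirtinger G1 (SS z * inverse (NN z) * G1 z - om z * inverse (NN z) * cnj (G2 z)) 0 z"
    proof (rule wirtinger_cong[OF wirtinger_entire[OF holo(1)]])
      have "deriv G1 z = deriv G1 z * n * inverse n" using n(1) by simp
      also have "deriv G1 z * n = SS z * G1 z - om z * cnj (G2 z)" by (simp add: n_def algebra_simps)
      finally have e: "deriv G1 z = (SS z * G1 z - om z * cnj (G2 z)) * inverse n" .
      show "deriv G1 z = SS z * inverse (NN z) * G1 z - om z * inverse (NN z) * cnj (G2 z)"
        unfolding n_def[symmetric]
        by (rule trans[OF e]) (simp only: left_diff_distrib distrib_right, simp only: mult_ac)
    qed simp
    show "wirtinger G2 (SS z * inverse (NN z) * G2 z + om z * inverse (NN z) * cnj (G1 z)) 0 z"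
    proof (rule wirtinger_cong[OF wirtinger_entire[OF holo(2)]])
      have "deriv G2 z = deriv G2 z * n * inverse n" using n(1) by simp
      also have "deriv G2 z * n = SS z * G2 z + om z * cnj (G1 z)" by (simp add: n_def algebra_simps)
      finally have e: "deriv G2 z = (SS z * G2 z + om z * cnj (G1 z)) * inverse n" .
      show "deriv G2 z = SS z * inverse (NN z) * G2 z + om z * inverse (NN z) * cnj (G1 z)"
        unfolding n_def[symmetric]
        by (rule trans[OF e]) (simp only: left_diff_distrib distrib_right, simp only: mult_ac)
    qed simp
    have eq1: "deriv G1 z * NN z - G1 z * SS z = - (om z * cnj (G2 z))"
      and eq2: "deriv G2 z * NN z - G2 z * SS z = om z * cnj (G1 z)"
      by (simp_all add: algebra_simps)
    have w: "wirtinger (\<lambda>z. cnj (T z) * G z * inverse (NN z))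
       (cnj (T z) * (deriv G z * NN z - G z * SS z) * (inverse (NN z) * inverse (NN z))) (be z * G z) z"
      if "G holomorphic_on UNIV" for G
      by (rule wirtinger_cong[OF wirtinger_mult[OF wirtinger_mult[OF wirtinger_cnj[OF wirtinger_entire[OF holo(3)]] wirtinger_entire[OF that]] wirtinger_inverse_NN]];
        unfold n_def[symmetric]; use n in \<open>simp add: divide_simps power2_eq_square; simp add: algebra_simps\<close>)
    show "wirtinger (\<lambda>z. cnj (T z) * G1 z * inverse (NN z)) (- al z * cnj (G2 z)) (be z * G1 z) z"
      by (rule wirtinger_cong[OF w[OF holo(1)] _ refl]) (unfold eq1, simp)
    show "wirtinger (\<lambda>z. cnj (T z) * G2 z * inverse (NN z)) (al z * cnj (G1 z)) (be z * G2 z) z"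
      by (rule wirtinger_cong[OF w[OF holo(2)] _ refl]) (unfold eq2, simp)
    \<comment> \<open>At a zero of \<open>T\<close> the vanishing of \<open>be\<close> would make
      that zero multiple. Elsewhere \<open>om = 0\<close> and \<open>deriv T * n = T * SS\<close>
      force both Wronskians with \<open>T\<close> to vanish, against the immersion
      condition.\<close>
    show "al z \<noteq> 0 \<or> be z \<noteq> 0"
    proof (rule ccontr)
      assume "\<not> ?thesis"
      then have 0: "cnj (T z) * om z = 0" "cnj (deriv T z) * n - cnj (T z) * cnj (SS z) = 0"
        using n(1) by (auto simp: n_def[symmetric])
      have "cnj (deriv T z * n - T z * SS z) = 0" using 0(2) n(2) by simp
      then have T: "deriv T z * n = T z * SS z" by (simp only: complex_cnj_zero_iff right_minus_eq)
      show False
      proof (cases "T z = 0")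
        case True
        then show False using simple T n(1) by auto
      next
        case False
        then have om: "om z = 0" using 0(1) by auto
        have "(deriv G1 z * T z - G1 z * deriv T z) * n = 0" "(deriv G2 z * T z - G2 z * deriv T z) * n = 0"
        proof -
          have "(deriv G1 z * T z - G1 z * deriv T z) * n = (deriv G1 z * n - G1 z * SS z) * T z"
            "(deriv G2 z * T z - G2 z * deriv T z) * n = (deriv G2 z * n - G2 z * SS z) * T z"
            unfolding left_diff_distrib mult.assoc T by (simp_all only: mult_ac)
          then show "(deriv G1 z * T z - G1 z * deriv T z) * n = 0" "(deriv G2 z * T z - G2 z * deriv T z) * n = 0"
            unfolding n_def eq1 eq2 om by simp_all
        qed
        then show False using imm[OF False] n(1) by auto
      qed
    qed
  qed (rule \<alpha>1[rule_format] \<beta>2[rule_format] \<mu>1[rule_format] G_nz | intro Ck_mult Ck_NN Ck_diff Ck_add Ck_bounded_linear[OF bounded_linear_cnj] Ck_SS Ck_entire holo holo_deriv)+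
qed

lemma integral_curvature:
  assumes w: "0 \<le> Im w" "0 \<le> Re w" "Re w \<le> 1"
    and per1: "\<And>z. G1 (z + 1) = G1 z" "\<And>z. G2 (z + 1) = G2 z"
    and perw: "\<And>z. G1 (z + w) = M z * G1 z" "\<And>z. G2 (z + w) = M z * G2 z"
    and M: "\<And>z. M z \<noteq> 0" "\<And>z. (M has_field_derivative (- 2 * of_real pi * \<i> * of_nat k) * M z) (at z)"
  shows "integral (cbox 0 (Complex 1 (Im w))) (\<lambda>z. 4 * (norm (om z * inverse (NN z)))\<^sup>2) = 4 * real k * pi"
proof -
  \<comment> \<open>\<open>D\<close> is the \<open>z\<close>-derivative of \<open>ln NN\<close>, so
    \<open>U\<close> and \<open>V\<close> are the x- and y-derivatives of \<open>ln NN\<close>, and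
    the integrand is the divergence of this gradient.\<close>
  define D where "D = (\<lambda>z. SS z * inverse (NN z))"
  define U where "U = (\<lambda>z. 2 * Re (D z))"
  define V where "V = (\<lambda>z. - 2 * Im (D z))"
  have CkD: "Ck n D" for n
    unfolding D_def by (intro Ck_mult Ck_SS Ck_NN)
  have CkU: "Ck n U" "Ck n V" for n
    unfolding U_def V_def
    by (intro Ck_bounded_linear[OF bounded_linear_const_mult[OF bounded_linear_Re] CkD]
      Ck_bounded_linear[OF bounded_linear_const_mult[OF bounded_linear_Im] CkD])+
  have div: "px U z + py V z = 4 * (norm (om z * inverse (NN z)))\<^sup>2" for z
  proof -
    define q where "q = complex_of_real ((norm (om z * inverse (NN z)))\<^sup>2)"
    have "\<exists>a. wirtinger D a q z"
    proof -
      define n where "n = NN z"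
      define s where "s = SS z"
      define o' where "o' = om z"
      define p where "p = deriv G1 z * cnj (deriv G1 z) + deriv G2 z * cnj (deriv G2 z)"
      have o: "o' * cnj o' = n * p - s * cnj s"
        using Gram_identity[of z] unfolding n_def s_def p_def o'_def .
      have n: "n \<noteq> 0" "cnj n = n" using NN_nz by (auto simp: n_def mult.commute)
      have q: "q = (o' * cnj o') * (inverse n * inverse n)"
        unfolding q_def complex_norm_square n_def[symmetric] o'_def[symmetric] using n by simp
      show ?thesis
        unfolding D_def
        by (rule exI, rule wirtinger_cong[OF wirtinger_mult[OF wirtinger_SS wirtinger_inverse_NN] refl],
          unfold n_def[symmetric] s_def[symmetric] p_def[symmetric] q o)
          (use n(1) in \<open>simp add: divide_simps power2_eq_square; simp add: algebra_simps\<close>)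
    qed
    then obtain a where a: "wirtinger D a q z" ..
    have "(U has_derivative (\<lambda>h. 2 * Re (a * h + q * cnj h))) (at z)"
      unfolding U_def using a[unfolded wirtinger_def]
      by (intro has_derivative_mult_right bounded_linear.has_derivative[OF bounded_linear_Re])
    moreover have "(V has_derivative (\<lambda>h. - 2 * Im (a * h + q * cnj h))) (at z)"
      unfolding V_def using a[unfolded wirtinger_def]
      by (intro has_derivative_mult_right bounded_linear.has_derivative[OF bounded_linear_Im])
    ultimately have "px U z = 2 * Re (a + q)" "py V z = - 2 * Im (a * \<i> - q * \<i>)"
      using has_derivative_px(2)[of U _ z] has_derivative_py(2)[of V _ z] by fastforce+
    then have "px U z + py V z = 4 * Re q" by simp
    then show ?thesis by (simp only: q_def Re_complex_of_real)
  qed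
  have "integral (cbox 0 (Complex 1 (Im w))) (\<lambda>z. 4 * (norm (om z * inverse (NN z)))\<^sup>2)
     = integral (cbox 0 (Complex 1 (Im w))) (\<lambda>z. px U z + py V z)"
    by (simp only: div)
  also have "\<dots> = integral (cbox 0 (Complex 1 (Im w))) (px U) + integral (cbox 0 (Complex 1 (Im w))) (py V)"
    using CkU(1)[of "Suc 0"] CkU(2)[of "Suc 0"]
    by (intro Henstock_Kurzweil_Integration.integral_add integrable_continuous)
      (auto intro: continuous_on_subset)
  also have D1: "D (z + 1) = D z" for z
    using deriv_quasi_periodic[OF holo(1), of 1 "\<lambda>_. 1" 0] deriv_quasi_periodic[OF holo(2), of 1 "\<lambda>_. 1" 0]
    by (simp add: D_def per1)
  then have "integral (cbox 0 (Complex 1 (Im w))) (px U) = 0"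
    by (intro integral_rectangle_px CkU) (simp add: U_def)
  also have "integral (cbox 0 (Complex 1 (Im w))) (py V) = 4 * real k * pi"
  proof (rule integral_rectangle_py[OF CkU(2) _ _ w])
    show "V (z + 1) = V z" for z by (simp add: V_def D1)
    show "V (z + w) = V z + 4 * real k * pi" for z
    proof -
      define c where "c = - 2 * of_real pi * \<i> * of_nat k"
      have Mc: "(M has_field_derivative c * M z) (at z)" for z using M(2) by (simp add: c_def)
      have S: "SS (z + w) = M z * cnj (M z) * (c * NN z + SS z)"
        unfolding deriv_quasi_periodic[OF holo(1) perw(1) Mc] deriv_quasi_periodic[OF holo(2) perw(2) Mc] perw
        by (simp add: algebra_simps)
      have N: "NN (z + w) = M z * cnj (M z) * NN z"
        unfolding perw by (simp add: algebra_simps)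
      have "M z * cnj (M z) \<noteq> 0" using M(1) by simp
      moreover define n where "n = NN z"
      moreover have "n \<noteq> 0" using NN_nz[of z] by (simp add: n_def)
      \<comment> \<open>The jump \<open>c = -2 pi \<i> k\<close> of \<open>D\<close> is a jump of
        \<open>4 pi k\<close> in \<open>V = -2 Im D\<close>.\<close>
      ultimately have "D (z + w) = c + D z"
        unfolding D_def S N n_def[symmetric] by (simp add: field_simps)
      then show ?thesis by (simp add: V_def c_def)
    qed
  qed
  finally show ?thesis by simp
qed

theorem willmore_inverted_curve:
  assumes w: "w \<in> moduli_M"
    and per1: "\<And>z. G1 (z + 1) = G1 z" "\<And>z. G2 (z + 1) = G2 z" "\<And>z. T (z + 1) = T z"
    and perw: "\<And>z. G1 (z + w) = M z * G1 z" "\<And>z. G2 (z + w) = M z * G2 z" "\<And>z. T (z + w) = M z * T z"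
    and M: "\<And>z. M z \<noteq> 0" "\<And>z. (M has_field_derivative (- 2 * of_real pi * \<i> * of_nat k) * M z) (at z)"
  defines "f \<equiv> inverted_curve G1 G2 T"
  shows "doubly_periodic w f" "immersion f" "conformal f" "willmore_immersion w f" "willmore w f = 4 * real k * pi"
proof -
  obtain \<alpha>1 \<beta>2 \<mu>1 where
    "framed_surface G1 G2 (\<lambda>z. al z) (\<lambda>z. be z) (\<lambda>z. om z * inverse (NN z)) (\<lambda>z. SS z * inverse (NN z)) \<alpha>1 \<beta>2 \<mu>1
       (\<lambda>z. cnj (T z) * G1 z * inverse (NN z)) (\<lambda>z. cnj (T z) * G2 z * inverse (NN z))"
    by (rule inverted_curve_frame)
  then interpret F: framed_surface G1 G2 "\<lambda>z. al z" "\<lambda>z. be z" "\<lambda>z. om z * inverse (NN z)" "\<lambda>z. SS z * inverse (NN z)" \<alpha>1 \<beta>2 \<mu>1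
    "\<lambda>z. cnj (T z) * G1 z * inverse (NN z)" "\<lambda>z. cnj (T z) * G2 z * inverse (NN z)" .
  have f: "F.f = f" by (simp add: F.f_def f_def inverted_curve_def fun_eq_iff)
  show per: "doubly_periodic w f"
    unfolding doubly_periodic_def
  proof (intro allI conjI)
    fix z
    show "f (z + 1) = f z" by (simp add: f_def inverted_curve_def per1)
    have N: "NN (z + w) = M z * cnj (M z) * NN z"
      unfolding perw by (simp add: algebra_simps)
    have "M z \<noteq> 0" "cnj (M z) \<noteq> 0" using M(1) by auto
    moreover define n where "n = NN z"
    moreover have "n \<noteq> 0" using NN_nz[of z] by (simp add: n_def)
    ultimately show "f (z + w) = f z"
      unfolding f_def inverted_curve_def N n_def[symmetric]
      unfolding perw vec4_eq_iff by (simp add: field_simps)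
  qed
  have G1: "\<exists>m. G1 (z + 1) = m * G1 z \<and> G2 (z + 1) = m * G2 z" for z
    by (rule exI[of _ 1]) (simp add: per1)
  have Gw: "\<exists>m. G1 (z + w) = m * G1 z \<and> G2 (z + w) = m * G2 z" for z
    by (rule exI[of _ "M z"]) (simp add: perw)
  note W = F.willmore_framed_surface[OF w per[folded f] G1 Gw, unfolded f]
  show "immersion f" "conformal f" "willmore_immersion w f" by (fact W)+
  have "0 \<le> Im w" "0 \<le> Re w" "Re w \<le> 1" using w by (auto simp: moduli_M_def)
  then show "willmore w f = 4 * real k * pi"
    unfolding W(4) by (rule integral_curvature[OF _ _ _ per1(1,2) perw(1,2) M])
qed

end

lemma inverted_curve_eq_0_iff:
  assumes "G1 z \<noteq> 0 \<or> G2 z \<noteq> 0"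
  shows "inverted_curve G1 G2 T z = 0 \<longleftrightarrow> T z = 0"
  using assms sum_cnj_nonzero[OF assms] by (auto simp: inverted_curve_def vec4_eq_0_iff)

text \<open>Inversion is an involution: \<open>x / |x|^2\<close> returns the point
  \<open>G / T\<close>.\<close>

lemma inverted_curve_eqD:
  assumes nz: "G1 z \<noteq> 0 \<or> G2 z \<noteq> 0" and eq: "inverted_curve G1 G2 T z = vec4 u v" and uv: "u \<noteq> 0 \<or> v \<noteq> 0"
  shows "G1 z = u / (u * cnj u + v * cnj v) * T z" "G2 z = v / (u * cnj u + v * cnj v) * T z"
proof -
  define N where "N = G1 z * cnj (G1 z) + G2 z * cnj (G2 z)"
  have N: "N \<noteq> 0" "cnj N = N" using sum_cnj_nonzero[OF nz] by (auto simp: N_def mult.commute)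
  have u: "u = cnj (T z) * G1 z * inverse N" and v: "v = cnj (T z) * G2 z * inverse N"
    using eq by (auto simp: inverted_curve_def vec4_eq_iff N_def)
  have T: "T z \<noteq> 0" using uv u v by auto
  have "u * cnj u + v * cnj v = T z * cnj (T z) * N * inverse N * inverse N"
    unfolding u v using N by (simp add: N_def[symmetric] algebra_simps) (simp add: N_def algebra_simps)
  then have s: "u * cnj u + v * cnj v = T z * cnj (T z) * inverse N" using N by simp
  show "G1 z = u / (u * cnj u + v * cnj v) * T z" "G2 z = v / (u * cnj u + v * cnj v) * T z"
    unfolding s using T N(1) by (simp_all add: u v)
qed

subsection \<open>Theta functions\<close>

text \<open>The infinite q-Pochhammer symbol.\<close>

definition qprod :: "complex \<Rightarrow> complex \<Rightarrow> complex" where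
  "qprod q x = (\<Prod>n. 1 - q ^ n * x)"

context
  fixes q :: complex
  assumes q: "norm q < 1"
begin

lemma has_prod_qprod: "(\<lambda>n. 1 - q ^ n * x) has_prod qprod q x"
proof -
  have "summable (\<lambda>n. norm (1 - q ^ n * x - 1))"
    using q by (auto simp: norm_mult norm_power intro!: summable_mult2 summable_geometric)
  then have "abs_convergent_prod (\<lambda>n. 1 - q ^ n * x)"
    by (simp add: abs_convergent_prod_conv_summable)
  then show ?thesis
    unfolding qprod_def by (intro convergent_prod_has_prod abs_convergent_prod_imp_convergent_prod)
qed

lemma qprod_LIMSEQ: "(\<lambda>N. \<Prod>n<N. 1 - q ^ n * x) \<longlonglongrightarrow> qprod q x"
proof -
  have "(\<lambda>N. \<Prod>n\<le>N. 1 - q ^ n * x) \<longlonglongrightarrow> qprod q x"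
    unfolding qprod_def using has_prod_qprod[of x] by (intro convergent_prod_LIMSEQ) (auto simp: has_prod_iff)
  then show ?thesis
    unfolding lessThan_Suc_atMost[symmetric] by (subst (asm) filterlim_sequentially_Suc)
qed

lemma qprod_rec: "qprod q x = (1 - x) * qprod q (q * x)"
proof (rule LIMSEQ_unique)
  show "(\<lambda>N. \<Prod>n<Suc N. 1 - q ^ n * x) \<longlonglongrightarrow> qprod q x"
    using qprod_LIMSEQ[of x] by (subst filterlim_sequentially_Suc)
  have "(\<Prod>n<Suc N. 1 - q ^ n * x) = (1 - x) * (\<Prod>n<N. 1 - q ^ n * (q * x))" for N
    by (subst prod.lessThan_Suc_shift) (simp add: mult_ac)
  then show "(\<lambda>N. \<Prod>n<Suc N. 1 - q ^ n * x) \<longlonglongrightarrow> (1 - x) * qprod q (q * x)"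
    using tendsto_mult_left[OF qprod_LIMSEQ[of "q * x"], of "1 - x"] by simp
qed

lemma qprod_eq_0_iff: "qprod q x = 0 \<longleftrightarrow> (\<exists>n. q ^ n * x = 1)"
  using has_prod_eq_0_iff[OF has_prod_qprod, of x] by auto

lemma qprod_holomorphic: "qprod q holomorphic_on UNIV"
proof (rule holomorphic_uniform_sequence)
  fix z :: complex
  define R where "R = norm z + 1"
  have "uniformly_convergent_on (cball z 1) (\<lambda>N x. \<Prod>n<N. 1 - q ^ n * x)"
  proof (rule uniformly_convergent_on_prod')
    show "uniformly_convergent_on (cball z 1) (\<lambda>N x. \<Sum>n<N. norm (1 - q ^ n * x - 1))"
    proof (rule Weierstrass_m_test')
      fix n x assume "x \<in> cball z 1"
      then have "norm x \<le> R"
        using norm_triangle_ineq2[of x z] by (auto simp: R_def dist_norm norm_minus_commute)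
      then show "norm (norm (1 - q ^ n * x - 1)) \<le> norm q ^ n * R"
        by (auto simp: norm_mult norm_power intro!: mult_left_mono)
    next
      show "summable (\<lambda>n. norm q ^ n * R)"
        using q by (intro summable_mult2 summable_geometric) auto
    qed
  qed (auto intro!: continuous_intros)
  then obtain g where g: "uniform_limit (cball z 1) (\<lambda>N x. \<Prod>n<N. 1 - q ^ n * x) g sequentially"
    by (auto simp: uniformly_convergent_on_def)
  have "g x = qprod q x" if "x \<in> cball z 1" for x
    using tendsto_uniform_limitI[OF g that] qprod_LIMSEQ LIMSEQ_unique by blast
  then have "uniform_limit (cball z 1) (\<lambda>N x. \<Prod>n<N. 1 - q ^ n * x) (qprod q) sequentially"
    using g by (subst uniform_limit_cong'[of _ _ _ _ g]) auto
  then show "\<exists>d>0. cball z d \<subseteq> UNIV \<and> uniform_limit (cball z d) (\<lambda>N x. \<Prod>n<N. 1 - q ^ n * x) (qprod q) sequentially"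
    by (intro exI[of _ 1]) auto
qed (auto intro!: holomorphic_intros)

end

definition ee :: "complex \<Rightarrow> complex" where
  "ee z = exp (2 * of_real pi * \<i> * z)"

lemma ee_add: "ee (x + y) = ee x * ee y"
  by (simp add: ee_def ring_distribs exp_add)

lemma ee_diff: "ee (x - y) = ee x / ee y"
  by (simp add: ee_def ring_distribs exp_diff)

lemma ee_minus: "ee (- x) = inverse (ee x)"
  by (simp add: ee_def exp_minus)

lemma ee_nz [simp]: "ee x \<noteq> 0"
  by (simp add: ee_def)

lemma ee_power: "ee x ^ n = ee (of_nat n * x)"
  by (simp add: ee_def exp_of_nat_mult[symmetric] mult_ac)

lemma ee_0 [simp]: "ee 0 = 1"
  by (simp add: ee_def)

lemma ee_eq_1_iff: "ee z = 1 \<longleftrightarrow> z \<in> \<int>"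
proof -
  have "2 * of_real pi * \<i> * z = of_int (2 * n) * of_real pi * \<i> \<longleftrightarrow> z = of_int n" for n :: int
  proof -
    have "2 * of_real pi * \<i> * z = of_int (2 * n) * of_real pi * \<i> \<longleftrightarrow> 2 * of_real pi * \<i> * z = 2 * of_real pi * \<i> * of_int n"
      by (simp add: mult_ac)
    also have "\<dots> \<longleftrightarrow> z = of_int n" by (subst mult_left_cancel) auto
    finally show ?thesis .
  qed
  moreover have "ee z = 1 \<longleftrightarrow> (\<exists>n::int. 2 * of_real pi * \<i> * z = of_int (2 * n) * of_real pi * \<i>)"
    unfolding ee_def exp_eq_1 by (auto simp: complex_eq_iff)
  ultimately show ?thesis by (auto simp: Ints_def)
qed

lemma ee_int [simp]: "ee (of_int n) = 1" and ee_1 [simp]: "ee 1 = 1"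
  by (auto simp: ee_eq_1_iff)

lemma DERIV_ee: "(ee has_field_derivative 2 * of_real pi * \<i> * ee z) (at z)"
  unfolding ee_def by (auto intro!: derivative_eq_intros)

lemma ee_holomorphic: "g holomorphic_on A \<Longrightarrow> (\<lambda>z. ee (g z)) holomorphic_on A"
  unfolding ee_def by (intro holomorphic_intros)

section \<open>The period lattice and its fundamental parallelogram\<close>

definition lattice :: "complex \<Rightarrow> complex set" where
  "lattice w = {of_int m + of_int n * w | m n. True}"

lemma lattice_I: "of_int m + of_int n * w \<in> lattice w"
  by (auto simp: lattice_def)

lemma lattice_0 [simp]: "0 \<in> lattice w"
  using lattice_I[of 0 0 w] by simp

lemma lattice_add: "x \<in> lattice w \<Longrightarrow> y \<in> lattice w \<Longrightarrow> x + y \<in> lattice w"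
  unfolding lattice_def
proof clarify
  fix m n m' n'
  show "\<exists>ma na. of_int m + of_int n * w + (of_int m' + of_int n' * w) = of_int ma + of_int na * w \<and> True"
    by (rule exI[of _ "m + m'"], rule exI[of _ "n + n'"]) (simp add: algebra_simps)
qed

lemma lattice_minus: "x \<in> lattice w \<Longrightarrow> - x \<in> lattice w"
  unfolding lattice_def
proof clarify
  fix m n
  show "\<exists>ma na. - (of_int m + of_int n * w) = of_int ma + of_int na * w \<and> True"
    by (rule exI[of _ "- m"], rule exI[of _ "- n"]) (simp add: algebra_simps)
qed

lemma lattice_diff: "x \<in> lattice w \<Longrightarrow> y \<in> lattice w \<Longrightarrow> x - y \<in> lattice w"
  using lattice_add[OF _ lattice_minus, of x w y] by simp

lemma countable_lattice: "countable (lattice w)"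
proof -
  have "lattice w = (\<lambda>(m, n). of_int m + of_int n * w) ` UNIV"
    by (auto simp: lattice_def)
  then show ?thesis by simp
qed

lemma lattice_real_iff:
  assumes "Im w > 0"
  shows "of_real r \<in> lattice w \<longleftrightarrow> r \<in> \<int>"
proof
  assume "of_real r \<in> lattice w"
  then obtain m n where mn: "of_real r = of_int m + of_int n * w" by (auto simp: lattice_def)
  from arg_cong[OF mn, of Im] have "n = 0" using assms by simp
  then have "r = of_int m" using arg_cong[OF mn, of Re] by simp
  then show "r \<in> \<int>" by simp
next
  assume "r \<in> \<int>"
  then obtain m where "r = of_int m" by (auto simp: Ints_def)
  then show "of_real r \<in> lattice w" using lattice_I[of m 0 w] by simp
qed

lemma fund_dom_lattice_eq:
  assumes w: "Im w > 0" and x: "x \<in> fund_dom w" and y: "y \<in> fund_dom w" and d: "x - y \<in> lattice w"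
  shows "x = y"
proof -
  obtain s t where x': "x = of_real s + of_real t * w" "0 \<le> s" "s < 1" "0 \<le> t" "t < 1"
    using x by (auto simp: fund_dom_def)
  obtain s' t' where y': "y = of_real s' + of_real t' * w" "0 \<le> s'" "s' < 1" "0 \<le> t'" "t' < 1"
    using y by (auto simp: fund_dom_def)
  obtain m n where mn: "x - y = of_int m + of_int n * w"
    using d by (auto simp: lattice_def)
  from arg_cong[OF mn, of Im] have "(t - t') * Im w = of_int n * Im w"
    by (simp add: x' y' algebra_simps)
  then have t: "t - t' = of_int n" using w by simp
  then have "\<bar>of_int n\<bar> < (1::real)" using x' y' by linarith
  then have n: "n = 0" by linarith
  from arg_cong[OF mn, of Re] have s: "s - s' = of_int m"
    using t n by (simp add: x' y')
  then have "\<bar>of_int m\<bar> < (1::real)" using x' y' by linarith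
  then have "m = 0" by linarith
  then show ?thesis using mn n by simp
qed

lemma fund_dom_representative:
  assumes w: "Im w > 0"
  shows "\<exists>l\<in>lattice w. z + l \<in> fund_dom w"
proof -
  define t where "t = Im z / Im w"
  define s where "s = Re z - t * Re w"
  have z: "z = of_real s + of_real t * w"
    using w by (auto simp: complex_eq_iff s_def t_def)
  have "z + (of_int (- \<lfloor>s\<rfloor>) + of_int (- \<lfloor>t\<rfloor>) * w) = of_real (frac s) + of_real (frac t) * w"
    unfolding z by (simp add: frac_def algebra_simps)
  moreover have "\<dots> \<in> fund_dom w"
    unfolding fund_dom_def using frac_lt_1 frac_ge_0 by blast
  ultimately show ?thesis using lattice_I by metis
qed

text \<open>A Jacobi theta function in triple product form, without its constant factor and
  translated so that its zeros are the lattice points; the second argument is \<open>q / x\<close>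
  for \<open>q = ee w\<close>, \<open>x = ee z\<close>.\<close>

definition theta :: "complex \<Rightarrow> complex \<Rightarrow> complex" where
  "theta w z = qprod (ee w) (ee z) * qprod (ee w) (ee (w - z))"

context
  fixes w :: complex
  assumes w: "Im w > 0"
begin

lemma norm_ee_less_1: "norm (ee w) < 1"
  using w by (simp add: ee_def)

lemma theta_holomorphic [holomorphic_intros]: "g holomorphic_on A \<Longrightarrow> (\<lambda>z. theta w (g z)) holomorphic_on A"
proof -
  assume g: "g holomorphic_on A"
  have q: "(\<lambda>z. qprod (ee w) (h z)) holomorphic_on A" if "h holomorphic_on A" for h
    using holomorphic_on_compose_gen[OF that qprod_holomorphic[OF norm_ee_less_1]] by (simp add: o_def)
  show ?thesis
    unfolding theta_def by (intro holomorphic_intros q ee_holomorphic g)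
qed

lemma theta_add_1: "theta w (z + 1) = theta w z"
  unfolding theta_def by (simp add: ee_add ee_diff)

text \<open>Moving by \<open>w\<close> multiplies \<open>u = ee z\<close> by \<open>q\<close>: the
  first product loses the factor \<open>1 - u\<close>, the second gains \<open>1 - 1/u\<close>, and
  the quotient is \<open>- 1/u\<close>.\<close>

lemma theta_add_w: "theta w (z + w) = - ee (- z) * theta w z"
proof -
  note rec = qprod_rec[OF norm_ee_less_1]
  define u where "u = ee z"
  have u0: "u \<noteq> 0" by (simp add: u_def)
  have 1: "theta w (z + w) = qprod (ee w) (ee w * u) * ((1 - inverse u) * qprod (ee w) (ee w / u))"
    using rec[of "inverse u"] by (simp add: theta_def ee_add ee_minus u_def mult.commute divide_inverse)
  have 2: "theta w z = (1 - u) * qprod (ee w) (ee w * u) * qprod (ee w) (ee w / u)"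
    using rec[of u] by (simp add: theta_def ee_diff u_def)
  show ?thesis
    unfolding 1 2 ee_minus u_def[symmetric] using u0 by (simp add: field_simps)
qed

lemma theta_add_lattice_mult: "\<exists>c. c \<noteq> 0 \<and> (\<forall>z. theta w (z + of_int n * w) = c * ee (- of_int n * z) * theta w z)"
proof (induction n rule: int_induct[of _ 0])
  case base
  show ?case by (rule exI[of _ 1]) simp
next
  case (step1 i)
  then obtain c where c: "c \<noteq> 0" "\<And>z. theta w (z + of_int i * w) = c * ee (- of_int i * z) * theta w z" by blast
  have "theta w (z + of_int (i + 1) * w) = (- c * ee (- of_int i * w)) * ee (- of_int (i + 1) * z) * theta w z" for z
  proof -
    have "theta w (z + of_int (i + 1) * w) = theta w ((z + of_int i * w) + w)" by (simp add: algebra_simps)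
    also have "\<dots> = - c * (ee (- (z + of_int i * w)) * ee (- of_int i * z)) * theta w z"
      unfolding theta_add_w c by simp
    also have "ee (- (z + of_int i * w)) * ee (- of_int i * z) = ee (- of_int i * w) * ee (- of_int (i + 1) * z)"
      unfolding ee_add[symmetric] by (simp add: algebra_simps)
    finally show ?thesis by simp
  qed
  then show ?case using c(1) by (intro exI[of _ "- c * ee (- of_int i * w)"]) simp
next
  case (step2 i)
  then obtain c where c: "c \<noteq> 0" "\<And>z. theta w (z + of_int i * w) = c * ee (- of_int i * z) * theta w z" by blast
  have "theta w (z + of_int (i - 1) * w) = (- c * ee (of_int (i - 1) * w)) * ee (- of_int (i - 1) * z) * theta w z" for z
  proof -
    define y where "y = z + of_int (i - 1) * w"
    have "theta w (y + w) = - ee (- y) * theta w y" by (rule theta_add_w)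
    then have "theta w y = - ee y * theta w (y + w)" by (simp add: ee_minus)
    also have "y + w = z + of_int i * w" by (simp add: y_def algebra_simps)
    also have "- ee y * theta w (z + of_int i * w) = - c * (ee y * ee (- of_int i * z)) * theta w z"
      unfolding c by simp
    also have "ee y * ee (- of_int i * z) = ee (of_int (i - 1) * w) * ee (- of_int (i - 1) * z)"
      unfolding ee_add[symmetric] y_def by (simp add: algebra_simps)
    finally show ?thesis by (simp add: y_def)
  qed
  then show ?case using c(1) by (intro exI[of _ "- c * ee (of_int (i - 1) * w)"]) simp
qed

lemma theta_add_lattice:
  assumes "l \<in> lattice w"
  obtains c n where "c \<noteq> 0" "\<And>z. theta w (z + l) = c * ee (- of_int n * z) * theta w z"
proof -
  obtain m n where l: "l = of_int m + of_int n * w" using assms by (auto simp: lattice_def)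
  have 1: "theta w (z + of_int m) = theta w z" for z
  proof -
    have "ee (w - (z + of_int m)) = ee (w - z)" by (simp add: ee_diff ee_add)
    then show ?thesis by (simp add: theta_def ee_add)
  qed
  obtain c where "c \<noteq> 0" "\<And>z. theta w (z + of_int n * w) = c * ee (- of_int n * z) * theta w z"
    using theta_add_lattice_mult by blast
  then show ?thesis
    using 1[of "_ + of_int n * w"] by (intro that[of c n]) (simp_all add: l add_ac)
qed

text \<open>The first product vanishes at lattice points whose \<open>w\<close>-coefficient is at
  most 0, the second at those where it is at least 1. Conversely, the zero at 0 is carried to every
  lattice point by quasi-periodicity.\<close>

lemma theta_eq_0_iff: "theta w z = 0 \<longleftrightarrow> z \<in> lattice w"
proof
  assume "theta w z = 0"
  then consider n where "ee w ^ n * ee z = 1" | n where "ee w ^ n * ee (w - z) = 1"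
    by (auto simp: theta_def qprod_eq_0_iff[OF norm_ee_less_1])
  then show "z \<in> lattice w"
  proof cases
    case 1
    then have "of_nat n * w + z \<in> \<int>"
      by (simp add: ee_power ee_add[symmetric] ee_eq_1_iff)
    then obtain m where m: "of_nat n * w + z = of_int m" by (auto simp: Ints_def)
    have "z = (of_nat n * w + z) - of_nat n * w" by simp
    then have "z = of_int m + of_int (- int n) * w" unfolding m by simp
    then show ?thesis using lattice_I by metis
  next
    case 2
    then have "of_nat n * w + (w - z) \<in> \<int>"
      by (simp add: ee_power ee_add[symmetric] ee_eq_1_iff)
    then obtain m where m: "of_nat n * w + (w - z) = of_int m" by (auto simp: Ints_def)
    have "z = of_nat n * w + w - (of_nat n * w + (w - z))" by simp
    then have "z = of_int (- m) + of_int (int n + 1) * w" unfolding m by (simp add: algebra_simps)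
    then show ?thesis using lattice_I by metis
  qed
next
  assume "z \<in> lattice w"
  then obtain c n where "\<And>x. theta w (x + z) = c * ee (- of_int n * x) * theta w x"
    by (metis theta_add_lattice)
  from this[of 0] have "theta w z = c * theta w 0" by simp
  also have "theta w 0 = 0"
    by (auto simp: theta_def qprod_eq_0_iff[OF norm_ee_less_1] intro: exI[of _ 0])
  finally show "theta w z = 0" by simp
qed

lemma DERIV_theta: "(theta w has_field_derivative deriv (theta w) z) (at z)"
  using holomorphic_derivI[OF theta_holomorphic[OF holomorphic_on_ident, of UNIV], of z] by simp

text \<open>At 0 the factor \<open>1 - ee z\<close> splits off with a simple zero, and the cofactor
  \<open>r\<close> is a square of \<open>qprod (ee w) (ee w)\<close>, nonzero as
  \<open>norm (ee w) < 1\<close>. Quasi-periodicity carries this to the other lattice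
  points.\<close>

lemma deriv_theta_nonzero:
  assumes "z \<in> lattice w"
  shows "deriv (theta w) z \<noteq> 0"
proof -
  define r where "r = (\<lambda>z. qprod (ee w) (ee w * ee z) * qprod (ee w) (ee (w - z)))"
  have r: "theta w z = (1 - ee z) * r z" for z
    unfolding theta_def r_def by (subst qprod_rec[OF norm_ee_less_1]) simp
  have q: "(\<lambda>z. qprod (ee w) (h z)) holomorphic_on UNIV" if "h holomorphic_on UNIV" for h
    using holomorphic_on_compose_gen[OF that qprod_holomorphic[OF norm_ee_less_1]] by (simp add: o_def)
  have "r holomorphic_on UNIV"
    unfolding r_def by (intro holomorphic_intros q ee_holomorphic)
  then have dr: "(r has_field_derivative deriv r 0) (at 0)"
    using holomorphic_derivI by blast
  have "((\<lambda>z. (1 - ee z) * r z) has_field_derivative - (2 * of_real pi * \<i>) * r 0) (at 0)"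
    by (rule derivative_eq_intros DERIV_ee dr | simp)+
  then have d0: "(theta w has_field_derivative - (2 * of_real pi * \<i>) * r 0) (at 0)"
    by (simp add: r[abs_def])
  have "qprod (ee w) (ee w) \<noteq> 0"
  proof
    assume "qprod (ee w) (ee w) = 0"
    then obtain n where "ee w ^ n * ee w = 1" by (auto simp: qprod_eq_0_iff[OF norm_ee_less_1])
    then have "norm (ee w) ^ Suc n = 1" by (metis norm_one norm_power power_Suc2)
    moreover have "norm (ee w) > 0" by simp
    ultimately show False using power_Suc_less_one[of "norm (ee w)" n] norm_ee_less_1 by simp
  qed
  then have r0: "r 0 \<noteq> 0" by (simp add: r_def)
  obtain c n where c: "c \<noteq> 0" "\<And>x. theta w (x + z) = c * ee (- of_int n * x) * theta w x"
    using theta_add_lattice[OF assms] by blast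
  have "((\<lambda>x. c * ee (- of_int n * x) * theta w x) has_field_derivative c * (- (2 * of_real pi * \<i>) * r 0)) (at 0)"
  proof -
    have e: "((\<lambda>x. ee (- of_int n * x)) has_field_derivative 2 * of_real pi * \<i> * ee (- of_int n * 0) * (- of_int n)) (at 0)"
      by (rule DERIV_chain2[OF DERIV_ee]) (auto intro!: derivative_eq_intros)
    have t0: "theta w 0 = 0" by (simp add: theta_eq_0_iff)
    show ?thesis
      by (rule DERIV_cong[OF DERIV_mult[OF DERIV_cmult[OF e] d0]]) (simp add: t0)
  qed
  moreover have "((\<lambda>x. theta w (x + z)) has_field_derivative deriv (theta w) z) (at 0)"
    using DERIV_shift[of "theta w" "deriv (theta w) z" 0 z] DERIV_theta[of z] by simp
  ultimately have "deriv (theta w) z = c * (- (2 * of_real pi * \<i>) * r 0)"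
    unfolding c using DERIV_unique by blast
  then show ?thesis using c r0 by simp
qed

end

subsection \<open>Spaces of theta functions of fixed degree\<close>

text \<open>\<open>P\<close> may take values in any type: it is mostly applied to predicates such as
  the vanishing of a quasi-periodic function, or to a norm, which are truly periodic.\<close>

lemma lattice_periodic:
  assumes 1: "\<And>z. P (z + 1) = P z" and 2: "\<And>z. P (z + w) = P z" and l: "l \<in> lattice w"
  shows "P (z + l) = P z"
proof -
  have int: "P (z + of_int n * x) = P z" if x: "\<And>z. P (z + x) = P z" for n :: int and x z
  proof (induction n rule: int_induct[of _ 0])
    case (step1 i)
    then show ?case using x[of "z + of_int i * x"] by (simp add: algebra_simps)
  next
    case (step2 i)
    then show ?case using x[of "z + of_int (i - 1) * x"] by (simp add: algebra_simps)
  qed simp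
  obtain m n where "l = of_int m + of_int n * w" using l by (auto simp: lattice_def)
  then have "P (z + l) = P (z + of_int m * 1 + of_int n * w)" by (simp add: add_ac)
  then show ?thesis by (simp only: int[OF 1] int[OF 2])
qed

text \<open>The multiplier of a product of \<open>k\<close> translates of \<open>theta\<close> by
  amounts with sum \<open>s\<close>: by \<open>theta_add_w\<close>, translation by \<open>a\<close>
  contributes \<open>- ee (a - z)\<close>.\<close>

definition theta_factor :: "nat \<Rightarrow> complex \<Rightarrow> complex \<Rightarrow> complex" where
  "theta_factor k s z = (-1) ^ k * ee (s - of_nat k * z)"

text \<open>The holomorphic sections of a line bundle of degree \<open>k\<close> on the torus. The
  common multiplier makes quotients of members doubly periodic.\<close>

definition theta_space :: "complex \<Rightarrow> nat \<Rightarrow> complex \<Rightarrow> (complex \<Rightarrow> complex) set" where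
  "theta_space w k s = {g. g holomorphic_on UNIV \<and> (\<forall>z. g (z + 1) = g z) \<and> (\<forall>z. g (z + w) = theta_factor k s z * g z)}"

lemma theta_spaceD:
  assumes "g \<in> theta_space w k s"
  shows "g holomorphic_on UNIV" "g (z + 1) = g z" "g (z + w) = theta_factor k s z * g z"
  using assms by (auto simp: theta_space_def)

lemma theta_factor_nz: "theta_factor k s z \<noteq> 0"
  by (simp add: theta_factor_def)

lemma DERIV_theta_factor:
  "(theta_factor k s has_field_derivative (- 2 * of_real pi * \<i> * of_nat k) * theta_factor k s z) (at z)"
proof -
  have "((\<lambda>z. ee (s - of_nat k * z)) has_field_derivative 2 * of_real pi * \<i> * ee (s - of_nat k * z) * (- of_nat k)) (at z)"
    by (rule DERIV_chain2[OF DERIV_ee]) (auto intro!: derivative_eq_intros)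
  from DERIV_cmult[OF this, of "(-1) ^ k"] show ?thesis
    unfolding theta_factor_def[abs_def] by (simp add: mult_ac)
qed

lemma theta_space_combination:
  assumes "f \<in> theta_space w k s" "g \<in> theta_space w k s"
  shows "(\<lambda>z. f z + c * g z) \<in> theta_space w k s"
  using assms by (auto simp: theta_space_def algebra_simps intro!: holomorphic_intros)

definition theta_prod :: "complex \<Rightarrow> complex list \<Rightarrow> complex \<Rightarrow> complex" where
  "theta_prod w as z = prod_list (map (\<lambda>a. theta w (z - a)) as)"

text \<open>\<open>T^2\<close> times the derivative of \<open>g / T\<close>, in a form that stays
  meaningful at the zeros of \<open>T\<close>.\<close>

definition wronskian :: "(complex \<Rightarrow> complex) \<Rightarrow> (complex \<Rightarrow> complex) \<Rightarrow> complex \<Rightarrow> complex" where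
  "wronskian g T z = deriv g z * T z - g z * deriv T z"

lemma wronskian_combination:
  assumes "f holomorphic_on UNIV" "g holomorphic_on UNIV"
  shows "wronskian (\<lambda>z. f z + c * g z) T z = wronskian f T z + c * wronskian g T z"
proof -
  have "(f has_field_derivative deriv f z) (at z)" "(g has_field_derivative deriv g z) (at z)"
    using holomorphic_derivI[OF assms(1)] holomorphic_derivI[OF assms(2)] by auto
  then have "deriv (\<lambda>z. f z + c * g z) z = deriv f z + c * deriv g z"
    by (intro DERIV_imp_deriv DERIV_add DERIV_cmult)
  then show ?thesis by (simp add: wronskian_def algebra_simps)
qed

lemma wronskian_eq_0_lattice:
  assumes g: "g \<in> theta_space w k s" and T: "T \<in> theta_space w k s" and l: "l \<in> lattice w"
  shows "wronskian g T (z + l) = 0 \<longleftrightarrow> wronskian g T z = 0"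
proof (rule lattice_periodic[where P="\<lambda>z. wronskian g T z = 0", OF _ _ l])
  fix z
  note d = deriv_quasi_periodic[where M="\<lambda>_. 1" and w=1 and c=0]
  have "wronskian g T (z + 1) = wronskian g T z"
    using d[OF theta_spaceD(1)[OF g]] d[OF theta_spaceD(1)[OF T]] theta_spaceD(2)[OF g] theta_spaceD(2)[OF T]
    by (simp add: wronskian_def)
  then show "(wronskian g T (z + 1) = 0) = (wronskian g T z = 0)" by simp
  note d' = deriv_quasi_periodic[OF _ _ DERIV_theta_factor]
  have "wronskian g T (z + w) = (theta_factor k s z)\<^sup>2 * wronskian g T z"
    unfolding wronskian_def theta_spaceD(3)[OF g] theta_spaceD(3)[OF T]
      d'[OF theta_spaceD(1)[OF g] theta_spaceD(3)[OF g]] d'[OF theta_spaceD(1)[OF T] theta_spaceD(3)[OF T]]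
    by (simp add: algebra_simps power2_eq_square)
  then show "(wronskian g T (z + w) = 0) = (wronskian g T z = 0)" by (simp add: theta_factor_nz)
qed

text \<open>A complex vector space is not a finite union of kernels of nonzero functionals;
  \<open>V\<close> only has to be closed under \<open>f + c g\<close>.\<close>

lemma exists_common_nonvanishing:
  fixes V :: "('a \<Rightarrow> complex) set" and \<phi> :: "'c \<Rightarrow> ('a \<Rightarrow> complex) \<Rightarrow> complex"
  assumes "finite C" and V: "\<And>f g c. f \<in> V \<Longrightarrow> g \<in> V \<Longrightarrow> (\<lambda>z. f z + c * g z) \<in> V"
    and lin: "\<And>x f g c. f \<in> V \<Longrightarrow> g \<in> V \<Longrightarrow> \<phi> x (\<lambda>z. f z + c * g z) = \<phi> x f + c * \<phi> x g"
    and "V \<noteq> {}" and ex: "\<And>x. x \<in> C \<Longrightarrow> \<exists>g\<in>V. \<phi> x g \<noteq> 0"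
  shows "\<exists>g\<in>V. \<forall>x\<in>C. \<phi> x g \<noteq> 0"
  using assms(1) ex
proof (induction C rule: finite_induct)
  case empty
  then show ?case using \<open>V \<noteq> {}\<close> by auto
next
  case (insert x C)
  then obtain g0 where g0: "g0 \<in> V" "\<And>y. y \<in> C \<Longrightarrow> \<phi> y g0 \<noteq> 0" by auto
  obtain g1 where g1: "g1 \<in> V" "\<phi> x g1 \<noteq> 0" using insert.prems by auto
  \<comment> \<open>Each point of \<open>insert x C\<close> forbids at most one coefficient
    \<open>c\<close>. Where \<open>\<phi> y g1 = 0\<close> the quotient is 0 by convention, and
    excluding that value does no harm.\<close>
  have "finite ((\<lambda>y. - \<phi> y g0 / \<phi> y g1) ` insert x C)" using insert.hyps by auto
  then obtain c where c: "c \<notin> (\<lambda>y. - \<phi> y g0 / \<phi> y g1) ` insert x C"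
    using ex_new_if_finite[OF infinite_UNIV_char_0] by metis
  have "\<phi> y (\<lambda>z. g0 z + c * g1 z) \<noteq> 0" if y: "y \<in> insert x C" for y
  proof (cases "\<phi> y g1 = 0")
    case True
    then have "y \<in> C" using y g1 by auto
    then show ?thesis using g0 True by (simp add: lin[OF g0(1) g1(1)])
  next
    case False
    have "c \<noteq> - \<phi> y g0 / \<phi> y g1" using c y by blast
    then show ?thesis using False by (simp add: lin[OF g0(1) g1(1)] field_simps add_eq_0_iff)
  qed
  then show ?case using V[OF g0(1) g1(1)] by blast
qed

lemma entire_quotient:
  assumes E: "E holomorphic_on UNIV" and Q: "Q holomorphic_on UNIV"
    and simple: "\<And>z. Q z = 0 \<Longrightarrow> deriv Q z \<noteq> 0" and zero: "\<And>z. Q z = 0 \<Longrightarrow> E z = 0"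
  obtains h where "h holomorphic_on UNIV" "\<And>z. E z = Q z * h z"
proof -
  define h where "h = (\<lambda>z. if Q z = 0 then deriv E z / deriv Q z else E z / Q z)"
  have "h field_differentiable (at z0)" for z0
  proof (cases "Q z0 = 0")
    case False
    have "open {z. Q z \<noteq> 0}"
      using holomorphic_on_imp_continuous_on[OF Q] by (intro open_Collect_neq continuous_intros)
    moreover have "(\<lambda>z. E z / Q z) holomorphic_on {z. Q z \<noteq> 0}"
      using E Q by (auto intro!: holomorphic_intros intro: holomorphic_on_subset)
    then have "h holomorphic_on {z. Q z \<noteq> 0}"
      by (rule holomorphic_transform) (auto simp: h_def)
    ultimately show ?thesis
      using False by (auto intro: holomorphic_on_imp_differentiable_at)
  next
    case True
    \<comment> \<open>Both functions are divided by \<open>z - z0\<close>: \<open>e\<close> and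
      \<open>q\<close> are entire, \<open>q z0 = deriv Q z0\<close> is nonzero, and
      \<open>h = e / q\<close> wherever \<open>q\<close> does not vanish.\<close>
    define e where "e = (\<lambda>z. if z = z0 then deriv E z0 else (E z - E z0) / (z - z0))"
    define q where "q = (\<lambda>z. if z = z0 then deriv Q z0 else (Q z - Q z0) / (z - z0))"
    have e: "e holomorphic_on UNIV" unfolding e_def by (rule pole_lemma[OF E]) auto
    have q: "q holomorphic_on UNIV" unfolding q_def by (rule pole_lemma[OF Q]) auto
    have "open {z. q z \<noteq> 0}"
      using holomorphic_on_imp_continuous_on[OF q] by (intro open_Collect_neq continuous_intros)
    moreover have "(\<lambda>z. e z / q z) holomorphic_on {z. q z \<noteq> 0}"
      using e q by (auto intro!: holomorphic_intros intro: holomorphic_on_subset)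
    then have "h holomorphic_on {z. q z \<noteq> 0}"
      by (rule holomorphic_transform) (use True zero[OF True] in \<open>auto simp: h_def e_def q_def split: if_splits\<close>)
    moreover have "q z0 \<noteq> 0" using simple[OF True] by (simp add: q_def)
    ultimately show ?thesis
      by (auto intro: holomorphic_on_imp_differentiable_at)
  qed
  then have "h holomorphic_on UNIV" by (auto simp: holomorphic_on_def)
  moreover have "E z = Q z * h z" for z using zero by (simp add: h_def)
  ultimately show ?thesis using that by blast
qed

section \<open>Theta functions with prescribed zeros\<close>

context
  fixes w :: complex
  assumes w: "Im w > 0"
begin

lemma theta_prod_space: "theta_prod w as \<in> theta_space w (length as) (sum_list as)"
proof (induction as)
  case Nil
  show ?case by (auto simp: theta_space_def theta_prod_def theta_factor_def)
next
  case (Cons a as)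
  have eq: "theta_prod w (a # as) z = theta w (z - a) * theta_prod w as z" for z
    by (simp add: theta_prod_def)
  have h: "(\<lambda>z. theta w (z - a)) holomorphic_on UNIV"
    by (intro theta_holomorphic[OF w] holomorphic_intros)
  have 1: "theta w (z + 1 - a) = theta w (z - a)" for z
    using theta_add_1[OF w, of "z - a"] by (simp add: algebra_simps)
  have 2: "theta w (z + w - a) = - ee (a - z) * theta w (z - a)" for z
    using theta_add_w[OF w, of "z - a"] by (simp add: algebra_simps)
  have 3: "theta_factor (Suc n) (a + s) z = - ee (a - z) * theta_factor n s z" for n s z
    unfolding theta_factor_def by (simp add: ee_add[symmetric] algebra_simps)
  show ?case
    using theta_spaceD[OF Cons]
    by (auto simp: theta_space_def eq[abs_def] 1 2 3 intro!: holomorphic_on_mult h)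
qed

lemma theta_prod_holomorphic: "theta_prod w as holomorphic_on UNIV"
  using theta_spaceD(1)[OF theta_prod_space] .

lemma theta_prod_eq_0_iff: "theta_prod w as z = 0 \<longleftrightarrow> (\<exists>a\<in>set as. z - a \<in> lattice w)"
  by (auto simp: theta_prod_def prod_list_zero_iff theta_eq_0_iff[OF w])

lemma deriv_theta_prod:
  assumes z: "z - a \<in> lattice w"
  shows "deriv (theta_prod w (xs @ a # ys)) z = deriv (theta w) (z - a) * theta_prod w (xs @ ys) z"
proof -
  have eq: "theta_prod w (xs @ a # ys) = (\<lambda>z. theta w (z - a) * theta_prod w (xs @ ys) z)"
    by (simp add: theta_prod_def fun_eq_iff mult_ac)
  have "((\<lambda>z. theta w (z - a)) has_field_derivative deriv (theta w) (z - a)) (at z)"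
    using DERIV_shift[of "theta w" "deriv (theta w) (z - a)" z "- a"] DERIV_theta[OF w, of "z - a"] by simp
  moreover have "(theta_prod w (xs @ ys) has_field_derivative deriv (theta_prod w (xs @ ys)) z) (at z)"
    using holomorphic_derivI[OF theta_prod_holomorphic] by blast
  ultimately have "(theta_prod w (xs @ a # ys) has_field_derivative
      deriv (theta w) (z - a) * theta_prod w (xs @ ys) z + deriv (theta_prod w (xs @ ys)) z * theta w (z - a)) (at z)"
    unfolding eq by (rule DERIV_mult)
  moreover have "theta w (z - a) = 0" using z by (simp add: theta_eq_0_iff[OF w])
  ultimately show ?thesis by (auto intro: DERIV_imp_deriv)
qed

lemma deriv_theta_prod_nonzero:
  assumes as: "distinct as" and inc: "\<And>a b. a \<in> set as \<Longrightarrow> b \<in> set as \<Longrightarrow> a - b \<in> lattice w \<Longrightarrow> a = b"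
    and z: "theta_prod w as z = 0"
  shows "deriv (theta_prod w as) z \<noteq> 0"
proof -
  obtain a where a: "a \<in> set as" "z - a \<in> lattice w" using z by (auto simp: theta_prod_eq_0_iff)
  then obtain xs ys where xy: "as = xs @ a # ys" by (meson split_list)
  have "theta_prod w (xs @ ys) z \<noteq> 0"
  proof
    assume "theta_prod w (xs @ ys) z = 0"
    then obtain b where b: "b \<in> set (xs @ ys)" "z - b \<in> lattice w" by (auto simp: theta_prod_eq_0_iff)
    have "b - a \<in> lattice w" using lattice_diff[OF a(2) b(2)] by simp
    then have "b = a" using inc[of b a] b xy by auto
    then show False using b as xy by auto
  qed
  then show ?thesis
    unfolding xy deriv_theta_prod[OF a(2)] using deriv_theta_nonzero[OF w a(2)] by simp
qed

text \<open>The zeros are \<open>c\<close>, then \<open>a\<close> repeated \<open>k - 2\<close>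
  times, then \<open>b\<close>, which the prescribed sum \<open>s\<close> determines. As
  \<open>k - 2\<close> is positive, \<open>b\<close> moves with \<open>a\<close>, so both can avoid
  the lattice translates of \<open>c\<close>.\<close>

lemma exists_simple_zero:
  assumes k: "k \<ge> 3"
  shows "\<exists>g\<in>theta_space w k s. g c = 0 \<and> deriv g c \<noteq> 0"
proof -
  \<comment> \<open>The forbidden offsets \<open>e = a - c\<close>: the first set makes
    \<open>a\<close> congruent to \<open>c\<close>, the second makes \<open>b\<close> congruent to
    \<open>c\<close>. Both are countable.\<close>
  define B where "B = lattice w \<union> (\<lambda>l. (s - of_nat k * c - l) / of_nat (k - 2)) ` lattice w"
  have "countable B" unfolding B_def using countable_lattice by auto
  then obtain e where e: "e \<notin> B"
    using uncountable_UNIV_complex by (metis UNIV_eq_I)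
  define a where "a = c + e"
  define b where "b = s - c - of_nat (k - 2) * a"
  define ys where "ys = b # replicate (k - 2) a"
  have g: "theta_prod w (c # ys) \<in> theta_space w k s"
  proof -
    have "length (c # ys) = k" "sum_list (c # ys) = s"
      using k by (auto simp: ys_def b_def sum_list_replicate)
    then show ?thesis using theta_prod_space[of "c # ys"] by simp
  qed
  have "theta_prod w ys c \<noteq> 0"
  proof
    assume "theta_prod w ys c = 0"
    then consider "c - b \<in> lattice w" | "c - a \<in> lattice w"
      by (auto simp: theta_prod_eq_0_iff ys_def)
    then show False
    proof cases
      case 1
      have "of_nat (k - 2) + 2 = (of_nat k :: complex)" using k by (simp add: of_nat_diff)
      then have k2: "(of_nat k :: complex) = of_nat (k - 2) + 2" by simp
      have "s - of_nat k * c - (b - c) = of_nat (k - 2) * e"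
        unfolding k2 b_def a_def by (simp add: algebra_simps)
      moreover have "of_nat (k - 2) \<noteq> (0::complex)" unfolding of_nat_eq_0_iff using k by simp
      ultimately have "e = (s - of_nat k * c - (b - c)) / of_nat (k - 2)"
        using nonzero_mult_div_cancel_left by metis
      moreover have "b - c \<in> lattice w" using lattice_minus[OF 1] by simp
      ultimately show False using e by (auto simp: B_def)
    next
      case 2
      then have "e \<in> lattice w" using lattice_minus[OF 2] by (simp add: a_def)
      then show False using e by (auto simp: B_def)
    qed
  qed
  then have "deriv (theta_prod w (c # ys)) c \<noteq> 0"
    using deriv_theta_prod[of c c "[]" ys] deriv_theta_nonzero[OF w lattice_0] by simp
  moreover have "theta_prod w (c # ys) c = 0" by (simp add: theta_prod_eq_0_iff)
  ultimately show ?thesis using g by blast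
qed

lemma bounded_fund_dom: "bounded (fund_dom w)"
proof -
  have "norm z \<le> 1 + norm w" if zf: "z \<in> fund_dom w" for z
  proof -
    obtain s t where z: "z = of_real s + of_real t * w" "0 \<le> s" "s < 1" "0 \<le> t" "t < 1"
      using zf by (auto simp: fund_dom_def)
    have "norm z \<le> \<bar>s\<bar> + \<bar>t\<bar> * norm w"
      unfolding z using norm_triangle_ineq[of "of_real s" "of_real t * w"] by (simp add: norm_mult)
    also have "\<dots> \<le> 1 + 1 * norm w" using z by (intro add_mono mult_right_mono) auto
    finally show ?thesis by simp
  qed
  then show ?thesis by (auto simp: bounded_iff)
qed

text \<open>With \<open>s = ln (norm b) / Im w\<close> the factor \<open>exp (\<i> s z)\<close> has
  modulus \<open>exp (- s * Im z)\<close>, which compensates \<open>norm b\<close> under the shift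
  by \<open>w\<close> and is unchanged under the shift by 1. So \<open>norm H\<close> is doubly
  periodic, hence bounded, and Liouville's theorem applies to \<open>H\<close>.\<close>

lemma multiplicative_entire:
  assumes h: "h holomorphic_on UNIV" and 1: "\<And>z. h (z + 1) = h z" and 2: "\<And>z. h (z + w) = b * h z" and b: "b \<noteq> 0"
  shows "\<exists>c. \<forall>z. h z = c * exp (- (\<i> * of_real (ln (norm b) / Im w)) * z)"
proof -
  define s where "s = ln (norm b) / Im w"
  define H where "H = (\<lambda>z. h z * exp (\<i> * of_real s * z))"
  have H: "H holomorphic_on UNIV" unfolding H_def by (intro holomorphic_intros h)
  have n1: "norm (H (z + 1)) = norm (H z)" for z
    by (simp add: H_def 1 norm_mult)
  have n2: "norm (H (z + w)) = norm (H z)" for z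
  proof -
    have "s * Im w = ln (norm b)" using w by (simp add: s_def)
    then have "exp (- (s * Im z) - s * Im w) = exp (- (s * Im z)) / norm b"
      using b by (simp add: exp_diff)
    then show ?thesis using b by (simp add: H_def 2 norm_mult distrib_left)
  qed
  have "compact (closure (fund_dom w))" using bounded_fund_dom by simp
  moreover have "continuous_on (closure (fund_dom w)) H"
    using holomorphic_on_imp_continuous_on[OF H] continuous_on_subset by blast
  ultimately have "bounded (H ` closure (fund_dom w))"
    using compact_continuous_image compact_imp_bounded by blast
  then obtain B where B: "\<And>z. z \<in> closure (fund_dom w) \<Longrightarrow> norm (H z) \<le> B"
    by (auto simp: bounded_iff)
  have "norm (H z) \<le> B" for z
  proof -
    obtain l where l: "l \<in> lattice w" "z + l \<in> fund_dom w"
      using fund_dom_representative[OF w] by blast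
    have "norm (H (z + l)) = norm (H z)"
      by (rule lattice_periodic[where P="\<lambda>z. norm (H z)", OF n1 n2 l(1)])
    then show ?thesis using B[of "z + l"] l(2) closure_subset by fastforce
  qed
  then have "bounded (range H)" by (auto simp: bounded_iff)
  then obtain c where c: "\<And>z. H z = c"
    using Liouville_theorem[OF H] by (auto simp: constant_on_def)
  have "h z = c * exp (- (\<i> * of_real s) * z)" for z
    using c[of z] by (simp add: H_def exp_minus field_simps)
  then show ?thesis unfolding s_def by blast
qed

text \<open>\<open>Q\<close> is a theta product with simple zeros exactly at the translates of
  \<open>Z\<close>. The quotients of \<open>E1\<close> and \<open>E2\<close> by \<open>Q\<close> are
  entire with the same multiplier \<open>ee (s - sum_list as)\<close>, so both are constant
  multiples of one exponential.\<close>

lemma theta_space_dependent: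
  assumes E1: "E1 \<in> theta_space w k s" and E2: "E2 \<in> theta_space w k s"
    and Z: "finite Z" "card Z = k" "Z \<subseteq> fund_dom w" and zero: "\<And>z. z \<in> Z \<Longrightarrow> E1 z = 0 \<and> E2 z = 0"
    and ne: "\<exists>z. E1 z \<noteq> 0"
  shows "\<exists>\<kappa>. \<forall>z. E2 z = \<kappa> * E1 z"
proof -
  obtain as where as: "set as = Z" "distinct as" using finite_distinct_list[OF Z(1)] by blast
  have len: "length as = k" using as Z(2) distinct_card by metis
  define Q where "Q = theta_prod w as"
  have Qs: "Q \<in> theta_space w k (sum_list as)" using theta_prod_space[of as] by (simp add: Q_def len)
  have Qh: "Q holomorphic_on UNIV" using theta_spaceD(1)[OF Qs] .
  have simple: "deriv Q z \<noteq> 0" if "Q z = 0" for z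
    unfolding Q_def
  proof (rule deriv_theta_prod_nonzero[OF as(2)])
    show "a = b" if "a \<in> set as" "b \<in> set as" "a - b \<in> lattice w" for a b
      using fund_dom_lattice_eq[OF w _ _ that(3)] that Z(3) as(1) by blast
  qed (use that Q_def in simp)
  have quot: "\<exists>c. \<forall>z. E z = Q z * (c * exp (- (\<i> * of_real (ln (norm (ee (s - sum_list as))) / Im w)) * z))"
    if E: "E \<in> theta_space w k s" and E0: "\<And>z. z \<in> Z \<Longrightarrow> E z = 0" for E
  proof -
    have "E z = 0" if Q0: "Q z = 0" for z
    proof -
      obtain a where a: "a \<in> Z" "z - a \<in> lattice w" using Q0 as by (auto simp: Q_def theta_prod_eq_0_iff)
      have "E (a + (z - a)) = 0 \<longleftrightarrow> E a = 0"
        by (rule lattice_periodic[where P="\<lambda>z. E z = 0", OF _ _ a(2)])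
          (simp_all add: theta_spaceD(2,3)[OF E] theta_factor_nz)
      then show ?thesis using E0[OF a(1)] by simp
    qed
    then obtain h where h: "h holomorphic_on UNIV" "\<And>z. E z = Q z * h z"
      using entire_quotient[OF theta_spaceD(1)[OF E] Qh simple] by blast
    \<comment> \<open>\<open>Q\<close> can be cancelled even at its zeros: if \<open>u\<close> and
      \<open>v\<close> differed at a point they would differ near it, so \<open>Q\<close> would
      vanish on an open set and have derivative 0 there.\<close>
    have cancel: "u z = v z" if uv: "u holomorphic_on UNIV" "v holomorphic_on UNIV" "\<And>z. Q z * u z = Q z * v z"
      for u v :: "complex \<Rightarrow> complex" and z
    proof (rule ccontr)
      assume ne: "u z \<noteq> v z"
      have "open {z. u z \<noteq> v z}"
        using uv(1,2)[THEN holomorphic_on_imp_continuous_on] by (intro open_Collect_neq)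
      moreover have "Q y = 0" if "y \<in> {z. u z \<noteq> v z}" for y using uv(3)[of y] that by auto
      ultimately have "deriv Q z = deriv (\<lambda>_. 0) z"
        using ne by (intro deriv_cong_ev) (auto simp: eventually_nhds)
      then show False using simple[of z] uv(3)[of z] ne by auto
    qed
    have shift: "(\<lambda>z. h (z + a)) holomorphic_on UNIV" for a
    proof -
      have "(\<lambda>z. z + a) holomorphic_on UNIV" by (intro holomorphic_intros)
      from holomorphic_on_compose_gen[OF this h(1)] show ?thesis by (simp add: o_def)
    qed
    have 1: "h (z + 1) = h z" for z
    proof (rule cancel[where u="\<lambda>z. h (z + 1)" and v=h])
      show "(\<lambda>z. h (z + 1)) holomorphic_on UNIV" by (rule shift)
      show "Q z * h (z + 1) = Q z * h z" for z
        using h(2)[of "z + 1"] h(2)[of z] theta_spaceD(2)[OF Qs] theta_spaceD(2)[OF E] by auto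
    qed (rule h(1))
    have 2: "h (z + w) = ee (s - sum_list as) * h z" for z
    proof (rule cancel[where u="\<lambda>z. h (z + w)" and v="\<lambda>z. ee (s - sum_list as) * h z"])
      show "(\<lambda>z. h (z + w)) holomorphic_on UNIV" by (rule shift)
      show "(\<lambda>z. ee (s - sum_list as) * h z) holomorphic_on UNIV" by (intro holomorphic_intros h(1))
      show "Q z * h (z + w) = Q z * (ee (s - sum_list as) * h z)" for z
      proof -
        have "theta_factor k (sum_list as) z * (Q z * h (z + w)) = theta_factor k s z * (Q z * h z)"
          using h(2)[of "z + w"] h(2)[of z] theta_spaceD(3)[OF Qs, of z] theta_spaceD(3)[OF E, of z] by auto
        also have "theta_factor k s z = theta_factor k (sum_list as) z * ee (s - sum_list as)"
          unfolding theta_factor_def by (simp add: ee_add[symmetric])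
        finally have "theta_factor k (sum_list as) z * (Q z * h (z + w)) = theta_factor k (sum_list as) z * (Q z * (ee (s - sum_list as) * h z))"
          by (simp add: mult_ac)
        then show ?thesis using theta_factor_nz by (simp only: mult_cancel_left) simp
      qed
    qed
    show ?thesis
      using multiplicative_entire[OF h(1) 1 2 ee_nz] h(2) by auto
  qed
  obtain c1 where c1: "\<And>z. E1 z = Q z * (c1 * exp (- (\<i> * of_real (ln (norm (ee (s - sum_list as))) / Im w)) * z))"
    using quot[OF E1] zero by blast
  obtain c2 where c2: "\<And>z. E2 z = Q z * (c2 * exp (- (\<i> * of_real (ln (norm (ee (s - sum_list as))) / Im w)) * z))"
    using quot[OF E2] zero by blast
  have "c1 \<noteq> 0" using ne c1 by auto
  then have "E2 z = (c2 / c1) * E1 z" for z unfolding c1 c2 by (simp add: field_simps)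
  then show ?thesis by blast
qed

end

text \<open>The vanishing of the Wronskian of \<open>G1\<close> at 0, together with the immersion condition, prevents
  \<open>G2 / T\<close> from being an affine function of \<open>G1 / T\<close>.\<close>

lemma exists_curve:
  assumes w: "Im w > 0" and k: "k \<ge> 3"
  obtains G1 G2 T ps where
    "G1 \<in> theta_space w k (1/2)" "G2 \<in> theta_space w k (1/2)" "T \<in> theta_space w k (1/2)"
    "\<And>z. G1 z \<noteq> 0 \<or> G2 z \<noteq> 0" "\<And>z. T z = 0 \<Longrightarrow> deriv T z \<noteq> 0"
    "\<And>z. wronskian G1 T z \<noteq> 0 \<or> wronskian G2 T z \<noteq> 0"
    "wronskian G1 T 0 = 0" "\<And>z. T z = 0 \<Longrightarrow> G1 z \<noteq> 0"
    "{z \<in> fund_dom w. T z = 0} = ps" "finite ps" "card ps = k"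
proof -
  \<comment> \<open>The poles: distinct reals with sum 1/2 over \<open>j = 1..k\<close>. For
    \<open>k \<ge> 3\<close> they lie in \<open>(0, 1/4]\<close>, so they are incongruent to each
    other and to 0 and 1/2, the zeros of \<open>G1\<close>.\<close>
  define p where "p = (\<lambda>j::nat. real j / (real k * (real k + 1)))"
  have kk: "real k * (real k + 1) > 0" using k by simp
  have p_range: "0 < p j" "p j \<le> 1/4" if "j \<in> {1..k}" for j
  proof -
    show "0 < p j" using that k by (simp add: p_def)
    have "p j \<le> real k / (real k * (real k + 1))"
      unfolding p_def using that kk by (intro divide_right_mono) auto
    also have "\<dots> = 1 / (real k + 1)" using k by simp
    also have "\<dots> \<le> 1/4" using k by (simp add: field_simps)
    finally show "p j \<le> 1/4" .
  qed
  have p_inj: "inj p" using kk by (auto simp: inj_on_def p_def)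
  define pl where "pl = map (\<lambda>j. complex_of_real (p j)) [1..<Suc k]"
  have set_pl: "set pl = (\<lambda>j. complex_of_real (p j)) ` {1..k}" by (auto simp: pl_def)
  have inj: "inj_on (\<lambda>j. complex_of_real (p j)) A" for A
    using p_inj by (auto simp: inj_on_def)
  have dist: "distinct pl" unfolding pl_def by (simp add: distinct_map inj del: upt_Suc)
  have len: "length pl = k" by (simp add: pl_def)
  have sum: "sum_list pl = 1/2"
  proof -
    have "(\<Sum>j=1..n. real j) = real n * (real n + 1) / 2" for n
      by (induction n) (auto simp: field_simps)
    then have S: "(\<Sum>j=1..k. p j) = 1/2"
      using kk k by (simp add: p_def sum_divide_distrib[symmetric])
    have "sum_list pl = (\<Sum>j\<in>{1..k}. complex_of_real (p j))"
      unfolding pl_def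
      by (simp add: interv_sum_list_conv_sum_set_nat atLeastLessThanSuc_atLeastAtMost del: upt_Suc)
    also have "\<dots> = of_real (\<Sum>j=1..k. p j)" by simp
    finally show ?thesis unfolding S by simp
  qed
  have small: "r = 0" if "of_real r \<in> lattice w" "\<bar>r\<bar> < 1" for r :: real
    using that lattice_real_iff[OF w, of r] by (auto simp: Ints_def)
  define T where "T = theta_prod w pl"
  have T: "T \<in> theta_space w k (1/2)" using theta_prod_space[OF w, of pl] by (simp add: T_def len sum)
  have T0: "T z = 0 \<longleftrightarrow> (\<exists>j\<in>{1..k}. z - of_real (p j) \<in> lattice w)" for z
    by (auto simp: T_def theta_prod_eq_0_iff[OF w] set_pl)
  have T_simple: "deriv T z \<noteq> 0" if "T z = 0" for z
    unfolding T_def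
  proof (rule deriv_theta_prod_nonzero[OF w dist])
    fix a b assume "a \<in> set pl" "b \<in> set pl" and ab: "a - b \<in> lattice w"
    then obtain i j where ij: "a = of_real (p i)" "b = of_real (p j)" "i \<in> {1..k}" "j \<in> {1..k}"
      by (auto simp: set_pl)
    have "p i - p j = 0"
      using ab p_range[OF ij(3)] p_range[OF ij(4)] by (intro small) (auto simp: ij)
    then show "a = b" by (simp add: ij)
  qed (use that T_def in simp)
  \<comment> \<open>\<open>G1\<close> has a zero of order \<open>k - 1 \<ge> 2\<close> at 0 and one
    at 1/2. The multiple zero gives a critical point of \<open>G1 / T\<close> at 0, and having only
    two zeros modulo the lattice makes common zeros with \<open>G2\<close> easy to avoid.\<close>
  define gl where "gl = replicate (k - 2) 0 @ [1/2 :: complex]"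
  define G1 where "G1 = theta_prod w (0 # gl)"
  have G1: "G1 \<in> theta_space w k (1/2)"
  proof -
    have ls: "length (0 # gl) = k" "sum_list (0 # gl) = 1/2" using k by (auto simp: gl_def sum_list_replicate)
    show ?thesis using theta_prod_space[OF w, of "0 # gl"] unfolding ls G1_def .
  qed
  have G10: "G1 z = 0 \<longleftrightarrow> z \<in> lattice w \<or> z - 1/2 \<in> lattice w" for z
    using k by (auto simp: G1_def gl_def theta_prod_eq_0_iff[OF w])
  have half: "T 0 \<noteq> 0" "T (1/2) \<noteq> 0"
  proof -
    show "T 0 \<noteq> 0"
    proof
      assume "T 0 = 0"
      then obtain j where j: "j \<in> {1..k}" "0 - complex_of_real (p j) \<in> lattice w" by (auto simp: T0)
      then have "- p j = 0" using p_range[OF j(1)] by (intro small) auto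
      then show False using p_range[OF j(1)] by simp
    qed
    show "T (1/2) \<noteq> 0"
    proof
      assume "T (1/2) = 0"
      then obtain j where j: "j \<in> {1..k}" "1/2 - complex_of_real (p j) \<in> lattice w" by (auto simp: T0)
      then have "1/2 - p j = 0" using p_range[OF j(1)] by (intro small) auto
      then show False using p_range[OF j(1)] by simp
    qed
  qed
  have zero_lattice: "g (z + l) = 0 \<longleftrightarrow> g z = 0" if "g \<in> theta_space w k (1/2)" "l \<in> lattice w" for g z l
    by (rule lattice_periodic[where P="\<lambda>z. g z = 0", OF _ _ that(2)])
      (simp_all add: theta_spaceD(2,3)[OF that(1)] theta_factor_nz)
  have at_zeros: "g 0 = 0 \<or> g (1/2) = 0" if "g \<in> theta_space w k (1/2)" "G1 z = 0" "g z = 0" for g z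
    using zero_lattice[OF that(1), of z 0] zero_lattice[OF that(1), of "z - 1/2" "1/2"] that
    by (auto simp: G10)
  have TG: "G1 z \<noteq> 0" if "T z = 0" for z
    using at_zeros[OF T _ that] half by auto
  have W0: "wronskian G1 T 0 = 0"
  proof -
    have "theta_prod w gl 0 = 0" using k by (auto simp: gl_def theta_prod_eq_0_iff[OF w])
    then have "deriv G1 0 = 0" using deriv_theta_prod[OF w, of 0 0 "[]" gl] by (simp add: G1_def)
    moreover have "G1 0 = 0" by (simp add: G10)
    ultimately show ?thesis by (simp add: wronskian_def)
  qed
  \<comment> \<open>At a pole the Wronskian is \<open>- G1 * deriv T\<close>. Hence it is not
    identically 0, and at its zeros \<open>T\<close> is nonzero, so that a theta function with a
    simple zero there has nonzero Wronskian with \<open>T\<close>.\<close>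
  have W_pole: "wronskian G1 T z \<noteq> 0" if "T z = 0" for z
    using T_simple[OF that] TG[OF that] that by (simp add: wronskian_def)
  define C where "C = {z \<in> closure (fund_dom w). wronskian G1 T z = 0}"
  have "finite C"
    unfolding C_def
  proof (rule holomorphic_compact_finite_zeros)
    show "wronskian G1 T holomorphic_on UNIV"
      unfolding wronskian_def[abs_def] using theta_spaceD(1)[OF G1] theta_spaceD(1)[OF T]
      by (auto intro!: holomorphic_intros)
    show "compact (closure (fund_dom w))" using bounded_fund_dom[OF w] by simp
    have "T (of_real (p 1)) = 0" unfolding T0 using k by (intro bexI[of _ 1]) auto
    then show "\<not> wronskian G1 T constant_on UNIV"
      using W0 W_pole by (metis UNIV_I constant_on_def)
  qed auto
  then have "\<exists>g\<in>theta_space w k (1/2). \<forall>x\<in>C. wronskian g T x \<noteq> 0"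
  proof (rule exists_common_nonvanishing[where \<phi>="\<lambda>x g. wronskian g T x"])
    show "\<exists>g\<in>theta_space w k (1/2). wronskian g T x \<noteq> 0" if "x \<in> C" for x
    proof -
      have "T x \<noteq> 0" using that W_pole by (auto simp: C_def)
      then show ?thesis using exists_simple_zero[OF w k, of "1/2" x] by (force simp: wronskian_def)
    qed
  qed (use T in \<open>auto intro!: theta_space_combination wronskian_combination theta_spaceD(1)\<close>)
  then obtain g where g: "g \<in> theta_space w k (1/2)" "\<And>x. x \<in> C \<Longrightarrow> wronskian g T x \<noteq> 0" by blast
  have g_imm: "wronskian g T z \<noteq> 0" if "wronskian G1 T z = 0" for z
  proof -
    obtain l where l: "l \<in> lattice w" "z + l \<in> fund_dom w" using fund_dom_representative[OF w] by blast
    then have "z + l \<in> C"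
      using that wronskian_eq_0_lattice[OF G1 T l(1)] closure_subset by (auto simp: C_def)
    then show ?thesis using g(2) wronskian_eq_0_lattice[OF g(1) T l(1)] by blast
  qed
  \<comment> \<open>Subtracting \<open>y T\<close> translates \<open>G2 / T\<close> by a constant:
    its Wronskian with \<open>T\<close> is unchanged, while \<open>G2\<close> becomes nonzero at 0
    and 1/2.\<close>
  obtain y where y: "y \<notin> {g 0 / T 0, g (1/2) / T (1/2)}"
    using ex_new_if_finite[OF infinite_UNIV_char_0, of "{g 0 / T 0, g (1/2) / T (1/2)}"] by auto
  define G2 where "G2 = (\<lambda>z. g z + (- y) * T z)"
  have G2: "G2 \<in> theta_space w k (1/2)"
    unfolding G2_def by (rule theta_space_combination[OF g(1) T])
  have W2: "wronskian G2 T z = wronskian g T z" for z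
    unfolding G2_def wronskian_combination[OF theta_spaceD(1)[OF g(1)] theta_spaceD(1)[OF T]]
    by (simp add: wronskian_def)
  have G2_0: "G2 0 \<noteq> 0" "G2 (1/2) \<noteq> 0"
    using y half by (auto simp: G2_def field_simps)
  have zeros: "{z \<in> fund_dom w. T z = 0} = set pl"
  proof -
    have "of_real (p j) \<in> fund_dom w" if "j \<in> {1..k}" for j
      unfolding fund_dom_def using p_range[OF that] by (intro CollectI exI[of _ "p j"] exI[of _ 0]) auto
    then have pl_fd: "set pl \<subseteq> fund_dom w" by (auto simp: set_pl)
    moreover have "T z = 0" if "z \<in> set pl" for z
      using that unfolding T0 set_pl by (auto intro!: bexI)
    moreover have "z \<in> set pl" if "z \<in> fund_dom w" "T z = 0" for z
    proof -
      obtain j where j: "j \<in> {1..k}" "z - of_real (p j) \<in> lattice w" using \<open>T z = 0\<close> by (auto simp: T0)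
      have "z = of_real (p j)"
        by (rule fund_dom_lattice_eq[OF w that(1) _ j(2)]) (use pl_fd j set_pl in auto)
      then show ?thesis using j by (auto simp: set_pl)
    qed
    ultimately show ?thesis by blast
  qed
  show ?thesis
  proof (rule that[OF G1 G2 T _ T_simple _ W0 TG zeros])
    show "G1 z \<noteq> 0 \<or> G2 z \<noteq> 0" for z using at_zeros[OF G2] G2_0 by blast
    show "wronskian G1 T z \<noteq> 0 \<or> wronskian G2 T z \<noteq> 0" for z using g_imm W2 by auto
    show "card (set pl) = k" using distinct_card[OF dist] len by simp
  qed auto
qed

theorem theorem2p3:
  fixes w :: complex and k :: nat
  assumes "w \<in> moduli_M" and "k \<ge> 3"
  shows "\<exists>f :: complex \<Rightarrow> real^4.
           doubly_periodic w f \<and> immersion f \<and> conformal f \<and> willmore_immersion w f \<and>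
           (\<exists>!x. density_pt w f x k) \<and>
           willmore w f = 4 * real k * pi"
proof -
  have w: "Im w > 0" using assms(1) by (simp add: moduli_M_def)
  obtain G1 G2 T ps where G1: "G1 \<in> theta_space w k (1/2)" and G2: "G2 \<in> theta_space w k (1/2)"
    and T: "T \<in> theta_space w k (1/2)" and G_nz: "\<And>z. G1 z \<noteq> 0 \<or> G2 z \<noteq> 0"
    and simple: "\<And>z. T z = 0 \<Longrightarrow> deriv T z \<noteq> 0"
    and imm: "\<And>z. wronskian G1 T z \<noteq> 0 \<or> wronskian G2 T z \<noteq> 0"
    and W0: "wronskian G1 T 0 = 0" and TG: "\<And>z. T z = 0 \<Longrightarrow> G1 z \<noteq> 0"
    and ps: "{z \<in> fund_dom w. T z = 0} = ps" "finite ps" "card ps = k"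
    using exists_curve[OF w assms(2)] by blast
  note holo = theta_spaceD(1)[OF G1] theta_spaceD(1)[OF G2] theta_spaceD(1)[OF T]
  define f where "f = inverted_curve G1 G2 T"
  note W = willmore_inverted_curve[OF holo G_nz simple imm[unfolded wronskian_def] assms(1)
      theta_spaceD(2)[OF G1] theta_spaceD(2)[OF G2] theta_spaceD(2)[OF T]
      theta_spaceD(3)[OF G1] theta_spaceD(3)[OF G2] theta_spaceD(3)[OF T] theta_factor_nz DERIV_theta_factor,
      folded f_def]
  have f0: "{z \<in> fund_dom w. f z = 0} = ps"
    using inverted_curve_eq_0_iff[where ?G1.0=G1 and ?G2.0=G2, OF G_nz] ps(1) by (simp add: f_def)
  have "\<exists>!x. density_pt w f x k"
  proof (rule ex1I[of _ 0])
    show "density_pt w f 0 k" by (simp add: density_pt_def f0 ps)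
    fix x assume x: "density_pt w f x k"
    show "x = 0"
    proof (rule ccontr)
      assume "x \<noteq> 0"
      obtain u v where uv: "x = vec4 u v" using ex_vec4 by blast
      then have uv0: "u \<noteq> 0 \<or> v \<noteq> 0" using \<open>x \<noteq> 0\<close> vec4_eq_0_iff by blast
      \<comment> \<open>\<open>(y1, y2)\<close> is the inverse point of \<open>x\<close>; at each
        preimage of \<open>x\<close> both \<open>G1 - y1 T\<close> and \<open>G2 - y2 T\<close>
        vanish.\<close>
      define y1 where "y1 = u / (u * cnj u + v * cnj v)"
      define y2 where "y2 = v / (u * cnj u + v * cnj v)"
      define E1 where "E1 = (\<lambda>z. G1 z + (- y1) * T z)"
      define E2 where "E2 = (\<lambda>z. G2 z + (- y2) * T z)"
      have E: "E1 \<in> theta_space w k (1/2)" "E2 \<in> theta_space w k (1/2)"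
        unfolding E1_def E2_def by (intro theta_space_combination G1 G2 T)+
      have WE: "wronskian E1 T 0 = wronskian G1 T 0" "wronskian E2 T 0 = wronskian G2 T 0"
        unfolding E1_def E2_def wronskian_combination[OF holo(1,3)] wronskian_combination[OF holo(2,3)]
        by (simp_all add: wronskian_def)
      have "\<exists>\<kappa>. \<forall>z. E2 z = \<kappa> * E1 z"
      proof (rule theta_space_dependent[OF w E])
        show "finite {z \<in> fund_dom w. f z = x}" "card {z \<in> fund_dom w. f z = x} = k"
          using x by (auto simp: density_pt_def)
        show "E1 z = 0 \<and> E2 z = 0" if "z \<in> {z \<in> fund_dom w. f z = x}" for z
          using inverted_curve_eqD[where ?G1.0=G1 and ?G2.0=G2 and T=T and z=z, OF G_nz _ uv0] that
          by (simp add: f_def uv E1_def E2_def y1_def y2_def)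
        \<comment> \<open>At a pole \<open>E1\<close> equals \<open>G1\<close>, which is nonzero
          there.\<close>
        obtain p where "p \<in> ps" using ps(2,3) assms(2) by (metis card.empty ex_in_conv not_numeral_le_zero)
        then have "T p = 0" using ps(1) by auto
        then show "\<exists>z. E1 z \<noteq> 0" using TG[of p] by (intro exI[of _ p]) (simp add: E1_def)
      qed auto
      \<comment> \<open>The proportionality passes to the Wronskians with \<open>T\<close>. At 0
        that of \<open>E1\<close> equals that of \<open>G1\<close>, namely 0, so that of
        \<open>G2\<close> vanishes as well, contradicting the immersion condition at 0.\<close>
      then obtain \<kappa> where "E2 = (\<lambda>z. 0 + \<kappa> * E1 z)" by auto
      then have "wronskian E2 T 0 = wronskian (\<lambda>_. 0) T 0 + \<kappa> * wronskian E1 T 0"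
        using wronskian_combination[OF holomorphic_on_const[of 0] theta_spaceD(1)[OF E(1)]] by simp
      then have "wronskian G2 T 0 = 0" using W0 WE by (simp add: wronskian_def[of "\<lambda>_. 0"])
      then show False using W0 imm[of 0] by simp
    qed
  qed
  then show ?thesis using W by blast
qed

end
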